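(* Let $s_1,s_2\in\mathbb R$, $0<\theta\le\infty$ and $0<\vec q<\vec p<\infty$. Assume that $s_1-\frac1{\mathbf p}=s_2-\frac1{\mathbf q}$. Then the following continuous embeddings hold: $$B_{\vec q,p_n}^{s_2}\hookrightarrow\dot E_{\vec q}^{\vec0,\vec p}B_{p_n}^{s_2}\hookrightarrow F_{\vec p,\theta}^{s_1}.$$
   Context: Conventions: $\vec p=(p_1,\dots,p_n)$, $\vec q=(q_1,\dots,q_n)$; inequalities between vectors are componentwise; $\vec0=(0,\dots,0)$; sums with exponent $\infty$ are replaced by suprema; $\frac1{\mathbf p}=\sum_i\frac1{p_i}$, $\frac1{\mathbf q}=\sum_i\frac1{q_i}$. $X\hookrightarrow Y$ means $X\subset Y$ with $\|f\|_Y\le C\|f\|_X$ for all $f\in X$. $L^{\vec p}(\mathbb R^n)$ is the mixed-norm Lebesgue space, with the $L^{p_i}$ norm taken in $x_i$ successively for $i=1,\dots,n$ ($x_1$ innermost). Mixed-norm Herz spaces: for $k\in\mathbb Z$ let $R_k=\{t\in\mathbb R:2^{k-1}\le|t|<2^k\}$. For $0<p,q\le\infty$, $\alpha\in\mathbb R$ and measurable $g$ on $\mathbb R$, $\|g\|_{\dot K_p^{\alpha,q}}=\big(\sum_{k\in\mathbb Z}2^{k\alpha q}\|g\chi_{R_k}\|_{L^p(\mathbb R)}^q\big)^{1/q}$. The space $\dot E_{\vec p}^{\vec\alpha,\vec q}(\mathbb R^n)$ consists of all measurable $f$ on $\mathbb R^n$ with $\|f\|_{\dot E_{\vec p}^{\vec\alpha,\vec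 q}(\mathbb R^n)}=\big\|\cdots\|f\|_{\dot K_{p_1}^{\alpha_1,q_1}}\cdots\big\|_{\dot K_{p_n}^{\alpha_n,q_n}}<\infty$, quasi-norms taken in $x_i$ successively for $i=1,\dots,n$ ($x_1$ innermost). Smoothness spaces: fix $\Phi,\varphi\in\mathcal S(\mathbb R^n)$ with $\operatorname{supp}\mathcal F\Phi\subset\{|\xi|\le2\}$, $|\mathcal F\Phi(\xi)|\ge c>0$ for $|\xi|\le\frac53$, $\operatorname{supp}\mathcal F\varphi\subset\{\frac12\le|\xi|\le2\}$, $|\mathcal F\varphi(\xi)|\ge c>0$ for $\frac35\le|\xi|\le\frac53$. Put $\varphi_0=\Phi$, $\varphi_k=2^{kn}\varphi(2^k\cdot)$ for $k\ge1$. For $f\in\mathcal S'(\mathbb R^n)$: $\|f\|_{\dot E_{\vec p}^{\vec\alpha,\vec q}B_\beta^s}=\big(\sum_{k\ge0}2^{ks\beta}\|\varphi_k*f\|_{\dot E_{\vec p}^{\vec\alpha,\vec q}(\mathbb R^n)}^\beta\big)^{1/\beta}$, $\|f\|_{B_{\vec p,\beta}^s}=\big(\sum_{k\ge0}2^{ks\beta}\|\varphi_k*f\|_{L^{\vec p}(\mathbb R^n)}^\beta\big)^{1/\beta}$, $\|f\|_{F_{\vec p,\beta}^s}=\big\|\big(\sum_{k\ge0}2^{ks\beta}|\varphi_k*f|^\beta\big)^{1/\beta}\big\|_{L^{\vec p}(\mathbb R^n)}$; each space consists of the $f\in\mathcal S'(\mathbb R^n)$ with finite quasi-norm. *)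

theory Defs
  imports "HOL-Analysis.Analysis" "HOL-Probability.Essential_Supremum"
begin

text \<open>
  The index type of the coordinates of \<open>real ^ 'n\<close> is a finite linearly ordered type;
  its elements in increasing order play the role of \<open>1, ..., n\<close>, so \<open>n = CARD('n)\<close> and the
  last coordinate is \<open>Max UNIV\<close>. All quasi-norms take values in \<open>ennreal\<close>, and integrability
  exponents in \<open>(0, \<infinity>]\<close> are represented in \<open>ennreal\<close>.
\<close>

type_synonym 'n cfun = "(real, 'n) vec \<Rightarrow> complex"
type_synonym 'n functional = "'n cfun \<Rightarrow> complex"

subsection \<open>Schwartz functions and tempered distributions\<close>

definition partial_deriv ::
    "'n::finite \<Rightarrow> 'n cfun \<Rightarrow> (real, 'n) vec \<Rightarrow> complex" where
  "partial_deriv i f x = vector_derivative (\<lambda>t. f (x + t *\<^sub>R axis i 1)) (at 0)"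

text \<open>Iterated partial derivatives are indexed by lists of coordinates instead of multi-indices.\<close>

definition iter_deriv ::
    "'n::finite list \<Rightarrow> 'n cfun \<Rightarrow> (real, 'n) vec \<Rightarrow> complex" where
  "iter_deriv is f = foldr partial_deriv is f"

definition smooth :: "('n::finite) cfun \<Rightarrow> bool" where
  "smooth f \<longleftrightarrow> (\<forall>is. iter_deriv is f differentiable_on UNIV)"

definition schwartz :: "('n::finite) cfun set" where
  "schwartz = {f. smooth f \<and>
     (\<forall>m is. bdd_above (range (\<lambda>x. (1 + norm x) ^ m * norm (iter_deriv is f x))))}"

definition schwartz_seminorm ::
    "nat \<Rightarrow> 'n::finite list \<Rightarrow> 'n cfun \<Rightarrow> real" where
  "schwartz_seminorm m is f = (SUP x. (1 + norm x) ^ m * norm (iter_deriv is f x))"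

definition schwartz_topology :: "('n::finite) cfun topology" where
  "schwartz_topology = topology_generated_by
     {{g \<in> schwartz. schwartz_seminorm m is (\<lambda>x. g x - f x) < e} | f m is e.
        f \<in> schwartz \<and> 0 < e}"

text \<open>A functional on \<open>schwartz\<close> is a total function in HOL; \<open>extensional\<close> fixes its
  irrelevant values elsewhere.\<close>

definition tempered_distributions :: "('n::finite) functional set" where
  "tempered_distributions = {u \<in> extensional schwartz.
     (\<forall>f\<in>schwartz. \<forall>g\<in>schwartz. u (\<lambda>x. f x + g x) = u f + u g) \<and>
     (\<forall>c. \<forall>f\<in>schwartz. u (\<lambda>x. c * f x) = c * u f) \<and>
     continuous_map schwartz_topology euclidean u}"

text \<open>The support conditions on Littlewood-Paley pairs below refer to this (unitary,
  angular-frequency) normalisation of the Fourier transform.\<close>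

definition fourier :: "('n::finite) cfun \<Rightarrow> (real, 'n) vec \<Rightarrow> complex" where
  "fourier f \<xi> = of_real ((2 * pi) powr (- real CARD('n) / 2)) *
     integral\<^sup>L lborel (\<lambda>x. exp (- \<i> * of_real (x \<bullet> \<xi>)) * f x)"

definition conv_distr ::
    "('n::finite) cfun \<Rightarrow> 'n functional \<Rightarrow> (real, 'n) vec \<Rightarrow> complex" where
  "conv_distr \<phi> u x = u (\<lambda>y. \<phi> (x - y))"

subsection \<open>Lebesgue, sequence, Herz and mixed quasi-norms\<close>

text \<open>Powers with exponent \<open>a > 0\<close>.\<close>

definition enn_powr :: "ennreal \<Rightarrow> real \<Rightarrow> ennreal" where
  "enn_powr x a = (if x = \<infinity> then \<infinity> else ennreal (enn2real x powr a))"

definition Lp_norm :: "ennreal \<Rightarrow> (real \<Rightarrow> ennreal) \<Rightarrow> ennreal" where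
  "Lp_norm p g = (if p = \<infinity> then esssup lborel g
     else enn_powr (\<integral>\<^sup>+ t. enn_powr (g t) (enn2real p) \<partial>lborel) (1 / enn2real p))"

definition lq_norm :: "ennreal \<Rightarrow> ('k \<Rightarrow> ennreal) \<Rightarrow> ennreal" where
  "lq_norm q a = (if q = \<infinity> then SUP k. a k
     else enn_powr (\<integral>\<^sup>+ k. enn_powr (a k) (enn2real q) \<partial>count_space UNIV) (1 / enn2real q))"

definition dyadic_shell :: "int \<Rightarrow> real set" where
  "dyadic_shell k = {t. 2 powi (k - 1) \<le> \<bar>t\<bar> \<and> \<bar>t\<bar> < 2 powi k}"

text \<open>The weights \<open>2\<^sup>k\<^sup>\<alpha>\<^sup>q\<close> are placed inside the \<open>q\<close>-th power, which also gives the
  intended weighted supremum for \<open>q = \<infinity>\<close>; likewise in the Besov and Triebel-Lizorkin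
  quasi-norms below.\<close>

definition herz_norm :: "ennreal \<Rightarrow> real \<Rightarrow> ennreal \<Rightarrow> (real \<Rightarrow> ennreal) \<Rightarrow> ennreal" where
  "herz_norm p \<alpha> q g = lq_norm q (\<lambda>k::int. ennreal (2 powr (of_int k * \<alpha>)) *
     Lp_norm p (\<lambda>t. g t * indicator (dyadic_shell k) t))"

definition coord_norm ::
    "('n::finite \<Rightarrow> (real \<Rightarrow> ennreal) \<Rightarrow> ennreal) \<Rightarrow> 'n \<Rightarrow> ((real, 'n) vec \<Rightarrow> ennreal) \<Rightarrow> (real, 'n) vec \<Rightarrow> ennreal" where
  "coord_norm N i g x = N i (\<lambda>t. g (\<chi> j. if j = i then t else x $ j))"

text \<open>After the norms in all coordinates have been taken, smallest coordinate first (innermost),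
  the resulting function is constant; it is evaluated at \<open>0\<close>.\<close>

definition mixed_norm ::
    "('n::{finite,linorder} \<Rightarrow> (real \<Rightarrow> ennreal) \<Rightarrow> ennreal) \<Rightarrow> ((real, 'n) vec \<Rightarrow> ennreal) \<Rightarrow> ennreal" where
  "mixed_norm N g = fold (coord_norm N) (sorted_list_of_set UNIV) g 0"

definition mixed_Lp_norm ::
    "('n::{finite,linorder} \<Rightarrow> ennreal) \<Rightarrow> ((real, 'n) vec \<Rightarrow> ennreal) \<Rightarrow> ennreal" where
  "mixed_Lp_norm p = mixed_norm (\<lambda>i. Lp_norm (p i))"

definition mixed_herz_norm ::
    "('n::{finite,linorder} \<Rightarrow> ennreal) \<Rightarrow> ('n \<Rightarrow> real) \<Rightarrow> ('n \<Rightarrow> ennreal) \<Rightarrow>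
     ((real, 'n) vec \<Rightarrow> ennreal) \<Rightarrow> ennreal" where
  "mixed_herz_norm p \<alpha> q = mixed_norm (\<lambda>i. herz_norm (p i) (\<alpha> i) (q i))"

subsection \<open>Smoothness spaces\<close>

definition admissible_pair ::
    "('n::finite) cfun \<Rightarrow> 'n cfun \<Rightarrow> bool" where
  "admissible_pair \<Phi> \<phi> \<longleftrightarrow> \<Phi> \<in> schwartz \<and> \<phi> \<in> schwartz \<and>
     closure {\<xi>. fourier \<Phi> \<xi> \<noteq> 0} \<subseteq> {\<xi>. norm \<xi> \<le> 2} \<and>
     (\<exists>c>0. \<forall>\<xi>. norm \<xi> \<le> 5 / 3 \<longrightarrow> norm (fourier \<Phi> \<xi>) \<ge> c) \<and>
     closure {\<xi>. fourier \<phi> \<xi> \<noteq> 0} \<subseteq> {\<xi>. 1 / 2 \<le> norm \<xi> \<and> norm \<xi> \<le> 2} \<and>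
     (\<exists>c>0. \<forall>\<xi>. 3 / 5 \<le> norm \<xi> \<and> norm \<xi> \<le> 5 / 3 \<longrightarrow> norm (fourier \<phi> \<xi>) \<ge> c)"

definition lp_kernel ::
    "('n::finite) cfun \<Rightarrow> 'n cfun \<Rightarrow> nat \<Rightarrow> (real, 'n) vec \<Rightarrow> complex" where
  "lp_kernel \<Phi> \<phi> k = (if k = 0 then \<Phi> else (\<lambda>x. 2 ^ (k * CARD('n)) * \<phi> (2 ^ k *\<^sub>R x)))"

definition lp_block ::
    "('n::finite) cfun \<Rightarrow> 'n cfun \<Rightarrow>
     'n functional \<Rightarrow> nat \<Rightarrow> (real, 'n) vec \<Rightarrow> ennreal" where
  "lp_block \<Phi> \<phi> f k x = ennreal (norm (conv_distr (lp_kernel \<Phi> \<phi> k) f x))"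

definition herz_besov_norm ::
    "('n::{finite,linorder}) cfun \<Rightarrow> 'n cfun \<Rightarrow>
     ('n \<Rightarrow> ennreal) \<Rightarrow> ('n \<Rightarrow> real) \<Rightarrow> ('n \<Rightarrow> ennreal) \<Rightarrow> real \<Rightarrow> ennreal \<Rightarrow>
     'n functional \<Rightarrow> ennreal" where
  "herz_besov_norm \<Phi> \<phi> p \<alpha> q s \<beta> f =
     lq_norm \<beta> (\<lambda>k. ennreal (2 powr (real k * s)) * mixed_herz_norm p \<alpha> q (lp_block \<Phi> \<phi> f k))"

definition besov_norm ::
    "('n::{finite,linorder}) cfun \<Rightarrow> 'n cfun \<Rightarrow>
     ('n \<Rightarrow> ennreal) \<Rightarrow> real \<Rightarrow> ennreal \<Rightarrow> 'n functional \<Rightarrow> ennreal" where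
  "besov_norm \<Phi> \<phi> p s \<beta> f =
     lq_norm \<beta> (\<lambda>k. ennreal (2 powr (real k * s)) * mixed_Lp_norm p (lp_block \<Phi> \<phi> f k))"

definition triebel_lizorkin_norm ::
    "('n::{finite,linorder}) cfun \<Rightarrow> 'n cfun \<Rightarrow>
     ('n \<Rightarrow> ennreal) \<Rightarrow> real \<Rightarrow> ennreal \<Rightarrow> 'n functional \<Rightarrow> ennreal" where
  "triebel_lizorkin_norm \<Phi> \<phi> p s \<beta> f =
     mixed_Lp_norm p (\<lambda>x. lq_norm \<beta> (\<lambda>k. ennreal (2 powr (real k * s)) * lp_block \<Phi> \<phi> f k x))"

text \<open>The space belonging to a quasi-norm on tempered distributions, and the continuous embedding
  of the space of \<open>N\<close> into the space of \<open>N'\<close>.\<close>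

definition distr_space ::
    "(('n::finite) functional \<Rightarrow> ennreal) \<Rightarrow> 'n functional set" where
  "distr_space N = {f \<in> tempered_distributions. N f < \<infinity>}"

definition cont_embedded ::
    "(('n::finite) functional \<Rightarrow> ennreal) \<Rightarrow>
     ('n functional \<Rightarrow> ennreal) \<Rightarrow> bool" where
  "cont_embedded N N' \<longleftrightarrow> distr_space N \<subseteq> distr_space N' \<and>
     (\<exists>C::real. C > 0 \<and> (\<forall>f\<in>distr_space N. N' f \<le> ennreal C * N f))"

end

theory Submission
  imports Defs "HOL-Probability.Probability"
begin

text \<open>
  Write \<open>f\<^sub>k\<close> for the \<open>k\<close>-th Littlewood-Paley block of \<open>f\<close>. Being band-limited, it satisfies
  in each coordinate a sampling formula
  \<open>f\<^sub>k x = (\<Sum>m. c s m * f\<^sub>k (x + 2\<^sup>-\<^sup>k (s + m) e\<^sub>i))\<close>, for every \<open>s \<in> [0, 1)\<close>, with rapidly decreasing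
  coefficients that do not depend on \<open>f\<close>. As the formula is a discrete sum, it survives taking
  \<open>r\<close>-th powers for every \<open>r < 1\<close>, and the resulting sub-mean value inequality in one coordinate is
  inherited, by Minkowski's inequality, by the Herz norms in the other coordinates as soon as \<open>r\<close> is
  smaller than all exponents.

  In one variable the sub-mean value inequality bounds \<open>f\<^sub>k\<close> on each dyadic shell by its \<open>L\<^sup>q\<close> norms
  on the neighbouring shells. Together with the pointwise estimate
  \<open>(\<Sum>k. a\<^sub>k\<^sup>r)\<^sup>p\<^sup>/\<^sup>r \<le> C (\<Sum>l\<le>k. 2\<^sup>\<epsilon>\<^sup>(\<^sup>k\<^sup>-\<^sup>l\<^sup>) a\<^sub>k\<^sup>q a\<^sub>l\<^sup>p\<^sup>-\<^sup>q)\<close>, where the more oscillating factor is measured in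
  \<open>L\<^sup>q\<close> and the other one in \<open>L\<^sup>\<infinity>\<close>, this yields the Franke-Jawerth inequality with a Herz norm on the
  right. It is applied to single blocks in all coordinates but the last, and to the whole sequence of
  blocks in the last one. The first embedding holds because \<open>\<ell>\<^sup>q \<subseteq> \<ell>\<^sup>p\<close> on the shells.
\<close>

subsection \<open>Powers, Hoelder and Minkowski inequalities in the extended nonnegative reals\<close>

text \<open>For r < 1 the r-th power of an integral is not bounded by the integral of the r-th
  power, so a reproducing convolution would be useless for small exponents. A discrete sum is
  subadditive under that power, and averaging over the free shift s afterwards restores an integral.
  Since \<theta> may be lowered to r, everything rests on an l^r norm with r as small as desired.
  Minkowski's inequality moves it outside the inner norms, because r lies below their exponents;
  each block then pays 2^(k(1/q_i - 1/p_i)) in each inner coordinate. In the last coordinate the l^r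
  norm stays inside L^(p_n), and exchanging it for an outer l^(p_n) norm is what makes p_n the
  summation index. The exponent equation says that all these powers of 2 add up to s2 - s1. The
  obstacle on the shells lies at the origin: infinitely many of them are within 2^-k of 0, where a
  function of scale 2^-k looks constant. The needed decay comes from the length of these shells, and
  keeping it for two scales at once costs part of the gain between them.\<close>

text \<open>Sums are integrals over a counting measure, so that each inequality below is proved
  once, for an arbitrary measure, and serves both function norms and sequence norms.\<close>

abbreviation tsum :: "('k \<Rightarrow> ennreal) \<Rightarrow> ennreal" where
  "tsum f \<equiv> \<integral>\<^sup>+ k. f k \<partial>count_space UNIV"

lemma ennreal_mult_inverse_cancel: "x \<noteq> 0 \<Longrightarrow> x \<noteq> top \<Longrightarrow> x * inverse x = (1::ennreal)"
  by (metis ennreal_divide_self divide_ennreal_def infinity_ennreal_def top.not_eq_extremum)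

text \<open>0 and infinity are fixed by every power, also for exponents \<le> 0. With this
  convention and 0 * \<open>top\<close> = 0 the product and exponent laws below hold without side
  conditions.\<close>

lemma enn_powr_top [simp]: "enn_powr \<infinity> a = \<infinity>" "enn_powr top a = top"
  by (simp_all add: enn_powr_def)

lemma enn_powr_0 [simp]: "enn_powr 0 a = 0"
  by (simp add: enn_powr_def)

lemma enn_powr_one [simp]: "enn_powr 1 a = 1"
  by (simp add: enn_powr_def)

lemma enn_powr_1 [simp]: "enn_powr x 1 = x"
  by (cases x) (auto simp: enn_powr_def)

lemma enn_powr_ennreal: "0 \<le> x \<Longrightarrow> enn_powr (ennreal x) a = ennreal (x powr a)"
  by (simp add: enn_powr_def)

lemma enn_powr_2powr [simp]: "enn_powr (ennreal (2 powr x)) a = ennreal (2 powr (x * a))"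
  by (simp add: enn_powr_ennreal powr_powr)

lemma enn_powr_eq_0_iff [simp]: "enn_powr x a = 0 \<longleftrightarrow> x = 0"
  by (cases x) (auto simp: enn_powr_ennreal)

lemma enn_powr_eq_top_iff [simp]: "enn_powr x a = top \<longleftrightarrow> x = top"
  by (cases x) (auto simp: enn_powr_ennreal)

lemma enn_powr_mono: "x \<le> y \<Longrightarrow> 0 \<le> a \<Longrightarrow> enn_powr x a \<le> enn_powr y a"
  by (cases x; cases y) (auto simp: enn_powr_ennreal powr_mono2 top_unique)

lemma enn_powr_mult: "enn_powr (x * y) a = enn_powr x a * enn_powr y a"
  by (cases x; cases y)
    (auto simp: enn_powr_ennreal ennreal_mult[symmetric] powr_mult ennreal_mult_eq_top_iff
       ennreal_top_mult ennreal_mult_top)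

lemma enn_powr_powr: "enn_powr (enn_powr x a) b = enn_powr x (a * b)"
  by (cases x) (auto simp: enn_powr_ennreal powr_powr)

lemma enn_powr_add: "enn_powr x (a + b) = enn_powr x a * enn_powr x b"
  by (cases x) (auto simp: enn_powr_ennreal powr_add ennreal_mult)

lemma enn_powr_inverse_cancel [simp]:
  assumes "a \<noteq> 0"
  shows "enn_powr (enn_powr x a) (1 / a) = x" "enn_powr (enn_powr x (1 / a)) a = x"
  using assms by (simp_all add: enn_powr_powr)

lemma enn_powr_le_iff:
  assumes "0 < a"
  shows "enn_powr x a \<le> y \<longleftrightarrow> x \<le> enn_powr y (1 / a)"
  using enn_powr_mono[of "enn_powr x a" y "1 / a"] enn_powr_mono[of x "enn_powr y (1 / a)" a] assms
  by auto

lemma enn_powr_indicator [simp]: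
  "enn_powr (indicator A x) a = indicator A x"
  by (simp split: split_indicator)

lemma enn_powr_mult_indicator:
  "enn_powr (y * indicator A x) a = enn_powr y a * indicator A x"
  by (simp add: enn_powr_mult)

lemma measurable_enn_powr [measurable]:
  "(\<lambda>x. enn_powr x a) \<in> borel_measurable borel"
  unfolding enn_powr_def by measurable

lemma measurable_enn_powr_comp [measurable (raw)]:
  "f \<in> borel_measurable M \<Longrightarrow> (\<lambda>x. enn_powr (f x) a) \<in> borel_measurable M"
  using measurable_compose[OF _ measurable_enn_powr] .

lemma enn_Young:
  assumes a: "0 < a" "a < 1"
  shows "enn_powr x a * enn_powr y (1 - a) \<le> ennreal a * x + ennreal (1 - a) * y"
proof (cases "x = 0 \<or> y = 0 \<or> x = top \<or> y = top")
  case True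
  then show ?thesis using a
    by (auto simp: ennreal_mult_top ennreal_top_mult ennreal_mult_eq_top_iff)
next
  case False
  then obtain u v where uv: "x = ennreal u" "y = ennreal v" "0 < u" "0 < v"
    by (metis ennreal_cases ennreal_eq_0_iff less_eq_real_def not_less)
  have "u powr a * v powr (1 - a) \<le> a * u + (1 - a) * v"
    using Youngs_inequality_0[of a "1 - a" u v] a uv by simp
  then show ?thesis using uv a
    by (simp add: enn_powr_ennreal ennreal_mult[symmetric] ennreal_plus[symmetric] ennreal_leI
       del: ennreal_plus)
qed

lemma enn_Young':
  assumes a: "0 < a" "a < 1"
  shows "enn_powr x a * enn_powr y (1 - a) \<le> x + y"
proof -
  have "ennreal a * x + ennreal (1 - a) * y \<le> 1 * x + 1 * y"
    using a by (intro add_mono mult_right_mono) (auto simp: ennreal_le_1)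
  then show ?thesis using enn_Young[OF a] order_trans by fastforce
qed

text \<open>Young's inequality is integrated after both functions are normalised by their integrals.
  Integrals equal to 0 or \<open>top\<close> cannot be divided out and are dealt with first.\<close>

lemma enn_Hoelder:
  assumes a: "0 < a" "a < 1"
    and [measurable]: "f \<in> borel_measurable M" "g \<in> borel_measurable M"
  shows "(\<integral>\<^sup>+x. enn_powr (f x) a * enn_powr (g x) (1 - a) \<partial>M) \<le>
    enn_powr (\<integral>\<^sup>+x. f x \<partial>M) a * enn_powr (\<integral>\<^sup>+x. g x \<partial>M) (1 - a)"
proof -
  define F G where "F = (\<integral>\<^sup>+x. f x \<partial>M)" and "G = (\<integral>\<^sup>+x. g x \<partial>M)"
  consider "F = 0" | "G = 0" | "F \<noteq> 0" "G \<noteq> 0" "F = top \<or> G = top" | "F \<noteq> 0" "G \<noteq> 0" "F \<noteq> top" "G \<noteq> top"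
    by blast
  then show ?thesis
  proof cases
    case 1
    then have "AE x in M. f x = 0"
      unfolding F_def by (simp add: nn_integral_0_iff_AE)
    then have "AE x in M. enn_powr (f x) a * enn_powr (g x) (1 - a) = 0" by eventually_elim simp
    then show ?thesis by (simp add: nn_integral_0_iff_AE[THEN iffD2])
  next
    case 2
    then have "AE x in M. g x = 0"
      unfolding G_def by (simp add: nn_integral_0_iff_AE)
    then have "AE x in M. enn_powr (f x) a * enn_powr (g x) (1 - a) = 0" by eventually_elim simp
    then show ?thesis by (simp add: nn_integral_0_iff_AE[THEN iffD2])
  next
    case 3
    then have "enn_powr F a * enn_powr G (1 - a) = top"
      using a by (auto simp: ennreal_mult_eq_top_iff)
    then show ?thesis by (simp add: F_def G_def)
  next
    case 4
    obtain u v where uv: "F = ennreal u" "G = ennreal v" "0 < u" "0 < v"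
      using 4 by (metis ennreal_cases ennreal_eq_0_iff less_eq_real_def not_less)
    define K where "K = enn_powr F a * enn_powr G (1 - a)"
    have F1: "ennreal u * (ennreal (1/u) * z) = z" "ennreal v * (ennreal (1/v) * z) = z" for z
      using uv by (simp_all add: mult.assoc[symmetric] ennreal_mult[symmetric])
    have "enn_powr (f x) a * enn_powr (g x) (1 - a)
        \<le> K * (ennreal a * (ennreal (1/u) * f x) + ennreal (1 - a) * (ennreal (1/v) * g x))" for x
    proof -
      have "enn_powr (f x) a * enn_powr (g x) (1 - a) =
         enn_powr (F * (ennreal (1/u) * f x)) a * enn_powr (G * (ennreal (1/v) * g x)) (1 - a)"
        unfolding uv(1,2) F1 ..
      also have "\<dots> = K * (enn_powr (ennreal (1/u) * f x) a * enn_powr (ennreal (1/v) * g x) (1 - a))"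
        by (simp add: K_def enn_powr_mult mult_ac)
      finally show ?thesis
        using enn_Young[OF a] by (simp add: mult_left_mono)
    qed
    then have "(\<integral>\<^sup>+x. enn_powr (f x) a * enn_powr (g x) (1 - a) \<partial>M) \<le>
       (\<integral>\<^sup>+x. K * (ennreal a * (ennreal (1/u) * f x) + ennreal (1 - a) * (ennreal (1/v) * g x)) \<partial>M)"
      by (rule nn_integral_mono)
    also have "\<dots> = K * (ennreal a * (ennreal (1/u) * F) + ennreal (1 - a) * (ennreal (1/v) * G))"
      by (simp add: nn_integral_cmult nn_integral_add F_def G_def)
    also have "\<dots> = K"
      using a uv by (simp add: ennreal_mult[symmetric] ennreal_plus[symmetric] del: ennreal_plus)
    finally show ?thesis by (simp add: K_def F_def G_def)
  qed
qed

text \<open>Hoelder for the splitting w f = (w f^s)^(1/s) w^(1 - 1/s). The weight is not normalised,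
  so its total mass remains, with the power s - 1.\<close>

lemma enn_Jensen:
  assumes s: "1 < s"
    and [measurable]: "w \<in> borel_measurable M" "f \<in> borel_measurable M"
  shows "enn_powr (\<integral>\<^sup>+x. w x * f x \<partial>M) s \<le>
    enn_powr (\<integral>\<^sup>+x. w x \<partial>M) (s - 1) * (\<integral>\<^sup>+x. w x * enn_powr (f x) s \<partial>M)"
proof -
  have "w x * f x = enn_powr (w x * enn_powr (f x) s) (1 / s) * enn_powr (w x) (1 - 1 / s)" for x
  proof -
    have "enn_powr (w x * enn_powr (f x) s) (1 / s) * enn_powr (w x) (1 - 1 / s)
       = f x * (enn_powr (w x) (1 / s) * enn_powr (w x) (1 - 1 / s))"
      using s by (simp add: enn_powr_mult mult_ac)
    also have "\<dots> = f x * w x" by (simp add: enn_powr_add[symmetric])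
    finally show ?thesis by (simp add: mult.commute)
  qed
  then have "(\<integral>\<^sup>+x. w x * f x \<partial>M) =
      (\<integral>\<^sup>+x. enn_powr (w x * enn_powr (f x) s) (1 / s) * enn_powr (w x) (1 - 1 / s) \<partial>M)"
    by simp
  also have "\<dots> \<le> enn_powr (\<integral>\<^sup>+x. w x * enn_powr (f x) s \<partial>M) (1 / s) * enn_powr (\<integral>\<^sup>+x. w x \<partial>M) (1 - 1 / s)"
    using s by (intro enn_Hoelder) auto
  finally have "enn_powr (\<integral>\<^sup>+x. w x * f x \<partial>M) s \<le>
    enn_powr (enn_powr (\<integral>\<^sup>+x. w x * enn_powr (f x) s \<partial>M) (1 / s) * enn_powr (\<integral>\<^sup>+x. w x \<partial>M) (1 - 1 / s)) s"
    using s by (intro enn_powr_mono) auto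
  also have "\<dots> = (\<integral>\<^sup>+x. w x * enn_powr (f x) s \<partial>M) * enn_powr (\<integral>\<^sup>+x. w x \<partial>M) (s - 1)"
    using s by (simp add: enn_powr_mult enn_powr_powr left_diff_distrib)
  finally show ?thesis by (simp add: mult.commute)
qed

section \<open>Countable sums and Minkowski's inequality\<close>

lemma tsum_nn_integral:
  fixes f :: "'k::countable \<Rightarrow> 'a \<Rightarrow> ennreal"
  assumes "\<And>k. f k \<in> borel_measurable M"
  shows "(\<integral>\<^sup>+x. tsum (\<lambda>k. f k x) \<partial>M) = tsum (\<lambda>k. \<integral>\<^sup>+x. f k x \<partial>M)"
  by (rule nn_integral_count_space_nn_integral) (use assms in auto)

text \<open>The sum over k is rewritten as a series over the codes \<open>to_nat k\<close>; each
  term of that series is a single \<open>f k\<close> or 0.\<close>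

lemma measurable_tsum [measurable (raw)]:
  fixes f :: "'k::countable \<Rightarrow> 'a \<Rightarrow> ennreal"
  assumes "\<And>k. f k \<in> borel_measurable M"
  shows "(\<lambda>x. tsum (\<lambda>k. f k x)) \<in> borel_measurable M"
proof -
  have "(\<lambda>x. \<Sum>n. (\<integral>\<^sup>+k. f k x * indicator {k. to_nat k = n} k \<partial>count_space UNIV)) \<in> borel_measurable M"
  proof (intro borel_measurable_suminf_order)
    fix n
    have "(\<integral>\<^sup>+k. f k x * indicator {k. to_nat k = n} k \<partial>count_space UNIV) =
       (if n \<in> range (to_nat :: 'k \<Rightarrow> nat) then f (from_nat n) x else 0)" for x
    proof -
      have "f k x * indicator {k. to_nat k = n} k =
         (if n \<in> range (to_nat :: 'k \<Rightarrow> nat) then f (from_nat n) x * indicator {from_nat n} k else 0)" for k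
        by (auto split: split_indicator intro: rangeI)
          (metis rangeI)
      then show ?thesis by auto
    qed
    then show "(\<lambda>x. \<integral>\<^sup>+k. f k x * indicator {k. to_nat k = n} k \<partial>count_space UNIV) \<in> borel_measurable M"
      using assms by simp
  qed
  also have "(\<lambda>x. \<Sum>n. (\<integral>\<^sup>+k. f k x * indicator {k. to_nat k = n} k \<partial>count_space UNIV)) =
     (\<lambda>x. tsum (\<lambda>k. f k x))"
  proof
    fix x
    have "(\<Sum>n. (\<integral>\<^sup>+k. f k x * indicator {k. to_nat k = n} k \<partial>count_space UNIV)) =
      (\<integral>\<^sup>+k. (\<Sum>n. f k x * indicator {k. to_nat k = n} k) \<partial>count_space UNIV)"
      by (subst nn_integral_suminf) auto
    also have "\<dots> = tsum (\<lambda>k. f k x)"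
    proof (intro nn_integral_cong)
      fix k
      have "(\<lambda>n. f k x * indicator {k. to_nat k = n} k) = (\<lambda>n. if n = to_nat k then f k x else 0)"
        by (auto split: split_indicator)
      then have "(\<lambda>n. f k x * indicator {k. to_nat k = n} k) sums f k x"
        using sums_single[of "to_nat k" "\<lambda>_. f k x"] by simp
      then show "(\<Sum>n. f k x * indicator {k. to_nat k = n} k) = f k x"
        by (simp add: sums_iff)
    qed
    finally show "(\<Sum>n. (\<integral>\<^sup>+k. f k x * indicator {k. to_nat k = n} k \<partial>count_space UNIV)) = tsum (\<lambda>k. f k x)" .
  qed
  finally show ?thesis .
qed

lemma tsum_ge: "f k \<le> tsum f"
proof -
  have "f k = (\<integral>\<^sup>+j. f j * indicator {k} j \<partial>count_space UNIV)" by simp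
  also have "\<dots> \<le> tsum f" by (intro nn_integral_mono) (auto split: split_indicator)
  finally show ?thesis .
qed

text \<open>This is the inclusion of l^s in l^t: one factor a_k^s is kept and the surplus a_k^(t -
  s) is bounded by the whole s-sum.\<close>

lemma tsum_powr_le:
  assumes "0 < s" "s < t"
  shows "tsum (\<lambda>k. enn_powr (a k) t) \<le> enn_powr (tsum (\<lambda>k. enn_powr (a k) s)) (t / s)"
proof -
  define S where "S = tsum (\<lambda>k. enn_powr (a k) s)"
  have "enn_powr (a k) t \<le> enn_powr (a k) s * enn_powr S ((t - s) / s)" for k
  proof -
    have "enn_powr (a k) t = enn_powr (a k) s * enn_powr (enn_powr (a k) s) ((t - s) / s)"
      using assms by (simp add: enn_powr_powr enn_powr_add[symmetric])
    also have "\<dots> \<le> enn_powr (a k) s * enn_powr S ((t - s) / s)"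
      using assms unfolding S_def
      by (intro mult_left_mono enn_powr_mono tsum_ge[of "\<lambda>k. enn_powr (a k) s"]) auto
    finally show ?thesis .
  qed
  then have "tsum (\<lambda>k. enn_powr (a k) t) \<le> tsum (\<lambda>k. enn_powr (a k) s * enn_powr S ((t - s) / s))"
    by (rule nn_integral_mono)
  also have "\<dots> = enn_powr S 1 * enn_powr S ((t - s) / s)"
    by (simp add: nn_integral_multc S_def)
  also have "\<dots> = enn_powr S (t / s)"
    using assms unfolding enn_powr_add[symmetric] by (simp add: field_simps)
  finally show ?thesis by (simp add: S_def)
qed

text \<open>Jensen's inequality with the weights \<open>\<parallel>H\<^sub>m\<parallel>\<close> gives Minkowski's inequality for countable sums.\<close>

lemma enn_Minkowski:
  fixes H :: "'k::countable \<Rightarrow> 'a \<Rightarrow> ennreal"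
  assumes s: "1 < s" and [measurable]: "\<And>k. H k \<in> borel_measurable M"
  shows "enn_powr (\<integral>\<^sup>+x. enn_powr (tsum (\<lambda>k. H k x)) s \<partial>M) (1 / s) \<le>
    tsum (\<lambda>k. enn_powr (\<integral>\<^sup>+x. enn_powr (H k x) s \<partial>M) (1 / s))"
proof -
  define a where "a k = enn_powr (\<integral>\<^sup>+x. enn_powr (H k x) s \<partial>M) (1 / s)" for k
  define A where "A = tsum a"
  show ?thesis
  proof (cases "A = top")
    case True
    then show ?thesis by (simp add: A_def a_def)
  next
    case False
    have afin: "a k \<noteq> top" for k
      using tsum_ge[of a k] False unfolding A_def by (auto simp: top_unique)
    have as: "enn_powr (a k) s = (\<integral>\<^sup>+x. enn_powr (H k x) s \<partial>M)" for k
      using s by (simp add: a_def)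
    \<comment> \<open>If \<open>a k\<close> is 0, the identity fails wherever \<open>H k\<close> is
      positive; this set is null.\<close>
    have "AE x in M. \<forall>k. H k x = a k * (H k x * inverse (a k))"
      unfolding AE_all_countable
    proof
      fix k
      show "AE x in M. H k x = a k * (H k x * inverse (a k))"
      proof (cases "a k = 0")
        case True
        then have "(\<integral>\<^sup>+x. enn_powr (H k x) s \<partial>M) = 0" using as[of k] by simp
        then have "AE x in M. enn_powr (H k x) s = 0" by (subst (asm) nn_integral_0_iff_AE) auto
        then show ?thesis by eventually_elim simp
      next
        case False
        then have "a k * inverse (a k) = 1"
          using afin[of k] by (simp add: ennreal_mult_inverse_cancel)
        then have "a k * (H k x * inverse (a k)) = H k x" for x
          by (metis mult.assoc mult.commute mult_1)
        then show ?thesis by simp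
      qed
    qed
    then have "AE x in M. enn_powr (tsum (\<lambda>k. H k x)) s \<le>
        enn_powr A (s - 1) * tsum (\<lambda>k. a k * enn_powr (H k x * inverse (a k)) s)"
    proof eventually_elim
      fix x assume "\<forall>k. H k x = a k * (H k x * inverse (a k))"
      then have "tsum (\<lambda>k. H k x) = tsum (\<lambda>k. a k * (H k x * inverse (a k)))"
        by (intro nn_integral_cong) blast
      moreover have "enn_powr (tsum (\<lambda>k. a k * (H k x * inverse (a k)))) s \<le>
        enn_powr A (s - 1) * tsum (\<lambda>k. a k * enn_powr (H k x * inverse (a k)) s)"
        unfolding A_def by (intro enn_Jensen s) auto
      ultimately show "enn_powr (tsum (\<lambda>k. H k x)) s \<le>
        enn_powr A (s - 1) * tsum (\<lambda>k. a k * enn_powr (H k x * inverse (a k)) s)" by simp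
    qed
    then have "(\<integral>\<^sup>+x. enn_powr (tsum (\<lambda>k. H k x)) s \<partial>M) \<le>
       (\<integral>\<^sup>+x. enn_powr A (s - 1) * tsum (\<lambda>k. a k * enn_powr (H k x * inverse (a k)) s) \<partial>M)"
      by (rule nn_integral_mono_AE)
    also have "\<dots> = enn_powr A (s - 1) * tsum (\<lambda>k. \<integral>\<^sup>+x. a k * enn_powr (H k x * inverse (a k)) s \<partial>M)"
      by (simp add: nn_integral_cmult tsum_nn_integral)
    \<comment> \<open>Each normalised function has s-th moment at most 1 as soon as
      \<open>a k\<close> is not 0, so only the weights \<open>a k\<close> remain.\<close>
    also have "\<dots> \<le> enn_powr A (s - 1) * tsum a"
    proof (intro mult_left_mono nn_integral_mono)
      fix k
      have "(\<integral>\<^sup>+x. a k * enn_powr (H k x * inverse (a k)) s \<partial>M) =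
          a k * (enn_powr (a k) s * enn_powr (inverse (a k)) s)"
        by (simp add: nn_integral_cmult nn_integral_multc enn_powr_mult as)
      also have "\<dots> = a k * enn_powr (a k * inverse (a k)) s" by (simp add: enn_powr_mult)
      also have "\<dots> \<le> a k"
      proof (cases "a k = 0")
        case False
        then have "a k * inverse (a k) = 1"
          using afin[of k] by (simp add: ennreal_mult_inverse_cancel)
        then show ?thesis by simp
      qed simp
      finally show "(\<integral>\<^sup>+x. a k * enn_powr (H k x * inverse (a k)) s \<partial>M) \<le> a k" .
    qed simp
    also have "\<dots> = enn_powr A (s - 1) * enn_powr A 1" by (simp add: A_def)
    also have "\<dots> = enn_powr A s" unfolding enn_powr_add[symmetric] by simp
    finally show ?thesis
      using s by (simp add: enn_powr_le_iff A_def a_def enn_powr_powr)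
  qed
qed

text \<open>Because r < p, Minkowski's inequality holds in L^(p/r); it is applied to the functions
  \<open>w k * enn_powr (h k x) r\<close>. A pointwise inequality between r-th powers thus passes to
  r-th powers of L^p quasi-norms with unchanged weights.\<close>

lemma enn_powr_norm_sub:
  fixes h :: "'k::countable \<Rightarrow> 'a \<Rightarrow> ennreal"
  assumes r: "0 < r" "r < p" and [measurable]: "\<And>k. h k \<in> borel_measurable M"
    and le: "\<And>x. x \<in> space M \<Longrightarrow> enn_powr (g x) r \<le> tsum (\<lambda>k. w k * enn_powr (h k x) r)"
  shows "enn_powr (enn_powr (\<integral>\<^sup>+x. enn_powr (g x) p \<partial>M) (1 / p)) r \<le>
    tsum (\<lambda>k. w k * enn_powr (enn_powr (\<integral>\<^sup>+x. enn_powr (h k x) p \<partial>M) (1 / p)) r)"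
proof -
  have "enn_powr (g x) p \<le> enn_powr (tsum (\<lambda>k. w k * enn_powr (h k x) r)) (p / r)" if "x \<in> space M" for x
  proof -
    have "enn_powr (g x) p = enn_powr (enn_powr (g x) r) (p / r)"
      using r by (simp add: enn_powr_powr)
    then show ?thesis using le[OF that] r by (simp add: enn_powr_mono)
  qed
  then have "(\<integral>\<^sup>+x. enn_powr (g x) p \<partial>M) \<le>
     (\<integral>\<^sup>+x. enn_powr (tsum (\<lambda>k. w k * enn_powr (h k x) r)) (p / r) \<partial>M)"
    by (rule nn_integral_mono)
  then have "enn_powr (\<integral>\<^sup>+x. enn_powr (g x) p \<partial>M) (1 / (p / r)) \<le>
     enn_powr (\<integral>\<^sup>+x. enn_powr (tsum (\<lambda>k. w k * enn_powr (h k x) r)) (p / r) \<partial>M) (1 / (p / r))"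
    using r by (intro enn_powr_mono) auto
  also have "\<dots> \<le> tsum (\<lambda>k. enn_powr (\<integral>\<^sup>+x. enn_powr (w k * enn_powr (h k x) r) (p / r) \<partial>M) (1 / (p / r)))"
    using r by (intro enn_Minkowski) auto
  also have "\<dots> = tsum (\<lambda>k. w k * enn_powr (\<integral>\<^sup>+x. enn_powr (h k x) p \<partial>M) (r / p))"
    using r by (simp add: enn_powr_mult enn_powr_powr nn_integral_cmult)
  finally show ?thesis using r by (simp add: enn_powr_powr)
qed

subsection \<open>Sub-mean value functions on dyadic shells\<close>

lemma Lp_norm_ennreal:
  "0 < p \<Longrightarrow> Lp_norm (ennreal p) g = enn_powr (\<integral>\<^sup>+ t. enn_powr (g t) p \<partial>lborel) (1 / p)"
  by (simp add: Lp_norm_def)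

lemma lq_norm_ennreal:
  "0 < p \<Longrightarrow> lq_norm (ennreal p) a = enn_powr (tsum (\<lambda>k. enn_powr (a k) p)) (1 / p)"
  by (simp add: lq_norm_def)

lemma dyadic_shell_iff:
  "t \<in> dyadic_shell i \<longleftrightarrow> 2 powr (of_int i - 1) \<le> \<bar>t\<bar> \<and> \<bar>t\<bar> < 2 powr (of_int i)"
  by (simp add: dyadic_shell_def powr_real_of_int'[symmetric])

lemma dyadic_shell_sets [measurable]: "dyadic_shell i \<in> sets borel"
  unfolding dyadic_shell_def by measurable

lemma dyadic_shell_unique:
  assumes "t \<noteq> 0"
  shows "\<exists>!i. t \<in> dyadic_shell i"
proof -
  have pos: "0 < \<bar>t\<bar>" using assms by simp
  have iff: "t \<in> dyadic_shell i \<longleftrightarrow> of_int (i - 1) \<le> log 2 \<bar>t\<bar> \<and> log 2 \<bar>t\<bar> < of_int (i - 1) + 1" for i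
    using pos by (simp add: dyadic_shell_iff le_log_iff log_less_iff)
  show ?thesis
  proof (rule ex1I[of _ "\<lfloor>log 2 \<bar>t\<bar>\<rfloor> + 1"])
    show "t \<in> dyadic_shell (\<lfloor>log 2 \<bar>t\<bar>\<rfloor> + 1)" unfolding iff by simp
    show "\<And>i. t \<in> dyadic_shell i \<Longrightarrow> i = \<lfloor>log 2 \<bar>t\<bar>\<rfloor> + 1" unfolding iff by (smt (verit) floor_unique)
  qed
qed

lemma tsum_dyadic_shell:
  assumes "t \<noteq> 0"
  shows "tsum (\<lambda>i. x * indicator (dyadic_shell i) t) = x"
proof -
  obtain j where j: "t \<in> dyadic_shell j" "\<And>i. t \<in> dyadic_shell i \<Longrightarrow> i = j"
    using dyadic_shell_unique[OF assms] by blast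
  have "x * indicator (dyadic_shell i) t = x * indicator {j} i" for i
  proof (cases "i = j")
    case True
    then show ?thesis using j(1) by simp
  next
    case False
    then have "t \<notin> dyadic_shell i" using j(2) by blast
    with False show ?thesis by simp
  qed
  then have "tsum (\<lambda>i. x * indicator (dyadic_shell i) t) = tsum (\<lambda>i. x * indicator {j} i)"
    by (simp only:)
  also have "\<dots> = x" by simp
  finally show ?thesis .
qed

lemma nn_integral_dyadic_shells:
  assumes [measurable]: "f \<in> borel_measurable borel"
  shows "(\<integral>\<^sup>+ t. f t \<partial>lborel) = tsum (\<lambda>i. \<integral>\<^sup>+ t. f t * indicator (dyadic_shell i) t \<partial>lborel)"
proof -
  \<comment> \<open>The origin belongs to no shell.\<close>
  have "AE t in lborel. (t::real) \<noteq> 0" by (rule AE_lborel_singleton)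
  then have "AE t in lborel. f t = tsum (\<lambda>i. f t * indicator (dyadic_shell i) t)"
    by eventually_elim (simp add: tsum_dyadic_shell)
  then have "(\<integral>\<^sup>+ t. f t \<partial>lborel) = (\<integral>\<^sup>+ t. tsum (\<lambda>i. f t * indicator (dyadic_shell i) t) \<partial>lborel)"
    by (rule nn_integral_cong_AE)
  also have "\<dots> = tsum (\<lambda>i. \<integral>\<^sup>+ t. f t * indicator (dyadic_shell i) t \<partial>lborel)"
    by (rule tsum_nn_integral) simp
  finally show ?thesis .
qed

lemma emeasure_dyadic_shell: "emeasure lborel (dyadic_shell i) \<le> ennreal (2 * 2 powr of_int i)"
proof -
  have "emeasure lborel (dyadic_shell i) \<le> emeasure lborel {- (2 powr of_int i) .. (2::real) powr of_int i}"
    by (intro emeasure_mono) (auto simp: dyadic_shell_iff)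
  then show ?thesis by (simp add: emeasure_lborel_Icc_eq)
qed

section \<open>The averaging kernel at scale 2^-k and its mass on a shell\<close>

text \<open>A bump of height 2^k and width 2^-k; 2 is the least integer power that is integrable on
  the line.\<close>

definition avg_kernel :: "int \<Rightarrow> real \<Rightarrow> real" where
  "avg_kernel k v = 2 powr of_int k / (1 + 2 powr of_int k * \<bar>v\<bar>) ^ 2"

lemma avg_kernel_nonneg [simp]: "0 \<le> avg_kernel k v"
  by (simp add: avg_kernel_def)

lemma avg_kernel_measurable [measurable]: "avg_kernel k \<in> borel_measurable borel"
  unfolding avg_kernel_def by measurable

lemma nn_integral_inverse_1_plus_square:
  "(\<integral>\<^sup>+ v. ennreal (1 / (1 + v\<^sup>2)) \<partial>lborel) = ennreal pi"
proof -
  have "set_integrable lborel UNIV (\<lambda>x::real. inverse (1 + x^2))"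
    and "(LBINT x=-\<infinity>..\<infinity>. inverse (1 + x^2)) = pi"
    using integrable_inverse_1_plus_square LBINT_inverse_1_plus_square
    by (auto simp: einterval_def)
  then show ?thesis
    by (subst nn_integral_eq_integral)
      (auto simp: set_integrable_def interval_lebesgue_integral_def set_lebesgue_integral_def
        einterval_def inverse_eq_divide zero_ereal_def)
qed

text \<open>(1 + x)^2 \<ge> 1 + x^2 for x \<ge> 0 compares the kernel with a rescaled 1/(1 + x^2),
  whose integral is pi; 4 stands for pi.\<close>

lemma nn_integral_avg_kernel:
  "(\<integral>\<^sup>+ y. ennreal (avg_kernel k (y - t)) \<partial>lborel) \<le> ennreal 4"
proof -
  define c where "c = (2::real) powr of_int k"
  have c: "c > 0" by (simp add: c_def)
  have "(\<integral>\<^sup>+ y. ennreal (avg_kernel k (y - t)) \<partial>lborel) \<le>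
      (\<integral>\<^sup>+ y. ennreal c * ennreal (1 / (1 + (c * (y - t))\<^sup>2)) \<partial>lborel)"
  proof (intro nn_integral_mono)
    fix y
    have "1 + (c * (y - t))\<^sup>2 \<le> (1 + c * \<bar>y - t\<bar>)\<^sup>2"
      using c by (simp add: power2_sum power_mult_distrib)
    moreover have "0 < 1 + (c * (y - t))\<^sup>2" by (smt (verit) zero_le_power2)
    ultimately show "ennreal (avg_kernel k (y - t)) \<le> ennreal c * ennreal (1 / (1 + (c * (y - t))\<^sup>2))"
      using c unfolding avg_kernel_def c_def[symmetric]
      by (subst ennreal_mult[symmetric]) (auto intro!: ennreal_leI divide_left_mono mult_pos_pos)
  qed
  also have "\<dots> = ennreal c * (\<integral>\<^sup>+ y. ennreal (1 / (1 + (c * (y - t))\<^sup>2)) \<partial>lborel)"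
    by (simp add: nn_integral_cmult)
  also have "(\<integral>\<^sup>+ y. ennreal (1 / (1 + (c * (y - t))\<^sup>2)) \<partial>lborel) =
     ennreal \<bar>1 / c\<bar> * (\<integral>\<^sup>+ v. ennreal (1 / (1 + (c * ((t + 1 / c * v) - t))\<^sup>2)) \<partial>lborel)"
    using c by (intro nn_integral_real_affine) auto
  also have "\<dots> = ennreal (1 / c) * ennreal pi"
    using c by (simp add: nn_integral_inverse_1_plus_square)
  also have "ennreal c * (ennreal (1 / c) * ennreal pi) = ennreal pi"
    using c by (simp add: ennreal_mult[symmetric])
  also have "\<dots> \<le> ennreal 4" using pi_less_4 by (intro ennreal_leI) simp
  finally show ?thesis .
qed

lemma avg_kernel_shell_le:
  assumes "\<And>y. y \<in> dyadic_shell i \<Longrightarrow> avg_kernel k (y - t) \<le> 2 powr c"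
  shows "(\<integral>\<^sup>+ y. ennreal (avg_kernel k (y - t)) * indicator (dyadic_shell i) y \<partial>lborel) \<le>
    ennreal (2 * 2 powr (c + of_int i))"
proof -
  have "(\<integral>\<^sup>+ y. ennreal (avg_kernel k (y - t)) * indicator (dyadic_shell i) y \<partial>lborel) \<le>
     (\<integral>\<^sup>+ y. ennreal (2 powr c) * indicator (dyadic_shell i) y \<partial>lborel)"
    by (intro nn_integral_mono) (auto split: split_indicator intro!: ennreal_leI assms)
  also have "\<dots> = ennreal (2 powr c) * emeasure lborel (dyadic_shell i)"
    by (simp add: nn_integral_cmult_indicator)
  also have "\<dots> \<le> ennreal (2 powr c) * ennreal (2 * 2 powr of_int i)"
    by (intro mult_left_mono emeasure_dyadic_shell) simp
  also have "\<dots> = ennreal (2 * 2 powr (c + of_int i))"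
    by (simp add: ennreal_mult[symmetric] powr_add mult_ac)
  finally show ?thesis .
qed

lemma avg_kernel_far:
  assumes "2 powr e \<le> \<bar>v\<bar>"
  shows "avg_kernel k v \<le> 2 powr (- of_int k - 2 * e)"
proof -
  have "avg_kernel k v \<le> 2 powr of_int k / (2 powr of_int k * 2 powr e) ^ 2"
    unfolding avg_kernel_def using assms
    by (intro divide_left_mono power_mono mult_pos_pos zero_less_power)
      (auto intro!: add_increasing mult_left_mono add_pos_nonneg)
  also have "\<dots> = 2 powr (- of_int k - 2 * e)"
    by (simp add: power2_eq_square powr_add[symmetric] powr_diff[symmetric] powr_minus[symmetric])
  finally show ?thesis .
qed

text \<open>The kernel does not resolve distances below 2^-k, so t acts as if it lay in shell max j
  (-k). Small shells are charged their length times the height of the kernel, neighbours of t the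
  total mass, and shells far from t the quadratic decay at the larger of the two radii. The constant
  32 = 2 * 2^4 pays for a distance 2^(i-2) or 2^(j-2) instead of 2^i or 2^j.\<close>

lemma avg_kernel_shell:
  assumes t: "t \<in> dyadic_shell j"
  shows "(\<integral>\<^sup>+ y. ennreal (avg_kernel k (y - t)) * indicator (dyadic_shell i) y \<partial>lborel) \<le>
    ennreal (32 * 2 powr (- real_of_int \<bar>i - max j (- k)\<bar>))" (is "?I \<le> _")
proof -
  have "avg_kernel k v \<le> 2 powr of_int k" for v
  proof -
    have "2 powr of_int k / (1 + 2 powr of_int k * \<bar>v\<bar>) ^ 2 \<le> 2 powr of_int k / 1"
      by (intro divide_left_mono mult_pos_pos zero_less_power add_pos_nonneg) auto
    then show ?thesis by (simp add: avg_kernel_def)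
  qed
  then have a: "?I \<le> ennreal (2 * 2 powr (of_int k + of_int i))"
    by (intro avg_kernel_shell_le)
  have b: "?I \<le> ennreal 4"
    by (rule order_trans[OF _ nn_integral_avg_kernel[of k t]])
      (auto intro!: nn_integral_mono split: split_indicator)
  have half: "2 powr (of_int i - 1) = 2 * 2 powr (of_int i - 2::real)" for i
    using powr_add[of 2 1 "of_int i - 2::real"] by simp
  have c: "?I \<le> ennreal (32 * 2 powr (- of_int k - of_int i))" if "j \<le> i - 2"
  proof -
    have "?I \<le> ennreal (2 * 2 powr (- of_int k - 2 * (of_int i - 2) + of_int i))"
    proof (intro avg_kernel_shell_le avg_kernel_far)
      fix y assume "y \<in> dyadic_shell i"
      then have "2 powr (of_int i - 1) \<le> \<bar>y\<bar>" by (simp add: dyadic_shell_iff)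
      moreover have "\<bar>t\<bar> < 2 powr (of_int i - 2)"
      proof -
        have "2 powr (of_int j) \<le> 2 powr (of_int i - 2 :: real)" using that by (intro powr_mono) auto
        then show ?thesis using t unfolding dyadic_shell_iff by linarith
      qed
      ultimately show "2 powr (of_int i - 2) \<le> \<bar>y - t\<bar>" using half[of i] by linarith
    qed
    also have "(- of_int k - 2 * (of_int i - 2) + of_int i :: real) = 4 + (- of_int k - of_int i)" by simp
    finally show ?thesis by (simp add: powr_add)
  qed
  have d: "?I \<le> ennreal (32 * 2 powr (- of_int k - 2 * of_int j + of_int i))" if "i \<le> j - 2"
  proof -
    have "?I \<le> ennreal (2 * 2 powr (- of_int k - 2 * (of_int j - 2) + of_int i))"
    proof (intro avg_kernel_shell_le avg_kernel_far)
      fix y assume "y \<in> dyadic_shell i"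
      then have "\<bar>y\<bar> < 2 powr of_int i" by (simp add: dyadic_shell_iff)
      also have "2 powr (of_int i) \<le> 2 powr (of_int j - 2 :: real)" using that by (intro powr_mono) auto
      finally show "2 powr (of_int j - 2) \<le> \<bar>y - t\<bar>" using half[of j] t unfolding dyadic_shell_iff by linarith
    qed
    also have "(- of_int k - 2 * (of_int j - 2) + of_int i :: real) = 4 + (- of_int k - 2 * of_int j + of_int i)" by simp
    finally show ?thesis by (simp add: powr_add)
  qed
  have fin: ?thesis if "?I \<le> ennreal (32 * 2 powr e)" "e \<le> - real_of_int \<bar>i - max j (- k)\<bar>" for e
    by (rule order_trans[OF that(1)]) (use that(2) in \<open>auto intro!: ennreal_leI powr_mono\<close>)
  have near: "?I \<le> ennreal (32 * 2 powr (-1))"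
    by (rule order_trans[OF b]) (auto intro!: ennreal_leI simp: powr_minus)
  have a': "?I \<le> ennreal (32 * 2 powr (of_int k + of_int i))"
    by (rule order_trans[OF a]) (auto intro!: ennreal_leI)
  consider "- k \<le> j" "\<bar>i - j\<bar> \<le> 1" | "- k \<le> j" "j \<le> i - 2" | "- k \<le> j" "i \<le> j - 2"
    | "j < - k" "i \<le> - k" | "j < - k" "- k < i" by linarith
  then show ?thesis
  proof cases
    case 1 then show ?thesis by (intro fin[OF near]) auto
  next
    case 2 then show ?thesis by (intro fin[OF c]) auto
  next
    case 3 then show ?thesis by (intro fin[OF d]) auto
  next
    case 4 then show ?thesis by (intro fin[OF a']) auto
  next
    case 5 then show ?thesis by (intro fin[OF c]) auto
  qed
qed

section \<open>Geometric series over the integers and the naturals\<close>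

lemma tsum_bij: "bij g \<Longrightarrow> tsum (\<lambda>k. f (g k)) = tsum f"
  using nn_integral_bij_count_space[of g UNIV UNIV f] by simp

lemma tsum_int_le:
  "tsum (f :: int \<Rightarrow> ennreal) \<le> tsum (\<lambda>n::nat. f (int n)) + tsum (\<lambda>n::nat. f (- int n))"
proof -
  have "tsum f \<le> (\<integral>\<^sup>+ i. f i * indicator (range int) i + f i * indicator (range (\<lambda>n. - int n)) i \<partial>count_space UNIV)"
  proof (intro nn_integral_mono)
    fix i :: int
    have "i \<in> range int \<or> i \<in> range (\<lambda>n. - int n)"
      by (metis int_cases2 rangeI)
    then show "f i \<le> f i * indicator (range int) i + f i * indicator (range (\<lambda>n. - int n)) i"
      by (auto split: split_indicator)
  qed
  also have "\<dots> = (\<integral>\<^sup>+ i. f i * indicator (range int) i \<partial>count_space UNIV) +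
      (\<integral>\<^sup>+ i. f i * indicator (range (\<lambda>n. - int n)) i \<partial>count_space UNIV)"
    by (rule nn_integral_add) auto
  also have "(\<integral>\<^sup>+ i. f i * indicator (range int) i \<partial>count_space UNIV) = tsum (\<lambda>n. f (int n))"
    by (subst nn_integral_count_space_indicator[symmetric])
      (auto intro!: nn_integral_bij_count_space[symmetric] inj_on_imp_bij_betw)
  also have "(\<integral>\<^sup>+ i. f i * indicator (range (\<lambda>n. - int n)) i \<partial>count_space UNIV) = tsum (\<lambda>n. f (- int n))"
    by (subst nn_integral_count_space_indicator[symmetric])
      (auto intro!: nn_integral_bij_count_space[symmetric] inj_on_imp_bij_betw injI)
  finally show ?thesis .
qed

text \<open>Bounds the two-sided series of 2^(-\<sigma> |i|): two one-sided series, with the term at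
  0 counted twice.\<close>

definition geo_const :: "real \<Rightarrow> real" where
  "geo_const \<sigma> = 2 / (1 - 2 powr (- \<sigma>))"

lemma geo_const_nonneg: "0 < \<sigma> \<Longrightarrow> 0 \<le> geo_const \<sigma>"
  by (simp add: geo_const_def powr_less_one less_imp_le)

lemma tsum_geometric:
  assumes "0 < \<sigma>"
  shows "tsum (\<lambda>n::nat. ennreal (2 powr (- \<sigma> * real n))) = ennreal (geo_const \<sigma> / 2)"
proof -
  define \<rho> where "\<rho> = 2 powr (- \<sigma>)"
  have \<rho>: "0 \<le> \<rho>" "\<rho> < 1" using assms by (auto simp: \<rho>_def powr_less_one)
  have eq: "2 powr (- \<sigma> * real n) = \<rho> ^ n" for n
  proof -
    have "\<rho> ^ n = \<rho> powr real n" by (simp add: \<rho>_def powr_realpow)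
    then show ?thesis by (simp add: \<rho>_def powr_powr)
  qed
  have "(\<Sum>n. ennreal (\<rho> ^ n)) = ennreal (1 / (1 - \<rho>))"
    using \<rho> by (intro suminf_ennreal_eq geometric_sums) auto
  also have "1 / (1 - \<rho>) = geo_const \<sigma> / 2"
    using \<rho> by (simp add: geo_const_def \<rho>_def[symmetric] field_simps)
  finally show ?thesis unfolding nn_integral_count_space_nat eq .
qed

lemma tsum_geometric_int:
  assumes \<sigma>: "0 < \<sigma>"
  shows "tsum (\<lambda>i::int. ennreal (2 powr (- \<sigma> * real_of_int \<bar>i - J\<bar>))) \<le> ennreal (geo_const \<sigma>)"
proof -
  have "tsum (\<lambda>i::int. ennreal (2 powr (- \<sigma> * real_of_int \<bar>i - J\<bar>))) = tsum (\<lambda>i::int. ennreal (2 powr (- \<sigma> * real_of_int \<bar>i\<bar>)))"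
    using tsum_bij[of "\<lambda>i. i - J" "\<lambda>i. ennreal (2 powr (- \<sigma> * real_of_int \<bar>i\<bar>))"]
    by (simp add: bij_diff_right)
  also have "\<dots> \<le> ennreal (geo_const \<sigma> / 2) + ennreal (geo_const \<sigma> / 2)"
    using tsum_int_le[of "\<lambda>i. ennreal (2 powr (- \<sigma> * real_of_int \<bar>i\<bar>))"]
    by (simp only: abs_minus_cancel abs_of_nat of_int_of_nat_eq tsum_geometric[OF \<sigma>])
  also have "\<dots> = ennreal (geo_const \<sigma>)"
    using geo_const_nonneg[OF \<sigma>] by (simp add: ennreal_plus[symmetric] del: ennreal_plus)
  finally show ?thesis .
qed

lemma tsum_geometric_nat:
  assumes \<sigma>: "0 < \<sigma>"
  shows "tsum (\<lambda>l::nat. ennreal (2 powr (- \<sigma> * \<bar>real l - real k\<bar>))) \<le> ennreal (geo_const \<sigma>)"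
proof -
  have "tsum (\<lambda>l::nat. ennreal (2 powr (- \<sigma> * \<bar>real l - real k\<bar>))) =
     (\<integral>\<^sup>+ i. ennreal (2 powr (- \<sigma> * real_of_int \<bar>i - int k\<bar>)) \<partial>count_space (range int))"
    using nn_integral_bij_count_space[of int UNIV "range int" "\<lambda>i. ennreal (2 powr (- \<sigma> * real_of_int \<bar>i - int k\<bar>))"]
    by (simp add: inj_on_imp_bij_betw)
  also have "\<dots> \<le> tsum (\<lambda>i::int. ennreal (2 powr (- \<sigma> * real_of_int \<bar>i - int k\<bar>)))"
    by (subst nn_integral_count_space_indicator) (auto intro!: nn_integral_mono split: split_indicator)
  also have "\<dots> \<le> ennreal (geo_const \<sigma>)" by (rule tsum_geometric_int[OF \<sigma>])
  finally show ?thesis .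
qed

section \<open>From discrete sub-mean inequalities to pointwise bounds by shell norms\<close>

text \<open>The inequality is required on the shifted grid for every \<open>s\<close>, with weights
  independent of \<open>s\<close> and \<open>t\<close>. This uniformity is what lets it be
  integrated over \<open>s\<close>.\<close>

definition sub_mean :: "real \<Rightarrow> (int \<Rightarrow> ennreal) \<Rightarrow> real \<Rightarrow> (real \<Rightarrow> ennreal) \<Rightarrow> bool" where
  "sub_mean r w \<delta> g \<longleftrightarrow> (\<forall>t. \<forall>s\<in>{0..<1}.
     enn_powr (g t) r \<le> tsum (\<lambda>m. w m * enn_powr (g (t + \<delta> * (s + of_int m))) r))"

lemma tsum_unit_intervals: "tsum (\<lambda>m. x * indicator {real_of_int m..<real_of_int m + 1} v) = x"
proof -
  have "x * indicator {real_of_int m..<real_of_int m + 1} v = x * indicator {\<lfloor>v\<rfloor>} m" for m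
  proof (cases "m = \<lfloor>v\<rfloor>")
    case False
    then have "v \<notin> {real_of_int m..<real_of_int m + 1}"
      using floor_unique[of m v] by auto
    with False show ?thesis by simp
  qed simp
  then have "tsum (\<lambda>m. x * indicator {real_of_int m..<real_of_int m + 1} v) = tsum (\<lambda>m. x * indicator {\<lfloor>v\<rfloor>} m)"
    by (simp only:)
  then show ?thesis by simp
qed

text \<open>When s runs through [0, 1), the points s + m sweep the line once, so integration over s
  turns the discrete mean into an average against \<open>avg_kernel\<close>. The factor 4 appears
  because 1 + |v| \<le> 2 (1 + |m|) for v in [m, m + 1).\<close>

lemma sub_mean_kernel:
  assumes sm: "sub_mean r w (2 powr (- real k)) g" and c: "0 \<le> c"
    and w: "\<And>m. w m \<le> ennreal (c / (1 + \<bar>real_of_int m\<bar>) ^ 2)"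
    and g [measurable]: "g \<in> borel_measurable borel"
  shows "enn_powr (g t) r \<le>
    ennreal (4 * c) * (\<integral>\<^sup>+ y. enn_powr (g y) r * ennreal (avg_kernel (int k) (y - t)) \<partial>lborel)"
proof -
  define \<delta> where "\<delta> = 2 powr (- real k)"
  have \<delta>: "\<delta> > 0" "\<delta> * 2 powr real k = 1" by (auto simp: \<delta>_def powr_add[symmetric])
  define G where "G y = enn_powr (g y) r" for y
  have [measurable]: "G \<in> borel_measurable borel" unfolding G_def by measurable
  have "G t = (\<integral>\<^sup>+ s. G t * indicator {0..<1::real} s \<partial>lborel)"
    by (simp add: nn_integral_cmult_indicator)
  also have "\<dots> \<le> (\<integral>\<^sup>+ s. tsum (\<lambda>m. w m * G (t + \<delta> * (s + of_int m)) * indicator {0..<1} s) \<partial>lborel)"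
    using sm by (intro nn_integral_mono) (auto simp: sub_mean_def G_def \<delta>_def split: split_indicator)
  also have "\<dots> = tsum (\<lambda>m. \<integral>\<^sup>+ s. w m * G (t + \<delta> * (s + of_int m)) * indicator {0..<1} s \<partial>lborel)"
    by (rule tsum_nn_integral) simp
  also have "\<dots> \<le> tsum (\<lambda>m. \<integral>\<^sup>+ v. ennreal (4 * c / (1 + \<bar>v\<bar>) ^ 2) * G (t + \<delta> * v) *
      indicator {real_of_int m..<real_of_int m + 1} v \<partial>lborel)"
  proof (rule nn_integral_mono)
    fix m :: int
    have "(\<integral>\<^sup>+ v. w m * G (t + \<delta> * v) * indicator {real_of_int m..<real_of_int m + 1} v \<partial>lborel) =
       ennreal \<bar>1\<bar> * (\<integral>\<^sup>+ s. w m * G (t + \<delta> * (real_of_int m + 1 * s)) *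
         indicator {real_of_int m..<real_of_int m + 1} (real_of_int m + 1 * s) \<partial>lborel)"
      by (rule nn_integral_real_affine) auto
    also have "\<dots> = (\<integral>\<^sup>+ s. w m * G (t + \<delta> * (s + of_int m)) * indicator {0..<1} s \<partial>lborel)"
      by (simp add: add.commute) (auto intro!: nn_integral_cong split: split_indicator)
    finally have eq: "(\<integral>\<^sup>+ s. w m * G (t + \<delta> * (s + of_int m)) * indicator {0..<1} s \<partial>lborel) =
      (\<integral>\<^sup>+ v. w m * G (t + \<delta> * v) * indicator {real_of_int m..<real_of_int m + 1} v \<partial>lborel)" by simp
    show "(\<integral>\<^sup>+ s. w m * G (t + \<delta> * (s + of_int m)) * indicator {0..<1} s \<partial>lborel) \<le>
      (\<integral>\<^sup>+ v. ennreal (4 * c / (1 + \<bar>v\<bar>) ^ 2) * G (t + \<delta> * v) *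
      indicator {real_of_int m..<real_of_int m + 1} v \<partial>lborel)"
      unfolding eq
    proof (rule nn_integral_mono)
      fix v
      show "w m * G (t + \<delta> * v) * indicator {real_of_int m..<real_of_int m + 1} v \<le>
        ennreal (4 * c / (1 + \<bar>v\<bar>) ^ 2) * G (t + \<delta> * v) * indicator {real_of_int m..<real_of_int m + 1} v"
      proof (cases "v \<in> {real_of_int m..<real_of_int m + 1}")
        case True
        then have "1 + \<bar>v\<bar> \<le> 2 * (1 + \<bar>real_of_int m\<bar>)" by auto
        then have "(1 + \<bar>v\<bar>)\<^sup>2 \<le> (2 * (1 + \<bar>real_of_int m\<bar>))\<^sup>2" by (intro power_mono) auto
        then have "c * (1 + \<bar>v\<bar>)\<^sup>2 \<le> 4 * c * (1 + \<bar>real_of_int m\<bar>)\<^sup>2"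
        proof -
          have "(1 + \<bar>v\<bar>)\<^sup>2 \<le> 4 * (1 + \<bar>real_of_int m\<bar>)\<^sup>2"
            using \<open>(1 + \<bar>v\<bar>)\<^sup>2 \<le> _\<close> unfolding power_mult_distrib by simp
          from mult_left_mono[OF this c] show ?thesis by (simp only: mult_ac)
        qed
        then have "c / (1 + \<bar>real_of_int m\<bar>) ^ 2 \<le> 4 * c / (1 + \<bar>v\<bar>) ^ 2"
          by (subst frac_le_eq) (auto intro!: divide_nonpos_pos mult_pos_pos zero_less_power add_pos_nonneg)
        then have "w m \<le> ennreal (4 * c / (1 + \<bar>v\<bar>) ^ 2)"
          using order_trans[OF w] by (auto intro: ennreal_leI)
        then show ?thesis by (intro mult_right_mono) auto
      qed simp
    qed
  qed
  also have "\<dots> = (\<integral>\<^sup>+ v. tsum (\<lambda>m. ennreal (4 * c / (1 + \<bar>v\<bar>) ^ 2) * G (t + \<delta> * v) *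
      indicator {real_of_int m..<real_of_int m + 1} v) \<partial>lborel)"
    by (rule tsum_nn_integral[symmetric]) simp
  also have "\<dots> = (\<integral>\<^sup>+ v. ennreal (4 * c / (1 + \<bar>v\<bar>) ^ 2) * G (t + \<delta> * v) \<partial>lborel)"
    by (simp only: tsum_unit_intervals)
  also have "\<dots> = ennreal (4 * c) * (ennreal \<bar>\<delta>\<bar> * (\<integral>\<^sup>+ v. G (t + \<delta> * v) * ennreal (avg_kernel (int k) ((t + \<delta> * v) - t)) \<partial>lborel))"
  proof -
    have "ennreal (4 * c / (1 + \<bar>v\<bar>) ^ 2) * G (t + \<delta> * v) =
       ennreal (4 * c) * (ennreal \<delta> * (G (t + \<delta> * v) * ennreal (avg_kernel (int k) ((t + \<delta> * v) - t))))" for v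
    proof -
      have "4 * c / (1 + \<bar>v\<bar>) ^ 2 = 4 * c * (\<delta> * avg_kernel (int k) ((t + \<delta> * v) - t))"
        using \<delta> by (simp add: avg_kernel_def abs_mult mult.assoc[symmetric])
          (simp add: mult.commute[of "2 powr _" \<delta>])
      then have "ennreal (4 * c / (1 + \<bar>v\<bar>) ^ 2) = ennreal (4 * c) * (ennreal \<delta> * ennreal (avg_kernel (int k) ((t + \<delta> * v) - t)))"
        using c \<delta> by (simp add: ennreal_mult)
      then show ?thesis by (simp add: mult_ac)
    qed
    then show ?thesis using \<delta> by (simp add: nn_integral_cmult)
  qed
  also have "ennreal \<bar>\<delta>\<bar> * (\<integral>\<^sup>+ v. G (t + \<delta> * v) * ennreal (avg_kernel (int k) ((t + \<delta> * v) - t)) \<partial>lborel) =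
     (\<integral>\<^sup>+ y. G y * ennreal (avg_kernel (int k) (y - t)) \<partial>lborel)"
    using \<delta> by (intro nn_integral_real_affine[symmetric]) auto
  finally show ?thesis by (simp add: G_def)
qed

definition shell_norm :: "real \<Rightarrow> (real \<Rightarrow> ennreal) \<Rightarrow> int \<Rightarrow> ennreal" where
  "shell_norm q g i = Lp_norm (ennreal q) (\<lambda>t. g t * indicator (dyadic_shell i) t)"

lemma shell_norm_powr:
  "0 < q \<Longrightarrow> enn_powr (shell_norm q g i) q = (\<integral>\<^sup>+ t. enn_powr (g t) q * indicator (dyadic_shell i) t \<partial>lborel)"
  by (simp add: shell_norm_def Lp_norm_ennreal enn_powr_mult_indicator)

text \<open>Hoelder with the exponent q/r puts g into L^q of the shell. What is left is the integral
  of a power of the kernel, which is controlled by the kernel itself because that is at most 2^k.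
  The price 2^(k r/q) is the Nikolskii factor.\<close>

lemma shell_kernel_le:
  assumes r: "0 < r" "r < q" and t: "t \<in> dyadic_shell j"
    and g [measurable]: "g \<in> borel_measurable borel"
  shows "(\<integral>\<^sup>+ y. enn_powr (g y) r * ennreal (avg_kernel (int k) (y - t)) * indicator (dyadic_shell i) y \<partial>lborel) \<le>
    ennreal (32 * 2 powr (real k * (r / q))) *
      (ennreal (2 powr (- (1 - r / q) * real_of_int \<bar>i - max j (- int k)\<bar>)) * enn_powr (shell_norm q g i) r)"
proof -
  define a where "a = r / q"
  have a: "0 < a" "a < 1" using r by (auto simp: a_def)
  \<comment> \<open>Chosen so that (2^E K)^(1 - a) \<ge> K for the kernel K, with equality at its
    peak K = 2^k.\<close>
  define E where "E = real k * (1 / (1 - a) - 1)"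
  have E: "E * (1 - a) = real k * a" using a by (simp add: E_def field_simps)
  define e where "e = real_of_int \<bar>i - max j (- int k)\<bar>"
  define H where "H y = ennreal (2 powr (E)) * (ennreal (avg_kernel (int k) (y - t)) * indicator (dyadic_shell i) y)" for y
  have [measurable]: "H \<in> borel_measurable borel" unfolding H_def by measurable
  have KH: "ennreal (avg_kernel (int k) v) \<le> enn_powr (ennreal (2 powr (E)) * ennreal (avg_kernel (int k) v)) (1 - a)" for v
  proof -
    define u where "u = 1 + 2 powr real k * \<bar>v\<bar>"
    have u: "1 \<le> u" by (simp add: u_def)
    have K: "avg_kernel (int k) v = 2 powr (real k) * u powr (-2)"
      using u by (simp add: avg_kernel_def u_def powr_minus divide_inverse powr_numeral)
    have "u powr (-2) \<le> u powr (-2 * (1 - a))"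
      using u a by (intro powr_mono) auto
    then have "avg_kernel (int k) v \<le> 2 powr real k * u powr (-2 * (1 - a))"
      unfolding K by (intro mult_left_mono) auto
    also have "\<dots> = (2 powr (E) * avg_kernel (int k) v) powr (1 - a)"
    proof -
      have K2: "2 powr (E * (1 - a)) * (2::real) powr (real k * (1 - a)) = 2 powr real k"
        unfolding E powr_add[symmetric] by (simp add: right_diff_distrib)
      have "(2 powr E * (2 powr real k * u powr - 2)) powr (1 - a) =
          (2 powr (E * (1 - a)) * 2 powr (real k * (1 - a))) * u powr (-2 * (1 - a))"
        using u by (simp only: powr_mult powr_powr mult.assoc)
      then show ?thesis unfolding K K2 by simp
    qed
    finally show ?thesis
      by (simp add: ennreal_mult[symmetric] enn_powr_ennreal ennreal_leI)
  qed
  have "(\<integral>\<^sup>+ y. enn_powr (g y) r * ennreal (avg_kernel (int k) (y - t)) * indicator (dyadic_shell i) y \<partial>lborel) \<le>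
    (\<integral>\<^sup>+ y. enn_powr (enn_powr (g y) q * indicator (dyadic_shell i) y) a * enn_powr (H y) (1 - a) \<partial>lborel)"
  proof (rule nn_integral_mono)
    fix y
    show "enn_powr (g y) r * ennreal (avg_kernel (int k) (y - t)) * indicator (dyadic_shell i) y \<le>
      enn_powr (enn_powr (g y) q * indicator (dyadic_shell i) y) a * enn_powr (H y) (1 - a)"
      using KH[of "y - t"] r
      by (auto simp: H_def enn_powr_powr a_def intro!: mult_left_mono split: split_indicator)
  qed
  also have "\<dots> \<le> enn_powr (\<integral>\<^sup>+ y. enn_powr (g y) q * indicator (dyadic_shell i) y \<partial>lborel) a * enn_powr (\<integral>\<^sup>+ y. H y \<partial>lborel) (1 - a)"
    using a by (intro enn_Hoelder) auto
  also have "(\<integral>\<^sup>+ y. enn_powr (g y) q * indicator (dyadic_shell i) y \<partial>lborel) = enn_powr (shell_norm q g i) q"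
    using r by (simp add: shell_norm_powr)
  also have "enn_powr (enn_powr (shell_norm q g i) q) a = enn_powr (shell_norm q g i) r"
    using r by (simp add: enn_powr_powr a_def)
  also have "enn_powr (\<integral>\<^sup>+ y. H y \<partial>lborel) (1 - a) \<le> ennreal (32 * 2 powr (real k * a)) * ennreal (2 powr (- (1 - a) * e))"
  proof -
    have "(\<integral>\<^sup>+ y. H y \<partial>lborel) \<le> ennreal (2 powr (E)) * ennreal (32 * 2 powr (- e))"
      unfolding H_def e_def
      by (subst nn_integral_cmult, simp, intro mult_left_mono avg_kernel_shell t, simp)
    then have "enn_powr (\<integral>\<^sup>+ y. H y \<partial>lborel) (1 - a) \<le>
       enn_powr (ennreal (2 powr (E) * (32 * 2 powr (- e)))) (1 - a)"
      using a by (intro enn_powr_mono) (simp_all add: ennreal_mult)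
    also have "\<dots> = ennreal ((2 powr (E) * (32 * 2 powr (- e))) powr (1 - a))"
      by (simp add: enn_powr_ennreal)
    also have "(2 powr (E) * (32 * 2 powr (- e))) powr (1 - a) =
        32 powr (1 - a) * 2 powr (real k * a) * 2 powr (- (1 - a) * e)"
    proof -
      have e3: "- e * (1 - a) = - (1 - a) * e" by (simp only: minus_mult_left[symmetric] mult.commute)
      show ?thesis by (simp only: powr_mult powr_powr E e3 mult_ac)
    qed
    also have "\<dots> \<le> 32 powr 1 * 2 powr (real k * a) * 2 powr (- (1 - a) * e)"
      using a by (intro mult_right_mono powr_mono) auto
    finally show ?thesis by (simp add: ennreal_mult[symmetric] ennreal_leI)
  qed
  finally have "(\<integral>\<^sup>+ y. enn_powr (g y) r * ennreal (avg_kernel (int k) (y - t)) * indicator (dyadic_shell i) y \<partial>lborel) \<le>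
    enn_powr (shell_norm q g i) r * (ennreal (32 * 2 powr (real k * a)) * ennreal (2 powr (- (1 - a) * e)))"
    by (simp add: mult_left_mono)
  then show ?thesis unfolding a_def e_def by (simp only: mult_ac)
qed

text \<open>At distances below \<open>2\<^sup>-\<^sup>k\<close> from the origin the function is essentially constant, so the shells
  \<open>j < - k\<close> are treated like the shell \<open>- k\<close>.\<close>

definition shell_mean :: "real \<Rightarrow> real \<Rightarrow> real \<Rightarrow> (real \<Rightarrow> ennreal) \<Rightarrow> nat \<Rightarrow> int \<Rightarrow> ennreal" where
  "shell_mean \<sigma> p q g k j = tsum (\<lambda>i. ennreal (2 powr (- \<sigma> * real_of_int \<bar>i - max j (- int k)\<bar>)) *
     enn_powr (shell_norm q g i) p)"

text \<open>128 = 4 * 32 combines the constants of \<open>sub_mean_kernel\<close> and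
  \<open>shell_kernel_le\<close>; the last factor is the mass of the geometric weights that Jensen's
  inequality leaves.\<close>

definition peetre_const :: "real \<Rightarrow> real \<Rightarrow> real \<Rightarrow> real \<Rightarrow> real" where
  "peetre_const c r q p = (128 * c) powr (p / r) * geo_const (1 - r / q) powr (p / r - 1)"

text \<open>The average over the line is cut into shells, each piece is bounded in L^q, and Jensen's
  inequality for the geometric weights raises the sum of r-th powers to the power p/r. Passing from
  L^q to a pointwise bound costs 2^(k/q), here raised to the power p.\<close>

lemma sub_mean_shell_mean:
  assumes sm: "sub_mean r w (2 powr (- real k)) g" and c: "0 \<le> c"
    and w: "\<And>m. w m \<le> ennreal (c / (1 + \<bar>real_of_int m\<bar>) ^ 2)"
    and g [measurable]: "g \<in> borel_measurable borel"
    and r: "0 < r" "r < q" "q < p" and t: "t \<in> dyadic_shell j"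
  shows "enn_powr (g t) p \<le> ennreal (peetre_const c r q p * 2 powr (real k * (p / q))) * shell_mean (1 - r / q) p q g k j"
proof -
  define \<sigma> where "\<sigma> = 1 - r / q"
  have \<sigma>: "0 < \<sigma>" using r by (simp add: \<sigma>_def)
  define \<omega> where "\<omega> i = ennreal (2 powr (- \<sigma> * real_of_int \<bar>i - max j (- int k)\<bar>))" for i
  have "enn_powr (g t) r \<le> ennreal (4 * c) * (\<integral>\<^sup>+ y. enn_powr (g y) r * ennreal (avg_kernel (int k) (y - t)) \<partial>lborel)"
    by (rule sub_mean_kernel[OF sm c w g])
  also have "(\<integral>\<^sup>+ y. enn_powr (g y) r * ennreal (avg_kernel (int k) (y - t)) \<partial>lborel) =
     tsum (\<lambda>i. \<integral>\<^sup>+ y. enn_powr (g y) r * ennreal (avg_kernel (int k) (y - t)) * indicator (dyadic_shell i) y \<partial>lborel)"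
    by (rule nn_integral_dyadic_shells) simp
  also have "\<dots> \<le> tsum (\<lambda>i. ennreal (32 * 2 powr (real k * (r / q))) * (\<omega> i * enn_powr (shell_norm q g i) r))"
    unfolding \<omega>_def \<sigma>_def by (intro nn_integral_mono shell_kernel_le r t g)
  also have "\<dots> = ennreal (32 * 2 powr (real k * (r / q))) * tsum (\<lambda>i. \<omega> i * enn_powr (shell_norm q g i) r)"
    by (rule nn_integral_cmult) simp
  finally have "enn_powr (g t) r \<le> ennreal (128 * c * 2 powr (real k * (r / q))) * tsum (\<lambda>i. \<omega> i * enn_powr (shell_norm q g i) r)"
    using c by (simp add: mult_left_mono mult.assoc[symmetric] ennreal_mult[symmetric])
  then have "enn_powr (enn_powr (g t) r) (p / r) \<le>
     enn_powr (ennreal (128 * c * 2 powr (real k * (r / q))) * tsum (\<lambda>i. \<omega> i * enn_powr (shell_norm q g i) r)) (p / r)"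
    using r by (intro enn_powr_mono) auto
  also have "enn_powr (enn_powr (g t) r) (p / r) = enn_powr (g t) p"
    using r by (simp add: enn_powr_powr)
  also have "enn_powr (ennreal (128 * c * 2 powr (real k * (r / q))) * tsum (\<lambda>i. \<omega> i * enn_powr (shell_norm q g i) r)) (p / r) =
     ennreal ((128 * c) powr (p / r) * 2 powr (real k * (p / q))) * enn_powr (tsum (\<lambda>i. \<omega> i * enn_powr (shell_norm q g i) r)) (p / r)"
    using c r by (simp add: enn_powr_mult enn_powr_ennreal powr_mult powr_powr)
  also have "enn_powr (tsum (\<lambda>i. \<omega> i * enn_powr (shell_norm q g i) r)) (p / r) \<le>
     enn_powr (tsum \<omega>) (p / r - 1) * tsum (\<lambda>i. \<omega> i * enn_powr (enn_powr (shell_norm q g i) r) (p / r))"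
    using r by (intro enn_Jensen) (auto simp: less_divide_eq)
  also have "tsum (\<lambda>i. \<omega> i * enn_powr (enn_powr (shell_norm q g i) r) (p / r)) = shell_mean \<sigma> p q g k j"
    using r by (simp add: shell_mean_def \<omega>_def enn_powr_powr)
  also have "enn_powr (tsum \<omega>) (p / r - 1) \<le> ennreal (geo_const \<sigma> powr (p / r - 1))"
  proof -
    have "tsum \<omega> \<le> ennreal (geo_const \<sigma>)" unfolding \<omega>_def by (rule tsum_geometric_int[OF \<sigma>])
    then have "enn_powr (tsum \<omega>) (p / r - 1) \<le> enn_powr (ennreal (geo_const \<sigma>)) (p / r - 1)"
      using r by (intro enn_powr_mono) (auto simp: le_divide_eq)
    then show ?thesis using geo_const_nonneg[OF \<sigma>] by (simp add: enn_powr_ennreal)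
  qed
  finally show ?thesis using c
    by (simp add: mult_left_mono mult_right_mono \<sigma>_def peetre_const_def ennreal_mult mult_ac)
qed

subsection \<open>The one-dimensional embedding\<close>

text \<open>A supremum need not be attained; an index that reaches half of it takes the place of a
  maximum.\<close>

lemma enn_powr_SUP_half:
  fixes a :: "nat \<Rightarrow> ennreal"
  assumes "(SUP k. a k) \<noteq> top"
  shows "\<exists>K. \<forall>k. a k \<le> 2 * a K"
proof (cases "(SUP k. a k) = 0")
  case True
  then have "a k = 0" for k by (metis SUP_upper UNIV_I le_zero_eq)
  then show ?thesis by simp
next
  case False
  obtain S where S: "(SUP k. a k) = ennreal S" "0 < S"
    using assms False by (metis ennreal_cases ennreal_eq_0_iff less_eq_real_def not_less)
  have "ennreal (S / 2) < (SUP k. a k)" unfolding S by (intro ennreal_lessI) (use S in auto)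
  then obtain K where K: "ennreal (S / 2) < a K" by (auto simp: less_SUP_iff)
  have "a k \<le> 2 * a K" for k
  proof -
    have "a k \<le> ennreal S" unfolding S(1)[symmetric] by (rule SUP_upper) simp
    also have "\<dots> = 2 * ennreal (S / 2)"
      using S by (simp add: ennreal_mult'[symmetric] flip: ennreal_numeral)
    also have "\<dots> \<le> 2 * a K" using K by (intro mult_left_mono) auto
    finally show ?thesis .
  qed
  then show ?thesis by blast
qed

text \<open>If \<open>a\<^sub>K\<close> is comparable to the supremum, then testing the right-hand side on the pair
  \<open>(k, K)\<close> shows that \<open>a\<^sub>k\<close> decays geometrically in \<open>\<bar>k - K\<bar>\<close>; so the size of \<open>r\<close> is irrelevant.\<close>

lemma tsum_powr_le_pairs:
  fixes a :: "nat \<Rightarrow> ennreal"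
  assumes r: "0 < r" and \<epsilon>: "0 < \<epsilon>" and b: "0 < q" "q < p"
  shows "enn_powr (tsum (\<lambda>k. enn_powr (a k) r)) (p / r) \<le>
    ennreal ((2 powr r * geo_const (\<epsilon> * r / p)) powr (p / r)) *
    tsum (\<lambda>k. tsum (\<lambda>l. if l \<le> k then ennreal (2 powr (\<epsilon> * (real k - real l))) *
      (enn_powr (a k) q * enn_powr (a l) (p - q)) else 0))" (is "_ \<le> _ * ?X")
proof -
  define f where "f k l = (if l \<le> k then ennreal (2 powr (\<epsilon> * (real k - real l))) *
      (enn_powr (a k) q * enn_powr (a l) (p - q)) else 0)" for k l
  define X where "X = ?X"
  have fX: "f k l \<le> X" for k l
    using tsum_ge[of "f k" l] tsum_ge[of "\<lambda>k. tsum (f k)" k] order_trans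
    unfolding X_def f_def by blast
  have p: "0 < p" using b by simp
  have \<gamma>: "0 < \<epsilon> * r / p" using \<epsilon> r p by simp
  have C0: "0 < (2 powr r * geo_const (\<epsilon> * r / p)) powr (p / r)"
  proof -
    have "2 powr - (\<epsilon> * r / p) < (1::real)" using \<gamma> by (intro powr_less_one) auto
    then show ?thesis using \<epsilon> r p by (simp add: geo_const_def)
  qed
  show ?thesis
  proof (cases "X = top")
    case True
    then have "ennreal ((2 powr r * geo_const (\<epsilon> * r / p)) powr (p / r)) * X = top"
      using C0 by (simp add: ennreal_mult_eq_top_iff)
    then show ?thesis unfolding X_def by simp
  next
    case False
    \<comment> \<open>The pairs (k, k) bound every \<open>a k\<close>, so the supremum is finite and
      \<open>K\<close> exists.\<close>
    have diag: "enn_powr (a k) p \<le> X" for k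
    proof -
      have "enn_powr (a k) p = f k k" by (simp add: f_def enn_powr_add[symmetric])
      then show ?thesis using fX by simp
    qed
    have "a k \<le> enn_powr X (1 / p)" for k using diag[of k] p by (simp add: enn_powr_le_iff)
    then have "(SUP k. a k) \<le> enn_powr X (1 / p)" by (intro SUP_least)
    moreover have "enn_powr X (1 / p) \<noteq> top" using False by simp
    ultimately have "(SUP k. a k) \<noteq> top" by (metis top_unique)
    then obtain K where K: "\<And>k. a k \<le> 2 * a K" using enn_powr_SUP_half by blast
    have dec: "enn_powr (a k) r \<le> ennreal (2 powr r * 2 powr (- (\<epsilon> * r / p) * \<bar>real k - real K\<bar>)) * enn_powr X (r / p)" for k
    proof -
      \<comment> \<open>The minimum bounds both factors from below, so it is irrelevant which of k
        and K carries the exponent q. Since \<open>a k\<close> is at most twice \<open>a K\<close>,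
        it is also at most twice the minimum.\<close>
      define m where "m = min (a k) (a K)"
      have m: "m \<le> a k" "m \<le> a K" "a k \<le> 2 * m"
        using K[of k] by (auto simp: m_def min_def mult_le_cancel_right1 intro: order_trans[OF _ mult_right_mono[of 1 2]])
      have "ennreal (2 powr (\<epsilon> * \<bar>real k - real K\<bar>)) * enn_powr m p \<le> X"
      proof -
        have "ennreal (2 powr (\<epsilon> * \<bar>real k - real K\<bar>)) * enn_powr m p =
           ennreal (2 powr (\<epsilon> * \<bar>real k - real K\<bar>)) * (enn_powr m q * enn_powr m (p - q))"
          by (simp add: enn_powr_add[symmetric])
        also have "\<dots> \<le> f (max k K) (min k K)"
          unfolding f_def using b m
          by (cases "K \<le> k") (auto intro!: mult_left_mono mult_mono enn_powr_mono simp: max_def min_def)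
        also have "\<dots> \<le> X" by (rule fX)
        finally show ?thesis .
      qed
      then have "ennreal (2 powr (- \<epsilon> * \<bar>real k - real K\<bar>)) * (ennreal (2 powr (\<epsilon> * \<bar>real k - real K\<bar>)) * enn_powr m p)
        \<le> ennreal (2 powr (- \<epsilon> * \<bar>real k - real K\<bar>)) * X"
        by (intro mult_left_mono) auto
      then have mp: "enn_powr m p \<le> ennreal (2 powr (- \<epsilon> * \<bar>real k - real K\<bar>)) * X"
        by (simp add: mult.assoc[symmetric] ennreal_mult[symmetric] powr_add[symmetric])
      have "enn_powr (a k) r \<le> enn_powr (2 * m) r" using r m by (intro enn_powr_mono) auto
      also have "\<dots> = ennreal (2 powr r) * enn_powr (enn_powr m p) (r / p)"
        using p enn_powr_ennreal[of 2 r] by (simp add: enn_powr_mult enn_powr_powr)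
      also have "\<dots> \<le> ennreal (2 powr r) * enn_powr (ennreal (2 powr (- \<epsilon> * \<bar>real k - real K\<bar>)) * X) (r / p)"
        using r p mp by (intro mult_left_mono enn_powr_mono) auto
      also have "\<dots> = ennreal (2 powr r * 2 powr (- (\<epsilon> * r / p) * \<bar>real k - real K\<bar>)) * enn_powr X (r / p)"
        by (simp add: enn_powr_mult ennreal_mult mult_ac)
      finally show ?thesis .
    qed
    have "tsum (\<lambda>k. enn_powr (a k) r) \<le>
       tsum (\<lambda>k. ennreal (2 powr r) * enn_powr X (r / p) * ennreal (2 powr (- (\<epsilon> * r / p) * \<bar>real k - real K\<bar>)))"
      by (intro nn_integral_mono order_trans[OF dec]) (simp add: ennreal_mult mult_ac)
    also have "\<dots> = ennreal (2 powr r) * enn_powr X (r / p) * tsum (\<lambda>k. ennreal (2 powr (- (\<epsilon> * r / p) * \<bar>real k - real K\<bar>)))"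
      by (rule nn_integral_cmult) simp
    also have "\<dots> \<le> ennreal (2 powr r) * enn_powr X (r / p) * ennreal (geo_const (\<epsilon> * r / p))"
      by (intro mult_left_mono tsum_geometric_nat \<gamma>) auto
    finally have "enn_powr (tsum (\<lambda>k. enn_powr (a k) r)) (p / r) \<le>
       enn_powr (ennreal (2 powr r) * enn_powr X (r / p) * ennreal (geo_const (\<epsilon> * r / p))) (p / r)"
      using r p by (intro enn_powr_mono) auto
    also have "\<dots> = ennreal ((2 powr r * geo_const (\<epsilon> * r / p)) powr (p / r)) * X"
      using r p geo_const_nonneg[OF \<gamma>]
      by (simp add: enn_powr_mult enn_powr_powr enn_powr_ennreal powr_mult powr_powr ennreal_mult mult_ac)
    finally show ?thesis unfolding X_def .
  qed
qed

section \<open>Integrals of pairs of functions living at two scales\<close>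

lemma shell_norm_le_shell_mean:
  assumes "- int k \<le> j"
  shows "enn_powr (shell_norm q g j) p \<le> shell_mean \<sigma> p q g k j"
  using tsum_ge[of "\<lambda>i. ennreal (2 powr (- \<sigma> * real_of_int \<bar>i - max j (- int k)\<bar>)) * enn_powr (shell_norm q g i) p" j]
    assms by (simp add: shell_mean_def max_def)

text \<open>The sum over j is taken first. For j \<ge> -k the weights decay geometrically away from
  i. Below -k all shell means equal the one at -k, and only the factor 2^(\<tau>(j + k)) makes their
  sum converge.\<close>

lemma tsum_shell_mean:
  assumes \<sigma>: "0 < \<sigma>" and \<tau>: "0 < \<tau>"
  shows "tsum (\<lambda>j. ennreal (2 powr (\<tau> * min 0 (of_int j + real k))) * shell_mean \<sigma> p q g k j) \<le>
    ennreal (geo_const \<sigma> + geo_const \<tau>) * tsum (\<lambda>i. enn_powr (shell_norm q g i) p)"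
proof -
  define b where "b i = enn_powr (shell_norm q g i) p" for i
  define u where "u j = ennreal (2 powr (\<tau> * min 0 (of_int j + real k)))" for j
  define \<omega> where "\<omega> i j = ennreal (2 powr (- \<sigma> * real_of_int \<bar>i - max j (- int k)\<bar>))" for i j
  have "tsum (\<lambda>j. u j * shell_mean \<sigma> p q g k j) = tsum (\<lambda>j. tsum (\<lambda>i. u j * (\<omega> i j * b i)))"
    unfolding shell_mean_def \<omega>_def b_def by (intro nn_integral_cong) (simp add: nn_integral_cmult)
  also have "\<dots> = tsum (\<lambda>i. tsum (\<lambda>j. u j * (\<omega> i j * b i)))"
    by (rule tsum_nn_integral) simp
  also have "\<dots> = tsum (\<lambda>i. b i * tsum (\<lambda>j. u j * \<omega> i j))"
    by (intro nn_integral_cong) (simp add: nn_integral_cmult[symmetric] mult_ac)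
  also have "\<dots> \<le> tsum (\<lambda>i. b i * ennreal (geo_const \<sigma> + geo_const \<tau>))"
  proof (intro nn_integral_mono mult_left_mono)
    fix i
    have "tsum (\<lambda>j. u j * \<omega> i j) \<le> tsum (\<lambda>j. ennreal (2 powr (- \<sigma> * real_of_int \<bar>j - i\<bar>)) +
        ennreal (2 powr (- \<tau> * real_of_int \<bar>j - (- int k)\<bar>)))"
    proof (rule nn_integral_mono)
      fix j
      show "u j * \<omega> i j \<le> ennreal (2 powr (- \<sigma> * real_of_int \<bar>j - i\<bar>)) +
        ennreal (2 powr (- \<tau> * real_of_int \<bar>j - (- int k)\<bar>))"
      proof (cases "- int k \<le> j")
        case True
        then have "min 0 (of_int j + real k) = 0" by linarith
        then have "u j * \<omega> i j = ennreal (2 powr (- \<sigma> * real_of_int \<bar>j - i\<bar>))"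
          using True by (simp add: u_def \<omega>_def max_def abs_minus_commute)
        then show ?thesis by simp
      next
        case False
        then have "min 0 (of_int j + real k) = - real_of_int \<bar>j - (- int k)\<bar>" by linarith
        then have "u j = ennreal (2 powr (- \<tau> * real_of_int \<bar>j - (- int k)\<bar>))"
          by (simp only: u_def mult_minus_left mult_minus_right)
        moreover have "\<omega> i j \<le> 1"
        proof -
          have "2 powr (- \<sigma> * real_of_int \<bar>i - max j (- int k)\<bar>) \<le> (2::real) powr 0"
            using \<sigma> by (intro powr_mono) auto
          then show ?thesis by (simp add: \<omega>_def ennreal_le_1)
        qed
        then have "u j * \<omega> i j \<le> u j * 1" by (intro mult_left_mono) auto
        ultimately show ?thesis by (simp add: add_increasing)
      qed
    qed
    also have "\<dots> = tsum (\<lambda>j. ennreal (2 powr (- \<sigma> * real_of_int \<bar>j - i\<bar>))) +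
       tsum (\<lambda>j. ennreal (2 powr (- \<tau> * real_of_int \<bar>j - (- int k)\<bar>)))"
      by (rule nn_integral_add) auto
    also have "\<dots> \<le> ennreal (geo_const \<sigma>) + ennreal (geo_const \<tau>)"
      by (intro add_mono tsum_geometric_int \<sigma> \<tau>)
    finally show "tsum (\<lambda>j. u j * \<omega> i j) \<le> ennreal (geo_const \<sigma> + geo_const \<tau>)"
      using geo_const_nonneg \<sigma> \<tau> by simp
  qed simp
  also have "\<dots> = ennreal (geo_const \<sigma> + geo_const \<tau>) * tsum b"
    by (simp add: nn_integral_multc mult.commute)
  finally show ?thesis by (simp add: u_def b_def)
qed

text \<open>For j \<ge> -k the p-th power of the shell norm is one of the terms of the shell mean.
  For j < -k the pointwise bound times the length of the shell produces the decay 2^(j + k). The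
  constant is the sum of those of the two cases.\<close>

lemma shell_integral_le:
  assumes sm: "sub_mean r w (2 powr (- real k)) g" and c: "0 \<le> c"
    and w: "\<And>m. w m \<le> ennreal (c / (1 + \<bar>real_of_int m\<bar>) ^ 2)"
    and g [measurable]: "g \<in> borel_measurable borel"
    and r: "0 < r" "r < q" "q < p"
  shows "(\<integral>\<^sup>+ t. enn_powr (g t) q * indicator (dyadic_shell j) t \<partial>lborel) \<le>
    ennreal (2 * peetre_const c r q p powr (q / p) + 1) * ennreal (2 powr (min 0 (of_int j + real k))) *
      enn_powr (shell_mean (1 - r / q) p q g k j) (q / p)"
proof (cases "- int k \<le> j")
  case True
  have "(\<integral>\<^sup>+ t. enn_powr (g t) q * indicator (dyadic_shell j) t \<partial>lborel) = enn_powr (enn_powr (shell_norm q g j) p) (q / p)"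
    using r by (simp add: shell_norm_powr[symmetric] enn_powr_powr)
  also have "\<dots> \<le> 1 * 1 * enn_powr (shell_mean (1 - r / q) p q g k j) (q / p)"
    using r shell_norm_le_shell_mean[OF True] by (auto intro!: enn_powr_mono)
  also have "\<dots> \<le> ennreal (2 * peetre_const c r q p powr (q / p) + 1) * ennreal (2 powr (min 0 (of_int j + real k))) *
      enn_powr (shell_mean (1 - r / q) p q g k j) (q / p)"
  proof (intro mult_right_mono mult_mono)
    have "min 0 (of_int j + real k) = 0" using True by linarith
    then show "1 \<le> ennreal (2 powr (min 0 (of_int j + real k)))" by simp
  qed auto
  finally show ?thesis .
next
  case False
  define S where "S = shell_mean (1 - r / q) p q g k j"
  define C where "C = peetre_const c r q p"
  have C: "0 \<le> C" by (simp add: C_def peetre_const_def)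
  have "(\<integral>\<^sup>+ t. enn_powr (g t) q * indicator (dyadic_shell j) t \<partial>lborel) \<le>
    (\<integral>\<^sup>+ t. enn_powr (ennreal (C * 2 powr (real k * (p / q))) * S) (q / p) * indicator (dyadic_shell j) t \<partial>lborel)"
  proof (rule nn_integral_mono)
    fix t
    show "enn_powr (g t) q * indicator (dyadic_shell j) t \<le>
      enn_powr (ennreal (C * 2 powr (real k * (p / q))) * S) (q / p) * indicator (dyadic_shell j) t"
    proof (cases "t \<in> dyadic_shell j")
      case True
      have "enn_powr (g t) q = enn_powr (enn_powr (g t) p) (q / p)" using r by (simp add: enn_powr_powr)
      also have "\<dots> \<le> enn_powr (ennreal (C * 2 powr (real k * (p / q))) * S) (q / p)"
        using r unfolding C_def S_def
        by (intro enn_powr_mono sub_mean_shell_mean[OF sm c w g r True]) auto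
      finally show ?thesis using True by simp
    qed simp
  qed
  also have "\<dots> = enn_powr (ennreal (C * 2 powr (real k * (p / q))) * S) (q / p) * emeasure lborel (dyadic_shell j)"
    by (simp add: nn_integral_cmult_indicator)
  also have "\<dots> \<le> enn_powr (ennreal (C * 2 powr (real k * (p / q))) * S) (q / p) * ennreal (2 * 2 powr of_int j)"
    by (intro mult_left_mono emeasure_dyadic_shell) simp
  also have "\<dots> = ennreal (2 * C powr (q / p) * 2 powr (of_int j + real k)) * enn_powr S (q / p)"
    using C r by (simp add: enn_powr_mult enn_powr_ennreal powr_mult powr_powr powr_add ennreal_mult mult_ac)
  also have "\<dots> \<le> ennreal ((2 * C powr (q / p) + 1) * 2 powr (of_int j + real k)) * enn_powr S (q / p)"
    by (intro mult_right_mono ennreal_leI) auto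
  also have "of_int j + real k = min 0 (of_int j + real k)" using False by linarith
  finally show ?thesis unfolding C_def S_def by (simp add: ennreal_mult)
qed

text \<open>With x = j + l and d = k - l this turns smallness of shell j relative to 2^-k into
  smallness relative to the coarser scale 2^-l, for a loss of 2^(\<tau> d).\<close>

lemma min_shift_le:
  fixes \<tau> :: real
  assumes "0 \<le> \<tau>" "\<tau> \<le> 1" "0 \<le> d"
  shows "min 0 (x + d) \<le> \<tau> * d + \<tau> * min 0 x"
proof (cases "0 \<le> x")
  case True
  then show ?thesis using assms by simp
next
  case False
  have "min 0 (x + d) \<le> \<tau> * min 0 (x + d)"
    using assms by (auto simp: min_def mult_le_cancel_right1)
  also have "\<dots> \<le> \<tau> * (x + d)" using assms by (intro mult_left_mono) auto
  finally show ?thesis using False by (simp add: algebra_simps)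
qed

text \<open>The p-th power of 2^(k(1/q - 1/p)) times the Herz norm of g with exponents q, p and
  weight 0.\<close>

definition franke_weight :: "real \<Rightarrow> real \<Rightarrow> (real \<Rightarrow> ennreal) \<Rightarrow> nat \<Rightarrow> ennreal" where
  "franke_weight p q g k = ennreal (2 powr (real k * (p / q - 1))) * tsum (\<lambda>i. enn_powr (shell_norm q g i) p)"

definition pair_const :: "real \<Rightarrow> real \<Rightarrow> real \<Rightarrow> real \<Rightarrow> real \<Rightarrow> real" where
  "pair_const c r q p \<tau> = (2 * peetre_const c r q p powr (q / p) + 1) * peetre_const c r q p powr (1 - q / p) *
     (geo_const (1 - r / q) + geo_const \<tau>)"

text \<open>On each shell the finer function gk is measured in L^q and the coarser gl in the
  supremum norm. In terms of the weighted shell means Dk and Dl, the first contributes 2^(-k \<eta>)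
  and the second 2^(l \<eta>), where \<eta> = 1 - q/p; together this is the gain 2^(-\<eta>(k - l)).
  The part \<tau> of it is spent on summing over the shells near the origin.\<close>

lemma pair_integral_le:
  assumes gk: "sub_mean r w (2 powr (- real k)) gk" and gl: "sub_mean r w (2 powr (- real l)) gl"
    and lk: "l \<le> k" and c: "0 \<le> c"
    and w: "\<And>m. w m \<le> ennreal (c / (1 + \<bar>real_of_int m\<bar>) ^ 2)"
    and [measurable]: "gk \<in> borel_measurable borel" "gl \<in> borel_measurable borel"
    and r: "0 < r" "r < q" "q < p" and \<tau>: "0 < \<tau>" "\<tau> \<le> 1"
  shows "(\<integral>\<^sup>+ t. enn_powr (gk t) q * enn_powr (gl t) (p - q) \<partial>lborel) \<le>
    ennreal (pair_const c r q p \<tau> * 2 powr (- (1 - q / p - \<tau>) * (real k - real l))) *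
      (franke_weight p q gk k + franke_weight p q gl l)"
proof -
  define \<eta> where "\<eta> = 1 - q / p"
  have \<eta>: "0 < \<eta>" "\<eta> < 1" using r by (auto simp: \<eta>_def)
  define \<sigma> where "\<sigma> = 1 - r / q"
  have \<sigma>: "0 < \<sigma>" using r by (simp add: \<sigma>_def)
  define P where "P = peetre_const c r q p"
  have P: "0 \<le> P" by (simp add: P_def peetre_const_def)
  define P2 where "P2 = 2 * P powr (q / p) + 1"
  have P2: "0 \<le> P2" by (simp add: P2_def)
  define Dk where "Dk j = ennreal (2 powr (real k * (p / q - 1))) * shell_mean \<sigma> p q gk k j" for j
  define Dl where "Dl j = ennreal (2 powr (real l * (p / q - 1))) * shell_mean \<sigma> p q gl l j" for j
  define d where "d = real k - real l"
  have d: "0 \<le> d" using lk by (simp add: d_def)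
  have exk: "shell_mean \<sigma> p q gk k j = ennreal (2 powr (- real k * (p / q - 1))) * Dk j" for j
    unfolding Dk_def by (simp add: mult.assoc[symmetric] ennreal_mult[symmetric] powr_add[symmetric])
  have pq: "(p / q - 1) * (q / p) = \<eta>" using r by (simp add: \<eta>_def field_simps)
  have shell: "(\<integral>\<^sup>+ t. enn_powr (gk t) q * enn_powr (gl t) (p - q) * indicator (dyadic_shell j) t \<partial>lborel) \<le>
     ennreal (P2 * P powr \<eta> * 2 powr (- (\<eta> - \<tau>) * d)) *
      (ennreal (2 powr (\<tau> * min 0 (of_int j + real k))) * Dk j + ennreal (2 powr (\<tau> * min 0 (of_int j + real l))) * Dl j)" for j
  proof -
    have gl_le: "enn_powr (gl t) (p - q) \<le> ennreal (P powr \<eta> * 2 powr (real l * \<eta>)) * enn_powr (Dl j) \<eta>"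
      if t: "t \<in> dyadic_shell j" for t
    proof -
      have "enn_powr (gl t) (p - q) = enn_powr (enn_powr (gl t) p) \<eta>"
        using r by (simp add: enn_powr_powr \<eta>_def right_diff_distrib)
      also have "\<dots> \<le> enn_powr (ennreal (P * 2 powr (real l * (p / q))) * shell_mean \<sigma> p q gl l j) \<eta>"
        using \<eta> unfolding P_def \<sigma>_def by (intro enn_powr_mono sub_mean_shell_mean[OF gl c w _ r t]) auto
      also have "ennreal (P * 2 powr (real l * (p / q))) * shell_mean \<sigma> p q gl l j = ennreal (P * 2 powr real l) * Dl j"
        using P by (simp add: Dl_def ennreal_mult[symmetric] mult.assoc[symmetric] powr_add[symmetric] right_diff_distrib)
          (simp add: mult.assoc powr_add[symmetric])
      also have "enn_powr (ennreal (P * 2 powr real l) * Dl j) \<eta> = ennreal (P powr \<eta> * 2 powr (real l * \<eta>)) * enn_powr (Dl j) \<eta>"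
        using P by (simp add: enn_powr_mult enn_powr_ennreal powr_mult powr_powr)
      finally show ?thesis .
    qed
    have "(\<integral>\<^sup>+ t. enn_powr (gk t) q * enn_powr (gl t) (p - q) * indicator (dyadic_shell j) t \<partial>lborel) \<le>
       (\<integral>\<^sup>+ t. (ennreal (P powr \<eta> * 2 powr (real l * \<eta>)) * enn_powr (Dl j) \<eta>) * (enn_powr (gk t) q * indicator (dyadic_shell j) t) \<partial>lborel)"
      by (intro nn_integral_mono) (auto split: split_indicator simp: mult.commute[of "enn_powr (gk _) q"] intro!: mult_right_mono gl_le)
    also have "\<dots> = (ennreal (P powr \<eta> * 2 powr (real l * \<eta>)) * enn_powr (Dl j) \<eta>) * (\<integral>\<^sup>+ t. enn_powr (gk t) q * indicator (dyadic_shell j) t \<partial>lborel)"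
      by (rule nn_integral_cmult) simp
    also have "\<dots> \<le> (ennreal (P powr \<eta> * 2 powr (real l * \<eta>)) * enn_powr (Dl j) \<eta>) *
       (ennreal P2 * ennreal (2 powr (min 0 (of_int j + real k))) * enn_powr (shell_mean \<sigma> p q gk k j) (q / p))"
      unfolding P2_def P_def \<sigma>_def by (intro mult_left_mono shell_integral_le[OF gk c w _ r]) auto
    also have "enn_powr (shell_mean \<sigma> p q gk k j) (q / p) = ennreal (2 powr (- real k * \<eta>)) * enn_powr (Dk j) (q / p)"
      unfolding exk by (simp only: enn_powr_mult enn_powr_2powr mult.assoc pq)
    also have "(ennreal (P powr \<eta> * 2 powr (real l * \<eta>)) * enn_powr (Dl j) \<eta>) *
       (ennreal P2 * ennreal (2 powr (min 0 (of_int j + real k))) * (ennreal (2 powr (- real k * \<eta>)) * enn_powr (Dk j) (q / p))) =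
       ennreal (P2 * P powr \<eta> * 2 powr (- \<eta> * d)) * (ennreal (2 powr (min 0 (of_int j + real k))) * (enn_powr (Dk j) (q / p) * enn_powr (Dl j) (1 - q / p)))"
    proof -
      have "2 powr (- \<eta> * d) = 2 powr (real l * \<eta>) * 2 powr (- real k * \<eta>)"
        unfolding powr_add[symmetric] by (simp add: d_def algebra_simps)
      then have "ennreal (P2 * P powr \<eta> * 2 powr (- \<eta> * d)) = ennreal P2 * ennreal (P powr \<eta> * 2 powr (real l * \<eta>)) * ennreal (2 powr (- real k * \<eta>))"
        using P2 by (simp add: ennreal_mult mult_ac)
      then show ?thesis unfolding \<eta>_def[symmetric] by (simp only: mult_ac)
    qed
    also have "\<dots> \<le> ennreal (P2 * P powr \<eta> * 2 powr (- \<eta> * d)) * (ennreal (2 powr (min 0 (of_int j + real k))) * (Dk j + Dl j))"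
      using r by (intro mult_left_mono enn_Young') auto
    also have "ennreal (2 powr (min 0 (of_int j + real k))) * (Dk j + Dl j) \<le>
       ennreal (2 powr (\<tau> * d)) * (ennreal (2 powr (\<tau> * min 0 (of_int j + real k))) * Dk j + ennreal (2 powr (\<tau> * min 0 (of_int j + real l))) * Dl j)"
    proof -
      \<comment> \<open>Each mean gets the decay at its own scale: Dl after the shift from k to l,
        Dk without any shift.\<close>
      have 1: "min 0 (of_int j + real k) \<le> \<tau> * d + \<tau> * min 0 (of_int j + real l)"
        using min_shift_le[of \<tau> d "of_int j + real l"] \<tau> d by (simp add: d_def)
      have 2: "min 0 (of_int j + real k) \<le> \<tau> * d + \<tau> * min 0 (of_int j + real k)"
        using min_shift_le[of \<tau> 0 "of_int j + real k"] \<tau> d by (smt (verit) mult_nonneg_nonneg mult_zero_right)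
      have "ennreal (2 powr (min 0 (of_int j + real k))) * (Dk j + Dl j) =
         ennreal (2 powr (min 0 (of_int j + real k))) * Dk j + ennreal (2 powr (min 0 (of_int j + real k))) * Dl j"
        by (simp add: distrib_left)
      also have "\<dots> \<le> ennreal (2 powr (\<tau> * d + \<tau> * min 0 (of_int j + real k))) * Dk j +
          ennreal (2 powr (\<tau> * d + \<tau> * min 0 (of_int j + real l))) * Dl j"
        using 1 2 by (intro add_mono mult_right_mono ennreal_leI powr_mono) auto
      finally show ?thesis by (simp add: powr_add ennreal_mult distrib_left mult.assoc)
    qed
    finally have "(\<integral>\<^sup>+ t. enn_powr (gk t) q * enn_powr (gl t) (p - q) * indicator (dyadic_shell j) t \<partial>lborel) \<le>
      ennreal (P2 * P powr \<eta> * 2 powr (- \<eta> * d)) * (ennreal (2 powr (\<tau> * d)) *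
       (ennreal (2 powr (\<tau> * min 0 (of_int j + real k))) * Dk j + ennreal (2 powr (\<tau> * min 0 (of_int j + real l))) * Dl j))"
      by (simp add: mult_left_mono)
    also have "\<dots> = ennreal (P2 * P powr \<eta> * 2 powr (- \<eta> * d) * 2 powr (\<tau> * d)) *
       (ennreal (2 powr (\<tau> * min 0 (of_int j + real k))) * Dk j + ennreal (2 powr (\<tau> * min 0 (of_int j + real l))) * Dl j)"
      using P2 by (subst ennreal_mult) (auto simp: mult.assoc)
    also have "P2 * P powr \<eta> * 2 powr (- \<eta> * d) * 2 powr (\<tau> * d) = P2 * P powr \<eta> * 2 powr (- (\<eta> - \<tau>) * d)"
      unfolding mult.assoc powr_add[symmetric] by (simp add: algebra_simps)
    finally show ?thesis .
  qed
  have sumD: "tsum (\<lambda>j. ennreal (2 powr (\<tau> * min 0 (of_int j + real n))) * (ennreal (2 powr (real n * (p / q - 1))) * shell_mean \<sigma> p q g n j))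
     \<le> ennreal (geo_const \<sigma> + geo_const \<tau>) * franke_weight p q g n" for n g
  proof -
    have "tsum (\<lambda>j. ennreal (2 powr (\<tau> * min 0 (of_int j + real n))) * (ennreal (2 powr (real n * (p / q - 1))) * shell_mean \<sigma> p q g n j))
      = ennreal (2 powr (real n * (p / q - 1))) * tsum (\<lambda>j. ennreal (2 powr (\<tau> * min 0 (of_int j + real n))) * shell_mean \<sigma> p q g n j)"
      by (subst nn_integral_cmult[symmetric]) (auto intro!: nn_integral_cong simp: mult_ac)
    also have "\<dots> \<le> ennreal (2 powr (real n * (p / q - 1))) * (ennreal (geo_const \<sigma> + geo_const \<tau>) * tsum (\<lambda>i. enn_powr (shell_norm q g i) p))"
      by (intro mult_left_mono tsum_shell_mean \<sigma> \<tau>) auto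
    finally show ?thesis by (simp add: franke_weight_def mult_ac)
  qed
  have "(\<integral>\<^sup>+ t. enn_powr (gk t) q * enn_powr (gl t) (p - q) \<partial>lborel) =
     tsum (\<lambda>j. \<integral>\<^sup>+ t. enn_powr (gk t) q * enn_powr (gl t) (p - q) * indicator (dyadic_shell j) t \<partial>lborel)"
    by (rule nn_integral_dyadic_shells) simp
  also have "\<dots> \<le> tsum (\<lambda>j. ennreal (P2 * P powr \<eta> * 2 powr (- (\<eta> - \<tau>) * d)) *
      (ennreal (2 powr (\<tau> * min 0 (of_int j + real k))) * Dk j + ennreal (2 powr (\<tau> * min 0 (of_int j + real l))) * Dl j))"
    by (intro nn_integral_mono shell)
  also have "\<dots> = ennreal (P2 * P powr \<eta> * 2 powr (- (\<eta> - \<tau>) * d)) *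
      (tsum (\<lambda>j. ennreal (2 powr (\<tau> * min 0 (of_int j + real k))) * Dk j) + tsum (\<lambda>j. ennreal (2 powr (\<tau> * min 0 (of_int j + real l))) * Dl j))"
    by (simp add: nn_integral_cmult nn_integral_add)
  also have "\<dots> \<le> ennreal (P2 * P powr \<eta> * 2 powr (- (\<eta> - \<tau>) * d)) *
      (ennreal (geo_const \<sigma> + geo_const \<tau>) * franke_weight p q gk k + ennreal (geo_const \<sigma> + geo_const \<tau>) * franke_weight p q gl l)"
    unfolding Dk_def Dl_def by (intro mult_left_mono add_mono sumD) auto
  also have "\<dots> = ennreal (P2 * P powr \<eta> * 2 powr (- (\<eta> - \<tau>) * d)) * ennreal (geo_const \<sigma> + geo_const \<tau>) *
     (franke_weight p q gk k + franke_weight p q gl l)"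
    by (simp only: distrib_left mult.assoc)
  also have "ennreal (P2 * P powr \<eta> * 2 powr (- (\<eta> - \<tau>) * d)) * ennreal (geo_const \<sigma> + geo_const \<tau>) =
     ennreal (pair_const c r q p \<tau> * 2 powr (- (1 - q / p - \<tau>) * (real k - real l)))"
    using P2 geo_const_nonneg \<sigma> \<tau>
    by (subst ennreal_mult[symmetric])
      (auto simp: pair_const_def P2_def P_def \<eta>_def \<sigma>_def d_def mult_ac intro!: add_nonneg_nonneg)
  finally show ?thesis .
qed

text \<open>The gain \<eta> = 1 - q/p of a pair is divided: \<eta>/4 is the growth \<epsilon>
  allowed in \<open>tsum_powr_le_pairs\<close>, \<eta>/4 is \<tau> in
  \<open>pair_integral_le\<close>, and the remaining \<eta>/2 sums the pairs. The p-th root undoes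
  the p-th powers in which the estimate is proved.\<close>

definition franke_const :: "real \<Rightarrow> real \<Rightarrow> real \<Rightarrow> real \<Rightarrow> real" where
  "franke_const c r q p = ((2 powr r * geo_const ((1 - q / p) / 4 * r / p)) powr (p / r) *
     pair_const c r q p ((1 - q / p) / 4) * (2 * geo_const ((1 - q / p) / 2))) powr (1 / p)"

lemma franke_powr:
  fixes g :: "nat \<Rightarrow> real \<Rightarrow> ennreal"
  assumes g: "\<And>k. sub_mean r w (2 powr (- real k)) (g k)" and c: "0 \<le> c"
    and w: "\<And>m. w m \<le> ennreal (c / (1 + \<bar>real_of_int m\<bar>) ^ 2)"
    and gm [measurable]: "\<And>k. g k \<in> borel_measurable borel"
    and r: "0 < r" "r < q" "q < p"
  shows "(\<integral>\<^sup>+ t. enn_powr (tsum (\<lambda>k. enn_powr (g k t) r)) (p / r) \<partial>lborel) \<le>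
    ennreal (franke_const c r q p powr p) * tsum (\<lambda>k. franke_weight p q (g k) k)"
proof -
  define \<eta> where "\<eta> = 1 - q / p"
  have \<eta>: "0 < \<eta>" "\<eta> < 1" using r by (auto simp: \<eta>_def)
  define A where "A = (2 powr r * geo_const (\<eta> / 4 * r / p)) powr (p / r)"
  define B where "B = pair_const c r q p (\<eta> / 4)"
  have B: "0 \<le> B" using r \<eta> geo_const_nonneg
    by (auto simp: B_def pair_const_def intro!: mult_nonneg_nonneg add_nonneg_nonneg)
  define b where "b k = franke_weight p q (g k) k" for k
  define f where "f k l = (if l \<le> k then ennreal (2 powr (\<eta> / 4 * (real k - real l))) else 0)" for k l :: nat
  have "(\<integral>\<^sup>+ t. enn_powr (tsum (\<lambda>k. enn_powr (g k t) r)) (p / r) \<partial>lborel) \<le>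
    (\<integral>\<^sup>+ t. ennreal A * tsum (\<lambda>k. tsum (\<lambda>l. f k l * (enn_powr (g k t) q * enn_powr (g l t) (p - q)))) \<partial>lborel)"
  proof (rule nn_integral_mono)
    fix t
    have "tsum (\<lambda>k. tsum (\<lambda>l. f k l * (enn_powr (g k t) q * enn_powr (g l t) (p - q)))) =
      tsum (\<lambda>k. tsum (\<lambda>l. if l \<le> k then ennreal (2 powr (\<eta> / 4 * (real k - real l))) *
      (enn_powr (g k t) q * enn_powr (g l t) (p - q)) else 0))"
      unfolding f_def by (intro nn_integral_cong) simp
    then show "enn_powr (tsum (\<lambda>k. enn_powr (g k t) r)) (p / r) \<le>
      ennreal A * tsum (\<lambda>k. tsum (\<lambda>l. f k l * (enn_powr (g k t) q * enn_powr (g l t) (p - q))))"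
      unfolding A_def using r \<eta> tsum_powr_le_pairs[of r "\<eta> / 4" q p "\<lambda>k. g k t"] by simp
  qed
  also have "\<dots> = ennreal A * tsum (\<lambda>k. tsum (\<lambda>l. f k l * (\<integral>\<^sup>+ t. enn_powr (g k t) q * enn_powr (g l t) (p - q) \<partial>lborel)))"
  proof -
    have "(\<integral>\<^sup>+ t. tsum (\<lambda>k. tsum (\<lambda>l. f k l * (enn_powr (g k t) q * enn_powr (g l t) (p - q)))) \<partial>lborel) =
      tsum (\<lambda>k. \<integral>\<^sup>+ t. tsum (\<lambda>l. f k l * (enn_powr (g k t) q * enn_powr (g l t) (p - q))) \<partial>lborel)"
      by (rule tsum_nn_integral) simp
    also have "\<dots> = tsum (\<lambda>k. tsum (\<lambda>l. \<integral>\<^sup>+ t. f k l * (enn_powr (g k t) q * enn_powr (g l t) (p - q)) \<partial>lborel))"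
      by (intro nn_integral_cong tsum_nn_integral) simp
    also have "\<dots> = tsum (\<lambda>k. tsum (\<lambda>l. f k l * (\<integral>\<^sup>+ t. enn_powr (g k t) q * enn_powr (g l t) (p - q) \<partial>lborel)))"
      by (intro nn_integral_cong nn_integral_cmult) simp
    finally show ?thesis by (subst nn_integral_cmult) simp_all
  qed
  also have "\<dots> \<le> ennreal A * tsum (\<lambda>k. tsum (\<lambda>l. ennreal B * (ennreal (2 powr (- (\<eta> / 2) * \<bar>real l - real k\<bar>)) * (b k + b l))))"
  proof (intro mult_left_mono nn_integral_mono)
    fix k l :: nat
    show "f k l * (\<integral>\<^sup>+ t. enn_powr (g k t) q * enn_powr (g l t) (p - q) \<partial>lborel) \<le>
      ennreal B * (ennreal (2 powr (- (\<eta> / 2) * \<bar>real l - real k\<bar>)) * (b k + b l))"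
    proof (cases "l \<le> k")
      case True
      have "f k l * (\<integral>\<^sup>+ t. enn_powr (g k t) q * enn_powr (g l t) (p - q) \<partial>lborel) \<le>
        f k l * (ennreal (B * 2 powr (- (\<eta> - \<eta> / 4) * (real k - real l))) * (b k + b l))"
        unfolding B_def b_def \<eta>_def using \<eta> unfolding \<eta>_def
        by (intro mult_left_mono pair_integral_le[OF g g True c w gm gm r]) auto
      also have "\<dots> = ennreal B * (ennreal (2 powr (\<eta> / 4 * (real k - real l)) * 2 powr (- (\<eta> - \<eta> / 4) * (real k - real l))) * (b k + b l))"
        using True B by (simp add: f_def ennreal_mult mult_ac)
      also have "2 powr (\<eta> / 4 * (real k - real l)) * 2 powr (- (\<eta> - \<eta> / 4) * (real k - real l)) =
         2 powr (- (\<eta> / 2) * \<bar>real l - real k\<bar>)"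
        unfolding powr_add[symmetric] using True
        by (intro arg_cong[where f = "\<lambda>x. 2 powr x"]) (simp add: field_simps)
      finally show ?thesis .
    qed (simp add: f_def)
  qed simp
  also have "tsum (\<lambda>k. tsum (\<lambda>l. ennreal B * (ennreal (2 powr (- (\<eta> / 2) * \<bar>real l - real k\<bar>)) * (b k + b l)))) \<le>
     ennreal B * (ennreal (2 * geo_const (\<eta> / 2)) * tsum b)"
  proof -
    \<comment> \<open>Schur's test: the kernel is symmetric with bounded row sums, and each pair is
      charged to both of its indices.\<close>
    define h where "h k l = ennreal (2 powr (- (\<eta> / 2) * \<bar>real l - real k\<bar>))" for k l
    have "tsum (\<lambda>k. tsum (\<lambda>l. ennreal B * (h k l * (b k + b l)))) =
       ennreal B * (tsum (\<lambda>k. tsum (\<lambda>l. h k l * b k)) + tsum (\<lambda>k. tsum (\<lambda>l. h k l * b l)))"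
      by (simp add: nn_integral_cmult nn_integral_add distrib_left)
    also have "tsum (\<lambda>k. tsum (\<lambda>l. h k l * b l)) = tsum (\<lambda>l. tsum (\<lambda>k. h k l * b l))"
      by (rule tsum_nn_integral) simp
    also have "tsum (\<lambda>k. tsum (\<lambda>l. h k l * b k)) + tsum (\<lambda>l. tsum (\<lambda>k. h k l * b l)) =
      tsum (\<lambda>k. tsum (\<lambda>l. h k l) * b k) + tsum (\<lambda>l. tsum (\<lambda>k. h k l) * b l)"
      by (simp add: nn_integral_multc)
    also have "\<dots> \<le> tsum (\<lambda>k. ennreal (geo_const (\<eta> / 2)) * b k) + tsum (\<lambda>k. ennreal (geo_const (\<eta> / 2)) * b k)"
    proof -
      have 1: "tsum (\<lambda>l. h k l) \<le> ennreal (geo_const (\<eta> / 2))" for k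
        unfolding h_def using \<eta> by (intro tsum_geometric_nat) simp
      have "h k l = h l k" for k l by (simp add: h_def abs_minus_commute)
      then have 2: "tsum (\<lambda>k. h k l) \<le> ennreal (geo_const (\<eta> / 2))" for l
        using 1[of l] by simp
      show ?thesis by (intro add_mono nn_integral_mono mult_right_mono 1 2) auto
    qed
    also have "\<dots> = ennreal (2 * geo_const (\<eta> / 2)) * tsum b"
      using geo_const_nonneg[of "\<eta> / 2"] \<eta>
      by (simp add: nn_integral_cmult distrib_right[symmetric] ennreal_plus[symmetric] del: ennreal_plus)
    finally show ?thesis unfolding h_def by (simp add: mult_left_mono)
  qed
  finally have "(\<integral>\<^sup>+ t. enn_powr (tsum (\<lambda>k. enn_powr (g k t) r)) (p / r) \<partial>lborel) \<le>
    ennreal A * (ennreal B * (ennreal (2 * geo_const (\<eta> / 2)) * tsum b))"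
    by (simp add: mult_left_mono)
  also have "\<dots> = ennreal (A * B * (2 * geo_const (\<eta> / 2))) * tsum b"
    using B geo_const_nonneg[of "\<eta> / 2"] \<eta> by (simp add: A_def ennreal_mult mult.assoc)
  also have "A * B * (2 * geo_const (\<eta> / 2)) = franke_const c r q p powr p"
    using r B geo_const_nonneg[of "\<eta> / 2"] \<eta>
    by (simp add: franke_const_def A_def B_def \<eta>_def powr_powr)
  finally show ?thesis unfolding b_def .
qed

text \<open>The functions need no relation to each other beyond being sub-mean at their own scales.
  This makes the inequality applicable to a sequence obtained by taking norms in other
  coordinates.\<close>

lemma franke_jawerth_herz:
  fixes g :: "nat \<Rightarrow> real \<Rightarrow> ennreal"
  assumes g: "\<And>k. sub_mean r w (2 powr (- real k)) (g k)" and c: "0 \<le> c"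
    and w: "\<And>m. w m \<le> ennreal (c / (1 + \<bar>real_of_int m\<bar>) ^ 2)"
    and gm [measurable]: "\<And>k. g k \<in> borel_measurable borel"
    and r: "0 < r" "r < q" "q < p"
  shows "Lp_norm (ennreal p) (\<lambda>t. lq_norm (ennreal r) (\<lambda>k. g k t)) \<le>
    ennreal (franke_const c r q p) * lq_norm (ennreal p)
      (\<lambda>k. ennreal (2 powr (real k * (1 / q - 1 / p))) * herz_norm (ennreal q) 0 (ennreal p) (g k))"
proof -
  have "franke_weight p q (g k) k =
     enn_powr (ennreal (2 powr (real k * (1 / q - 1 / p))) * herz_norm (ennreal q) 0 (ennreal p) (g k)) p" for k
  proof -
    have "herz_norm (ennreal q) 0 (ennreal p) (g k) = enn_powr (tsum (\<lambda>i. enn_powr (shell_norm q (g k) i) p)) (1 / p)"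
      using r by (simp add: herz_norm_def lq_norm_ennreal shell_norm_def)
    then show ?thesis
      using r by (simp add: franke_weight_def enn_powr_mult mult.assoc left_diff_distrib)
  qed
  then have "(\<integral>\<^sup>+ t. enn_powr (tsum (\<lambda>k. enn_powr (g k t) r)) (p / r) \<partial>lborel) \<le>
    ennreal (franke_const c r q p powr p) *
    tsum (\<lambda>k. enn_powr (ennreal (2 powr (real k * (1 / q - 1 / p))) * herz_norm (ennreal q) 0 (ennreal p) (g k)) p)"
    using franke_powr[OF g c w gm r] by simp
  then have "enn_powr (\<integral>\<^sup>+ t. enn_powr (tsum (\<lambda>k. enn_powr (g k t) r)) (p / r) \<partial>lborel) (1 / p) \<le>
    enn_powr (ennreal (franke_const c r q p powr p) *
    tsum (\<lambda>k. enn_powr (ennreal (2 powr (real k * (1 / q - 1 / p))) * herz_norm (ennreal q) 0 (ennreal p) (g k)) p)) (1 / p)"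
    using r by (intro enn_powr_mono) auto
  moreover have "enn_powr (ennreal (franke_const c r q p powr p)) (1 / p) = ennreal (franke_const c r q p)"
    using r by (simp add: enn_powr_ennreal powr_powr) (simp add: franke_const_def)
  ultimately show ?thesis
    using r by (simp add: Lp_norm_ennreal lq_norm_ennreal enn_powr_powr enn_powr_mult)
qed

subsection \<open>Mixed norms\<close>

lemma Lp_norm_mono:
  assumes "0 < p" "\<And>t. g t \<le> h t"
  shows "Lp_norm (ennreal p) g \<le> Lp_norm (ennreal p) h"
  using assms by (auto simp: Lp_norm_ennreal intro!: enn_powr_mono nn_integral_mono)

lemma lq_norm_mono:
  assumes "0 < p" "\<And>k. a k \<le> b k"
  shows "lq_norm (ennreal p) a \<le> lq_norm (ennreal p) b"
  using assms by (auto simp: lq_norm_ennreal intro!: enn_powr_mono nn_integral_mono)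

lemma Lp_norm_cmult:
  assumes "0 < p" and [measurable]: "g \<in> borel_measurable borel"
  shows "Lp_norm (ennreal p) (\<lambda>t. c * g t) = c * Lp_norm (ennreal p) g"
  using assms by (simp add: Lp_norm_ennreal enn_powr_mult nn_integral_cmult)

lemma lq_norm_cmult: "0 < p \<Longrightarrow> lq_norm (ennreal p) (\<lambda>k. c * a k) = c * lq_norm (ennreal p) a"
  by (simp add: lq_norm_ennreal enn_powr_mult nn_integral_cmult)

lemma Lp_norm_sub:
  fixes h :: "'k::countable \<Rightarrow> real \<Rightarrow> ennreal"
  assumes "0 < r" "r < p" "\<And>k. h k \<in> borel_measurable borel"
    and "\<And>t. enn_powr (g t) r \<le> tsum (\<lambda>k. w k * enn_powr (h k t) r)"
  shows "enn_powr (Lp_norm (ennreal p) g) r \<le> tsum (\<lambda>k. w k * enn_powr (Lp_norm (ennreal p) (h k)) r)"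
  using enn_powr_norm_sub[of r p h lborel g w] assms by (simp add: Lp_norm_ennreal)

lemma lq_norm_sub:
  fixes h :: "'k::countable \<Rightarrow> 'j \<Rightarrow> ennreal"
  assumes "0 < r" "r < p"
    and "\<And>t. enn_powr (g t) r \<le> tsum (\<lambda>k. w k * enn_powr (h k t) r)"
  shows "enn_powr (lq_norm (ennreal p) g) r \<le> tsum (\<lambda>k. w k * enn_powr (lq_norm (ennreal p) (h k)) r)"
  using enn_powr_norm_sub[of r p h "count_space UNIV" g w] assms by (simp add: lq_norm_ennreal)

lemma herz_norm_0: "herz_norm p 0 q g = lq_norm q (\<lambda>k. Lp_norm p (\<lambda>t. g t * indicator (dyadic_shell k) t))"
  by (simp add: herz_norm_def)

lemma herz_norm_mono:
  assumes "0 < q" "0 < p" "\<And>t. g t \<le> h t"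
  shows "herz_norm (ennreal q) 0 (ennreal p) g \<le> herz_norm (ennreal q) 0 (ennreal p) h"
  unfolding herz_norm_0 using assms by (intro lq_norm_mono Lp_norm_mono mult_right_mono) auto

lemma herz_norm_cmult:
  assumes "0 < q" "0 < p" and [measurable]: "g \<in> borel_measurable borel"
  shows "herz_norm (ennreal q) 0 (ennreal p) (\<lambda>t. c * g t) = c * herz_norm (ennreal q) 0 (ennreal p) g"
proof -
  have "Lp_norm (ennreal q) (\<lambda>t. c * g t * indicator (dyadic_shell k) t) =
     c * Lp_norm (ennreal q) (\<lambda>t. g t * indicator (dyadic_shell k) t)" for k
    unfolding mult.assoc using assms by (intro Lp_norm_cmult) auto
  then show ?thesis unfolding herz_norm_0 using assms by (simp add: lq_norm_cmult)
qed

text \<open>\<open>Lp_norm_sub\<close> is used on each shell and \<open>lq_norm_sub\<close> over the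
  shells; cutting off to a shell commutes with powers and sums.\<close>

lemma herz_norm_sub:
  fixes h :: "'k::countable \<Rightarrow> real \<Rightarrow> ennreal"
  assumes "0 < r" "r < q" "r < p" and [measurable]: "\<And>k. h k \<in> borel_measurable borel"
    and le: "\<And>t. enn_powr (g t) r \<le> tsum (\<lambda>k. w k * enn_powr (h k t) r)"
  shows "enn_powr (herz_norm (ennreal q) 0 (ennreal p) g) r \<le>
    tsum (\<lambda>k. w k * enn_powr (herz_norm (ennreal q) 0 (ennreal p) (h k)) r)"
  unfolding herz_norm_0
proof (intro lq_norm_sub Lp_norm_sub)
  fix i t
  have "enn_powr (g t * indicator (dyadic_shell i) t) r \<le>
      tsum (\<lambda>k. w k * enn_powr (h k t) r) * indicator (dyadic_shell i) t"
    unfolding enn_powr_mult_indicator by (intro mult_right_mono le) simp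
  also have "\<dots> = tsum (\<lambda>k. w k * enn_powr (h k t * indicator (dyadic_shell i) t) r)"
    by (simp add: enn_powr_mult_indicator mult.assoc[symmetric] nn_integral_multc)
  finally show "enn_powr (g t * indicator (dyadic_shell i) t) r \<le>
    tsum (\<lambda>k. w k * enn_powr (h k t * indicator (dyadic_shell i) t) r)" .
qed (use assms in auto)

text \<open>The shells partition the line up to a null set, so the l^q sum of the shell norms is
  exactly the L^q norm, and \<open>tsum_powr_le\<close> passes from l^q to l^p.\<close>

lemma herz_norm_le_Lp_norm:
  assumes "0 < q" "q < p" and [measurable]: "g \<in> borel_measurable borel"
  shows "herz_norm (ennreal q) 0 (ennreal p) g \<le> Lp_norm (ennreal q) g"
proof -
  have "tsum (\<lambda>k. enn_powr (shell_norm q g k) p) \<le> enn_powr (tsum (\<lambda>k. enn_powr (shell_norm q g k) q)) (p / q)"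
    using assms by (intro tsum_powr_le) auto
  also have "tsum (\<lambda>k. enn_powr (shell_norm q g k) q) = (\<integral>\<^sup>+ t. enn_powr (g t) q \<partial>lborel)"
    using assms by (simp add: shell_norm_powr nn_integral_dyadic_shells[of "\<lambda>t. enn_powr (g t) q"])
  finally have "enn_powr (tsum (\<lambda>k. enn_powr (shell_norm q g k) p)) (1 / p) \<le>
      enn_powr (enn_powr (\<integral>\<^sup>+ t. enn_powr (g t) q \<partial>lborel) (p / q)) (1 / p)"
    using assms by (intro enn_powr_mono) auto
  then show ?thesis
    using assms by (simp add: herz_norm_0 lq_norm_ennreal Lp_norm_ennreal[of q g] enn_powr_powr flip: shell_norm_def)
qed

lemma lq_norm_single:
  assumes "0 < p"
  shows "lq_norm (ennreal p) (\<lambda>j. if j = k then a else 0) = a"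
proof -
  have "enn_powr (if j = k then a else 0) p = enn_powr a p * indicator {k} j" for j by simp
  then have "tsum (\<lambda>j. enn_powr (if j = k then a else 0) p) = tsum (\<lambda>j. enn_powr a p * indicator {k} j)"
    by (simp only:)
  then show ?thesis using assms by (simp add: lq_norm_ennreal)
qed

text \<open>The sequence inequality is applied to the sequence whose only nonzero member is g, at
  index k; the inner l^r and the outer l^p norm then both collapse.\<close>

lemma Lp_norm_le_herz_norm:
  assumes g: "sub_mean r w (2 powr (- real k)) g" and c: "0 \<le> c"
    and w: "\<And>m. w m \<le> ennreal (c / (1 + \<bar>real_of_int m\<bar>) ^ 2)"
    and gm [measurable]: "g \<in> borel_measurable borel"
    and r: "0 < r" "r < q" "q < p"
  shows "Lp_norm (ennreal p) g \<le>
    ennreal (franke_const c r q p) * (ennreal (2 powr (real k * (1 / q - 1 / p))) * herz_norm (ennreal q) 0 (ennreal p) g)"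
proof -
  define h where "h j = (if j = k then g else (\<lambda>t. 0))" for j
  have z: "herz_norm (ennreal q) 0 (ennreal p) (\<lambda>t. 0) = 0"
    using herz_norm_cmult[of q p "\<lambda>t. 0" 0] r by simp
  have "Lp_norm (ennreal p) (\<lambda>t. lq_norm (ennreal r) (\<lambda>j. h j t)) \<le>
    ennreal (franke_const c r q p) * lq_norm (ennreal p)
      (\<lambda>j. ennreal (2 powr (real j * (1 / q - 1 / p))) * herz_norm (ennreal q) 0 (ennreal p) (h j))"
    using g by (intro franke_jawerth_herz[OF _ c w _ r]) (auto simp: h_def sub_mean_def)
  also have "(\<lambda>t. lq_norm (ennreal r) (\<lambda>j. h j t)) = g"
  proof
    fix t
    have "(\<lambda>j. h j t) = (\<lambda>j. if j = k then g t else 0)" by (auto simp: h_def)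
    then show "lq_norm (ennreal r) (\<lambda>j. h j t) = g t" using lq_norm_single[OF r(1)] by metis
  qed
  also have "(\<lambda>j. ennreal (2 powr (real j * (1 / q - 1 / p))) * herz_norm (ennreal q) 0 (ennreal p) (h j)) =
     (\<lambda>j. if j = k then ennreal (2 powr (real k * (1 / q - 1 / p))) * herz_norm (ennreal q) 0 (ennreal p) g else 0)"
    by (auto simp: h_def z)
  finally show ?thesis using r by (subst (asm) lq_norm_single) simp_all
qed

section \<open>Slices in one coordinate\<close>

definition upd :: "(real, 'n::finite) vec \<Rightarrow> 'n \<Rightarrow> real \<Rightarrow> (real, 'n) vec" where
  "upd x i t = (\<chi> j. if j = i then t else x $ j)"

lemma coord_norm_upd: "coord_norm N i g x = N i (\<lambda>t. g (upd x i t))"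
  by (simp add: coord_norm_def upd_def)

lemma upd_commute: "i \<noteq> j \<Longrightarrow> upd (upd x i t) j u = upd (upd x j u) i t"
  by (auto simp: upd_def vec_eq_iff)

lemma upd_add: "upd x i (t + u) = upd x i t + u *\<^sub>R axis i 1"
  by (auto simp: upd_def vec_eq_iff axis_def)

text \<open>Joint measurability in the vector and the new coordinate, without which
  \<open>coord_norm\<close> could not be iterated.\<close>

lemma measurable_upd [measurable (raw)]:
  fixes f :: "'a \<Rightarrow> (real, 'n::finite) vec"
  assumes [measurable]: "f \<in> borel_measurable M" "g \<in> borel_measurable M"
  shows "(\<lambda>x. upd (f x) i (g x)) \<in> borel_measurable M"
proof -
  have "continuous_on UNIV (\<lambda>p::(real, 'n) vec \<times> real. upd (fst p) i (snd p))"
    unfolding upd_def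
  proof (rule continuous_on_vec_lambda)
    show "continuous_on UNIV (\<lambda>p::(real, 'n) vec \<times> real. if j = i then snd p else fst p $ j)" for j
      by (cases "j = i") (auto intro!: continuous_intros)
  qed
  then have "(\<lambda>p::(real, 'n) vec \<times> real. upd (fst p) i (snd p)) \<in> borel_measurable (borel \<Otimes>\<^sub>M borel)"
    unfolding borel_prod by (rule borel_measurable_continuous_onI)
  from measurable_compose[OF _ this, of "\<lambda>x. (f x, g x)" M] show ?thesis by simp
qed

definition slice_sub_mean ::
    "real \<Rightarrow> (int \<Rightarrow> ennreal) \<Rightarrow> real \<Rightarrow> 'n::finite \<Rightarrow> ((real, 'n) vec \<Rightarrow> ennreal) \<Rightarrow> bool" where
  "slice_sub_mean r w \<delta> i H \<longleftrightarrow> (\<forall>x. sub_mean r w \<delta> (\<lambda>t. H (upd x i t)))"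

lemma sub_mean_cmult:
  assumes "sub_mean r w \<delta> g"
  shows "sub_mean r w \<delta> (\<lambda>t. c * g t)"
  unfolding sub_mean_def
proof (intro allI ballI)
  fix t s :: real assume "s \<in> {0..<1}"
  then have "enn_powr (g t) r \<le> tsum (\<lambda>m. w m * enn_powr (g (t + \<delta> * (s + of_int m))) r)"
    using assms by (auto simp: sub_mean_def)
  then have "enn_powr c r * enn_powr (g t) r \<le> enn_powr c r * tsum (\<lambda>m. w m * enn_powr (g (t + \<delta> * (s + of_int m))) r)"
    by (intro mult_left_mono) auto
  then show "enn_powr (c * g t) r \<le> tsum (\<lambda>m. w m * enn_powr (c * g (t + \<delta> * (s + of_int m))) r)"
    by (subst (asm) nn_integral_cmult[symmetric]) (simp_all add: enn_powr_mult mult_ac)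
qed

lemma measurable_coord_Lp_norm [measurable]:
  assumes "0 < p i" and [measurable]: "H \<in> borel_measurable borel"
  shows "coord_norm (\<lambda>i. Lp_norm (ennreal (p i))) i H \<in> borel_measurable borel"
  unfolding coord_norm_upd[abs_def] using assms(1) by (simp add: Lp_norm_ennreal)

lemma measurable_coord_herz_norm [measurable]:
  assumes "0 < q i" "0 < p i" and [measurable]: "H \<in> borel_measurable borel"
  shows "coord_norm (\<lambda>i. herz_norm (ennreal (q i)) 0 (ennreal (p i))) i H \<in> borel_measurable borel"
  unfolding coord_norm_upd[abs_def] herz_norm_0 using assms(1,2) by (simp add: Lp_norm_ennreal lq_norm_ennreal)

text \<open>The weights are the same on every line, so \<open>herz_norm_sub\<close> applies to the
  translates in direction j, each seen as a function of coordinate i. Substitutions in different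
  coordinates commute.\<close>

lemma slice_sub_mean_coord_herz_norm:
  assumes r: "0 < r" "r < q i" "r < p i" and [measurable]: "H \<in> borel_measurable borel"
    and ij: "i \<noteq> j" and H: "slice_sub_mean r w \<delta> j H"
  shows "slice_sub_mean r w \<delta> j (coord_norm (\<lambda>i. herz_norm (ennreal (q i)) 0 (ennreal (p i))) i H)"
  unfolding slice_sub_mean_def sub_mean_def coord_norm_upd
proof (intro allI ballI herz_norm_sub)
  fix x and t s u :: real assume "s \<in> {0..<1}"
  then show "enn_powr (H (upd (upd x j t) i u)) r \<le>
    tsum (\<lambda>m. w m * enn_powr (H (upd (upd x j (t + \<delta> * (s + of_int m))) i u)) r)"
    using H ij by (auto simp: slice_sub_mean_def sub_mean_def upd_commute[of j i])
qed (use assms in auto)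

lemma fold_coord_norm_mono:
  assumes "\<And>i g h. (\<And>t. g t \<le> h t) \<Longrightarrow> N i g \<le> N i h" and "\<And>x. g x \<le> h x"
  shows "fold (coord_norm N) l g y \<le> fold (coord_norm N) l h y"
  using assms(2)
proof (induction l arbitrary: g h)
  case (Cons i l)
  then show ?case by (simp add: coord_norm_upd assms(1))
qed simp

section \<open>Iterated norms along a list of coordinates\<close>

context
  fixes p q :: "'n::{finite,linorder} \<Rightarrow> real" and r c :: real and w :: "int \<Rightarrow> ennreal"
  assumes r: "0 < r" "\<And>i. r < q i" "\<And>i. q i < p i" and c: "0 \<le> c"
    and w: "\<And>m. w m \<le> ennreal (c / (1 + \<bar>real_of_int m\<bar>) ^ 2)"
begin

lemma exponents_pos: "0 < q i" "0 < p i" "r < p i"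
  using r(1) r(2)[of i] r(3)[of i] by linarith+

abbreviation "foldL \<equiv> fold (coord_norm (\<lambda>i. Lp_norm (ennreal (p i))))"
abbreviation "foldH \<equiv> fold (coord_norm (\<lambda>i. herz_norm (ennreal (q i)) 0 (ennreal (p i))))"

lemma foldL_mono: "(\<And>x. g x \<le> h x) \<Longrightarrow> foldL l g y \<le> foldL l h y"
  by (rule fold_coord_norm_mono) (auto intro!: Lp_norm_mono exponents_pos)

lemma measurable_foldH:
  "H \<in> borel_measurable borel \<Longrightarrow> foldH l H \<in> borel_measurable borel"
proof (induction l arbitrary: H)
  case (Cons i l)
  then show ?case using measurable_coord_herz_norm[of q i p H] exponents_pos by simp
qed simp

lemma foldL_cmult:
  "H \<in> borel_measurable borel \<Longrightarrow> foldL l (\<lambda>x. a * H x) y = a * foldL l H y"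
proof (induction l arbitrary: H)
  case (Cons i l)
  note [measurable] = Cons.prems
  have "coord_norm (\<lambda>i. Lp_norm (ennreal (p i))) i (\<lambda>x. a * H x) =
     (\<lambda>x. a * coord_norm (\<lambda>i. Lp_norm (ennreal (p i))) i H x)"
    unfolding coord_norm_upd[abs_def] by (intro ext Lp_norm_cmult exponents_pos) simp
  then show ?case using Cons.IH[OF measurable_coord_Lp_norm[OF exponents_pos(2) Cons.prems]] by simp
qed simp

lemma foldH_sub_mean:
  assumes "H \<in> borel_measurable borel" "j \<notin> set l" "slice_sub_mean r w \<delta> j H"
  shows "slice_sub_mean r w \<delta> j (foldH l H)"
  using assms
proof (induction l arbitrary: H)
  case (Cons i l)
  have "slice_sub_mean r w \<delta> j (coord_norm (\<lambda>i. herz_norm (ennreal (q i)) 0 (ennreal (p i))) i H)"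
    using Cons.prems r exponents_pos by (intro slice_sub_mean_coord_herz_norm) auto
  then show ?case
    using Cons.IH[OF measurable_coord_herz_norm[OF exponents_pos(1,2) Cons.prems(1)]] Cons.prems by simp
qed simp

text \<open>Each step is Minkowski's inequality in L^(p_i/r) with all weights equal to 1; here r has
  to lie below every p_i.\<close>

lemma foldL_lq_norm_le:
  fixes H :: "nat \<Rightarrow> (real, 'n) vec \<Rightarrow> ennreal"
  assumes "\<And>k. H k \<in> borel_measurable borel"
  shows "foldL l (\<lambda>x. lq_norm (ennreal r) (\<lambda>k. H k x)) y \<le> lq_norm (ennreal r) (\<lambda>k. foldL l (H k) y)"
  using assms
proof (induction l arbitrary: H)
  case (Cons i l)
  note [measurable] = Cons.prems
  let ?G = "\<lambda>k. coord_norm (\<lambda>i. Lp_norm (ennreal (p i))) i (H k)"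
  have "coord_norm (\<lambda>i. Lp_norm (ennreal (p i))) i (\<lambda>x. lq_norm (ennreal r) (\<lambda>k. H k x)) x \<le>
     lq_norm (ennreal r) (\<lambda>k. ?G k x)" for x
  proof -
    have "enn_powr (Lp_norm (ennreal (p i)) (\<lambda>t. lq_norm (ennreal r) (\<lambda>k. H k (upd x i t)))) r \<le>
      tsum (\<lambda>k. 1 * enn_powr (Lp_norm (ennreal (p i)) (\<lambda>t. H k (upd x i t))) r)"
      using r exponents_pos by (intro Lp_norm_sub) (auto simp: lq_norm_ennreal)
    then show ?thesis using r by (simp add: coord_norm_upd lq_norm_ennreal[of r] enn_powr_le_iff)
  qed
  then have "foldL l (coord_norm (\<lambda>i. Lp_norm (ennreal (p i))) i (\<lambda>x. lq_norm (ennreal r) (\<lambda>k. H k x))) y \<le>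
     foldL l (\<lambda>x. lq_norm (ennreal r) (\<lambda>k. ?G k x)) y"
    by (rule foldL_mono)
  also have "\<dots> \<le> lq_norm (ennreal r) (\<lambda>k. foldL l (?G k) y)"
    using exponents_pos by (intro Cons.IH measurable_coord_Lp_norm) auto
  finally show ?case by simp
qed simp

text \<open>The coordinates are converted one at a time, innermost first. After coordinate i is
  measured by a Herz norm, the result is still sub-mean in the coordinates that follow, because
  these differ from i.\<close>

lemma foldL_le_foldH:
  assumes "H \<in> borel_measurable borel" "distinct l"
    "\<And>i. i \<in> set l \<Longrightarrow> slice_sub_mean r w (2 powr (- real k)) i H"
  shows "foldL l H y \<le> ennreal (prod_list (map (\<lambda>i. franke_const c r (q i) (p i)) l) *
     2 powr (real k * sum_list (map (\<lambda>i. 1 / q i - 1 / p i) l))) * foldH l H y"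
  using assms
proof (induction l arbitrary: H)
  case Nil
  then show ?case by simp
next
  case (Cons i l)
  note [measurable] = Cons.prems(1)
  let ?G = "coord_norm (\<lambda>i. herz_norm (ennreal (q i)) 0 (ennreal (p i))) i H"
  have fc: "0 \<le> franke_const c r a b" for a b by (simp add: franke_const_def)
  have fcp: "0 \<le> prod_list (map (\<lambda>i. franke_const c r (q i) (p i)) l)" for l
    by (induction l) (auto simp: fc)
  define a where "a = ennreal (franke_const c r (q i) (p i) * 2 powr (real k * (1 / q i - 1 / p i)))"
  have le: "coord_norm (\<lambda>i. Lp_norm (ennreal (p i))) i H x \<le> a * ?G x" for x
  proof -
    have "sub_mean r w (2 powr (- real k)) (\<lambda>t. H (upd x i t))"
      using Cons.prems(3)[of i] by (auto simp: slice_sub_mean_def)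
    then show ?thesis
      using Lp_norm_le_herz_norm[OF _ c w _ r(1,2,3), of k "\<lambda>t. H (upd x i t)" i] fc
      by (simp add: a_def coord_norm_upd ennreal_mult mult.assoc)
  qed
  have Gm: "?G \<in> borel_measurable borel" using exponents_pos by measurable
  have "foldL (i # l) H y \<le> foldL l (\<lambda>x. a * ?G x) y"
    by (simp add: foldL_mono le)
  also have "\<dots> = a * foldL l ?G y" by (rule foldL_cmult[OF Gm])
  also have "\<dots> \<le> a * (ennreal (prod_list (map (\<lambda>i. franke_const c r (q i) (p i)) l) *
     2 powr (real k * sum_list (map (\<lambda>i. 1 / q i - 1 / p i) l))) * foldH l ?G y)"
  proof (intro mult_left_mono Cons.IH Gm)
    show "slice_sub_mean r w (2 powr - real k) j ?G" if "j \<in> set l" for j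
      using that Cons.prems r exponents_pos by (intro slice_sub_mean_coord_herz_norm) auto
  qed (use Cons.prems in auto)
  also have "\<dots> = ennreal (prod_list (map (\<lambda>i. franke_const c r (q i) (p i)) (i # l)) *
     2 powr (real k * sum_list (map (\<lambda>i. 1 / q i - 1 / p i) (i # l)))) * foldH (i # l) H y"
    using fc fcp by (simp add: a_def ennreal_mult distrib_left powr_add mult_ac)
  finally show ?case .
qed

lemma mixed_Lp_norm_le_mixed_herz_norm:
  fixes H :: "nat \<Rightarrow> (real, 'n) vec \<Rightarrow> ennreal"
  assumes Hm [measurable]: "\<And>k. H k \<in> borel_measurable borel"
    and H: "\<And>k i. slice_sub_mean r w (2 powr (- real k)) i (H k)"
    and s: "s1 - (\<Sum>i\<in>UNIV. 1 / p i) = s2 - (\<Sum>i\<in>UNIV. 1 / q i)"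
  shows "mixed_Lp_norm (\<lambda>i. ennreal (p i)) (\<lambda>x. lq_norm (ennreal r) (\<lambda>k. ennreal (2 powr (real k * s1)) * H k x)) \<le>
     ennreal (\<Prod>i\<leftarrow>sorted_list_of_set UNIV. franke_const c r (q i) (p i)) *
     lq_norm (ennreal (p (Max UNIV))) (\<lambda>k. ennreal (2 powr (real k * s2)) *
       mixed_herz_norm (\<lambda>i. ennreal (q i)) (\<lambda>i. 0) (\<lambda>i. ennreal (p i)) (H k))"
proof -
  have fc: "0 \<le> franke_const c r a b" for a b by (simp add: franke_const_def)
  define L where "L = sorted_list_of_set (UNIV :: 'n set)"
  have L: "set L = UNIV" "sorted L" "distinct L" by (auto simp: L_def)
  then obtain l n where ln: "L = l @ [n]"
    by (metis UNIV_not_empty rev_exhaust set_empty)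
  have nmax: "Max UNIV = n"
  proof (rule Max_eqI)
    fix y :: 'n
    have "y \<in> set (l @ [n])" using L(1) unfolding ln by blast
    then show "y \<le> n" using L(2) unfolding ln by (auto simp: sorted_append)
  qed auto
  have nl: "n \<notin> set l" "distinct l" using L(3) ln by auto
  define \<Delta> where "\<Delta> = sum_list (map (\<lambda>i. 1 / q i - 1 / p i) l)"
  define A where "A = prod_list (map (\<lambda>i. franke_const c r (q i) (p i)) l)"
  have A: "0 \<le> A" unfolding A_def by (induction l) (auto simp: fc)
  have "(\<Sum>i\<in>UNIV. 1 / q i - 1 / p i) = sum_list (map (\<lambda>i. 1 / q i - 1 / p i) L)"
    using L by (simp add: sum_list_distinct_conv_sum_set)
  \<comment> \<open>The differences 1/q_i - 1/p_i of the inner coordinates and that of the last one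
    lead together from s1 to s2.\<close>
  then have s2: "s2 = s1 + \<Delta> + (1 / q n - 1 / p n)"
    using s by (simp add: ln \<Delta>_def sum_subtractf)
  \<comment> \<open>Collects the smoothness weight and the price of the inner coordinates. As it is
    constant in t, it does not disturb the sub-mean property of \<open>G k\<close>.\<close>
  define a where "a k = ennreal (A * 2 powr (real k * (s1 + \<Delta>)))" for k :: nat
  define G where "G k t = a k * foldH l (H k) (upd 0 n t)" for k t
  note [measurable] = measurable_foldH[OF Hm]
  have Gm [measurable]: "G k \<in> borel_measurable borel" for k
    unfolding G_def by measurable
  have "foldL l (\<lambda>x. lq_norm (ennreal r) (\<lambda>k. ennreal (2 powr (real k * s1)) * H k x)) (upd 0 n t) \<le>
      lq_norm (ennreal r) (\<lambda>k. G k t)" for t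
  proof -
    have "foldL l (\<lambda>x. lq_norm (ennreal r) (\<lambda>k. ennreal (2 powr (real k * s1)) * H k x)) (upd 0 n t) \<le>
       lq_norm (ennreal r) (\<lambda>k. foldL l (\<lambda>x. ennreal (2 powr (real k * s1)) * H k x) (upd 0 n t))"
      by (rule foldL_lq_norm_le) simp
    also have "\<dots> \<le> lq_norm (ennreal r) (\<lambda>k. G k t)"
    proof (rule lq_norm_mono[OF r(1)])
      fix k
      have "foldL l (\<lambda>x. ennreal (2 powr (real k * s1)) * H k x) (upd 0 n t) =
          ennreal (2 powr (real k * s1)) * foldL l (H k) (upd 0 n t)"
        by (rule foldL_cmult) simp
      also have "\<dots> \<le> ennreal (2 powr (real k * s1)) * (ennreal (A * 2 powr (real k * \<Delta>)) * foldH l (H k) (upd 0 n t))"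
        unfolding A_def \<Delta>_def by (intro mult_left_mono foldL_le_foldH Hm nl H) simp
      also have "\<dots> = G k t"
      proof -
        have "a k = ennreal (2 powr (real k * s1)) * ennreal (A * 2 powr (real k * \<Delta>))"
          unfolding a_def using A
          by (subst ennreal_mult[symmetric]) (simp_all add: distrib_left powr_add mult.left_commute)
        then show ?thesis by (simp only: G_def mult.assoc)
      qed
      finally show "foldL l (\<lambda>x. ennreal (2 powr (real k * s1)) * H k x) (upd 0 n t) \<le> G k t" .
    qed
    finally show ?thesis .
  qed
  then have "mixed_Lp_norm (\<lambda>i. ennreal (p i)) (\<lambda>x. lq_norm (ennreal r) (\<lambda>k. ennreal (2 powr (real k * s1)) * H k x)) \<le>
      Lp_norm (ennreal (p n)) (\<lambda>t. lq_norm (ennreal r) (\<lambda>k. G k t))"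
    unfolding mixed_Lp_norm_def mixed_norm_def L_def[symmetric] ln
    by (simp add: coord_norm_upd Lp_norm_mono exponents_pos)
  also have "\<dots> \<le> ennreal (franke_const c r (q n) (p n)) * lq_norm (ennreal (p n))
      (\<lambda>k. ennreal (2 powr (real k * (1 / q n - 1 / p n))) * herz_norm (ennreal (q n)) 0 (ennreal (p n)) (G k))"
  proof (rule franke_jawerth_herz[OF _ c w Gm r])
    fix k
    have "slice_sub_mean r w (2 powr - real k) n (foldH l (H k))"
      by (intro foldH_sub_mean Hm nl H)
    then show "sub_mean r w (2 powr - real k) (G k)"
      unfolding G_def slice_sub_mean_def by (intro sub_mean_cmult) auto
  qed
  also have "(\<lambda>k. ennreal (2 powr (real k * (1 / q n - 1 / p n))) * herz_norm (ennreal (q n)) 0 (ennreal (p n)) (G k)) =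
     (\<lambda>k. ennreal A * (ennreal (2 powr (real k * s2)) * mixed_herz_norm (\<lambda>i. ennreal (q i)) (\<lambda>i. 0) (\<lambda>i. ennreal (p i)) (H k)))"
  proof
    fix k
    have "herz_norm (ennreal (q n)) 0 (ennreal (p n)) (G k) = a k * herz_norm (ennreal (q n)) 0 (ennreal (p n)) (\<lambda>t. foldH l (H k) (upd 0 n t))"
      unfolding G_def by (intro herz_norm_cmult exponents_pos) simp
    also have "herz_norm (ennreal (q n)) 0 (ennreal (p n)) (\<lambda>t. foldH l (H k) (upd 0 n t)) =
      mixed_herz_norm (\<lambda>i. ennreal (q i)) (\<lambda>i. 0) (\<lambda>i. ennreal (p i)) (H k)"
      unfolding mixed_herz_norm_def mixed_norm_def L_def[symmetric] ln by (simp add: coord_norm_upd)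
    finally show "ennreal (2 powr (real k * (1 / q n - 1 / p n))) * herz_norm (ennreal (q n)) 0 (ennreal (p n)) (G k) =
      ennreal A * (ennreal (2 powr (real k * s2)) * mixed_herz_norm (\<lambda>i. ennreal (q i)) (\<lambda>i. 0) (\<lambda>i. ennreal (p i)) (H k))"
      using A unfolding s2 a_def by (simp add: distrib_left powr_add ennreal_mult mult_ac)
  qed
  also have "lq_norm (ennreal (p n)) (\<lambda>k. ennreal A * (ennreal (2 powr (real k * s2)) * mixed_herz_norm (\<lambda>i. ennreal (q i)) (\<lambda>i. 0) (\<lambda>i. ennreal (p i)) (H k))) =
      ennreal A * lq_norm (ennreal (p n)) (\<lambda>k. ennreal (2 powr (real k * s2)) * mixed_herz_norm (\<lambda>i. ennreal (q i)) (\<lambda>i. 0) (\<lambda>i. ennreal (p i)) (H k))"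
    by (intro lq_norm_cmult exponents_pos)
  finally show ?thesis
    using A fc unfolding nmax L_def[symmetric] ln by (simp add: A_def ennreal_mult mult_ac)
qed

end

subsection \<open>Sampling coefficients of band-limited functions\<close>

text \<open>Differentiating exp(-1/x)/x^j yields a combination of the members j + 1 and j + 2, so
  carrying the power of x along makes the family closed under differentiation up to linear
  combinations.\<close>

definition flat_exp :: "nat \<Rightarrow> real \<Rightarrow> real" where
  "flat_exp j x = (if x \<le> 0 then 0 else exp (- (1 / x)) / x ^ j)"

lemma flat_exp_nonneg: "0 \<le> flat_exp j x"
  by (simp add: flat_exp_def)

text \<open>From exp y \<ge> (y/n)^n with y = 1/x and n = j + 2. Two powers of x are left over,
  which forces the derivative at 0 to vanish.\<close>

lemma flat_exp_le: "flat_exp j x \<le> real (j + 2) ^ (j + 2) * x\<^sup>2"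
proof (cases "0 < x")
  case True
  define n where "n = j + 2"
  have n: "0 < n" by (simp add: n_def)
  have "1 / x / real n \<le> exp (1 / x / real n)" using exp_ge_add_one_self[of "1 / x / real n"] by linarith
  then have "(1 / x / real n) ^ n \<le> exp (1 / x / real n) ^ n"
    using True by (intro power_mono) auto
  also have "\<dots> = exp (1 / x)" by (rule exp_divide_power_eq[OF n])
  finally have "1 \<le> exp (1 / x) * (real n ^ n * x ^ n)"
    using True n by (simp add: field_simps)
  then have "exp (- (1 / x)) \<le> real n ^ n * x ^ n"
    by (simp add: exp_minus inverse_eq_divide divide_le_eq mult.commute)
  then have "exp (- (1 / x)) / x ^ j \<le> real n ^ n * x ^ n / x ^ j"
    using True by (intro divide_right_mono) auto
  also have "\<dots> = real n ^ n * x\<^sup>2"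
    using True by (simp add: n_def power_add power2_eq_square)
  finally show ?thesis using True by (simp add: flat_exp_def n_def)
qed (simp add: flat_exp_def)

lemma flat_exp_has_derivative:
  "(flat_exp j has_real_derivative flat_exp (j + 2) x - real j * flat_exp (j + 1) x) (at x)"
proof -
  consider "x < 0" | "x = 0" | "0 < x" by linarith
  then show ?thesis
  proof cases
    case 1
    have "((\<lambda>x. 0) has_real_derivative 0) (at x)" by simp
    moreover have "eventually (\<lambda>y. y < 0) (nhds x)" using 1 by (simp add: eventually_nhds_in_open[of "{..<0}", simplified])
    then have "eventually (\<lambda>y. flat_exp j y = 0) (nhds x)" by eventually_elim (simp add: flat_exp_def)
    ultimately show ?thesis using 1 by (subst DERIV_cong_ev[OF refl]) (auto simp: flat_exp_def)
  next
    case 2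
    have "(\<lambda>h. (flat_exp j (0 + h) - flat_exp j 0) / h) \<midarrow>0\<rightarrow> 0"
    proof (rule Lim_null_comparison)
      show "\<forall>\<^sub>F h in at 0. norm ((flat_exp j (0 + h) - flat_exp j 0) / h) \<le> real (j + 2) ^ (j + 2) * \<bar>h\<bar>"
      proof (rule eventually_at_topological[THEN iffD2], intro exI[of _ UNIV] conjI ballI impI)
        fix h :: real assume "h \<noteq> 0"
        then show "norm ((flat_exp j (0 + h) - flat_exp j 0) / h) \<le> real (j + 2) ^ (j + 2) * \<bar>h\<bar>"
          using flat_exp_le[of j h] flat_exp_nonneg[of j h]
          by (simp add: flat_exp_def[of j 0] divide_le_eq power2_eq_square mult.assoc)
      qed auto
      show "(\<lambda>h. real (j + 2) ^ (j + 2) * \<bar>h\<bar>) \<midarrow>0\<rightarrow> 0"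
        by (auto intro!: tendsto_eq_intros)
    qed
    then show ?thesis using 2 by (simp add: DERIV_def flat_exp_def)
  next
    case 3
    have "((\<lambda>x. exp (- (1 / x)) / x ^ j) has_real_derivative
        flat_exp (j + 2) x - real j * flat_exp (j + 1) x) (at x)"
    proof -
      have "((\<lambda>x. exp (- (1 / x)) / x ^ j) has_real_derivative
        (exp (- (1 / x)) * (1 / x\<^sup>2) * x ^ j - exp (- (1 / x)) * (real j * x ^ (j - 1))) / (x ^ j * x ^ j)) (at x)"
        using 3 by (auto intro!: derivative_eq_intros simp: power2_eq_square)
      also have "(exp (- (1 / x)) * (1 / x\<^sup>2) * x ^ j - exp (- (1 / x)) * (real j * x ^ (j - 1))) / (x ^ j * x ^ j) =
          flat_exp (j + 2) x - real j * flat_exp (j + 1) x"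
        using 3 by (cases j) (simp_all add: flat_exp_def field_simps power2_eq_square)
      finally show ?thesis .
    qed
    moreover have "eventually (\<lambda>y. 0 < y) (nhds x)" using 3 by (simp add: eventually_nhds_in_open[of "{0<..}", simplified])
    then have "eventually (\<lambda>y. flat_exp j y = exp (- (1 / y)) / y ^ j) (nhds x)"
      by eventually_elim (simp add: flat_exp_def)
    ultimately show ?thesis by (subst DERIV_cong_ev[OF refl]) auto
  qed
qed

text \<open>The linear span of products that are flat at 0 and at 1. It is closed under
  differentiation and its members vanish outside (0, 1), so derivatives of all orders exist without
  being computed.\<close>

inductive_set bumps :: "(real \<Rightarrow> real) set" where
  base: "(\<lambda>x. flat_exp i x * flat_exp j (1 - x)) \<in> bumps"
| add: "f \<in> bumps \<Longrightarrow> g \<in> bumps \<Longrightarrow> (\<lambda>x. f x + g x) \<in> bumps"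
| cmult: "f \<in> bumps \<Longrightarrow> (\<lambda>x. c * f x) \<in> bumps"

lemma bumps_derivative:
  "f \<in> bumps \<Longrightarrow> \<exists>f'\<in>bumps. \<forall>x. (f has_real_derivative f' x) (at x)"
proof (induction rule: bumps.induct)
  case (base i j)
  let ?f' = "\<lambda>x. (flat_exp (i + 2) x * flat_exp j (1 - x) + (- real i) * (flat_exp (i + 1) x * flat_exp j (1 - x))) +
     ((-1) * (flat_exp i x * flat_exp (j + 2) (1 - x)) + real j * (flat_exp i x * flat_exp (j + 1) (1 - x)))"
  have "?f' \<in> bumps" by (intro bumps.intros)
  moreover have "((\<lambda>x. flat_exp i x * flat_exp j (1 - x)) has_real_derivative ?f' x) (at x)" for x
  proof -
    have "((\<lambda>x. flat_exp j (1 - x)) has_real_derivative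
        (flat_exp (j + 2) (1 - x) - real j * flat_exp (j + 1) (1 - x)) * (- 1)) (at x)"
      by (rule DERIV_chain2[OF flat_exp_has_derivative]) (auto intro!: derivative_eq_intros)
    from DERIV_mult[OF flat_exp_has_derivative[of i x] this] show ?thesis
      by (simp add: algebra_simps)
  qed
  ultimately show ?case by (intro bexI[of _ ?f']) auto
next
  case (add f g)
  then obtain f' g' where "f' \<in> bumps" "g' \<in> bumps" "\<And>x. (f has_real_derivative f' x) (at x)"
    "\<And>x. (g has_real_derivative g' x) (at x)" by blast
  then show ?case by (intro bexI[of _ "\<lambda>x. f' x + g' x"]) (auto intro: bumps.add DERIV_add)
next
  case (cmult f c)
  then obtain f' where "f' \<in> bumps" "\<And>x. (f has_real_derivative f' x) (at x)" by blast
  then show ?case by (intro bexI[of _ "\<lambda>x. c * f' x"]) (auto intro: bumps.cmult DERIV_cmult)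
qed

lemma bumps_eq_0: "f \<in> bumps \<Longrightarrow> x \<le> 0 \<or> 1 \<le> x \<Longrightarrow> f x = 0"
  by (induction rule: bumps.induct) (auto simp: flat_exp_def)

lemma bumps_continuous:
  assumes "f \<in> bumps"
  shows "continuous_on A f"
proof -
  obtain f' where "\<And>x. (f has_real_derivative f' x) (at x)" using bumps_derivative[OF assms] by blast
  then show ?thesis by (meson DERIV_isCont continuous_at_imp_continuous_on)
qed

text \<open>The normalised primitive P of a bump is a smooth step from 0 to 1 on [0, 1]; P (x + 3) -
  P (x - 2) rises on [-3, -2] and falls on [2, 3]. \<open>D\<close> lists its successive
  derivatives. The interval [-4, 4] contains [-pi, pi], where Fourier coefficients are
  taken.\<close>

lemma plateau_exists:
  "\<exists>D :: nat \<Rightarrow> real \<Rightarrow> real.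
    (\<forall>n. \<forall>x\<in>{-4..4}. (D n has_real_derivative D (Suc n) x) (at x within {-4..4})) \<and>
    (\<forall>x\<in>{-2..2}. D 0 x = 1) \<and> (\<forall>n. \<forall>x\<in>{-4..4}. 3 \<le> \<bar>x\<bar> \<longrightarrow> D n x = 0)"
proof -
  define b where "b x = flat_exp 0 x * flat_exp 0 (1 - x)" for x
  have b: "b \<in> bumps" unfolding b_def by (rule bumps.base)
  have "\<exists>B. \<forall>n. (B n \<in> bumps \<and> (n = 0 \<longrightarrow> B n = b)) \<and> (\<forall>x. (B n has_real_derivative B (Suc n) x) (at x))"
  proof (rule dependent_nat_choice)
    show "\<exists>x. x \<in> bumps \<and> (0 = (0::nat) \<longrightarrow> x = b)" using b by blast
    show "\<exists>y. (y \<in> bumps \<and> (Suc n = 0 \<longrightarrow> y = b)) \<and> (\<forall>z. (x has_real_derivative y z) (at z))"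
      if "x \<in> bumps \<and> (n = 0 \<longrightarrow> x = b)" for x n
      using bumps_derivative[of x] that by blast
  qed
  then obtain B where B: "\<And>n. B n \<in> bumps" "\<And>n x. (B n has_real_derivative B (Suc n) x) (at x)" "B 0 = b"
    by metis
  \<comment> \<open>The primitive starts at -10, far enough to the left for all arguments x + 3 and
    x - 2 with |x| \<le> 4.\<close>
  define I where "I = integral {-10..1} b"
  define P where "P x = integral {-10..x} b / I" for x
  have bc: "continuous_on A b" for A by (rule bumps_continuous[OF b])
  have b0: "0 \<le> b x" for x by (simp add: b_def flat_exp_nonneg)
  have "I \<noteq> 0"
  proof
    assume "I = 0"
    then have "\<forall>x\<in>{-10..1}. b x = 0"
      unfolding I_def using integral_eq_0_iff[OF bc[of "{-10..1}"]] b0 by simp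
    then have "b (1/2) = 0" by simp
    then show False by (simp add: b_def flat_exp_def)
  qed
  have P0: "P x = 0" if "-10 \<le> x" "x \<le> 0" for x
  proof -
    have "integral {-10..x} b = integral {-10..x} (\<lambda>_. 0)"
      using that by (intro integral_cong) (auto intro!: bumps_eq_0[OF b])
    then show ?thesis by (simp add: P_def)
  qed
  have P1: "P x = 1" if "1 \<le> x" for x
  proof -
    have "integral {-10..1} b + integral {1..x} b = integral {-10..x} b"
      using that by (intro Henstock_Kurzweil_Integration.integral_combine integrable_continuous_interval bc) auto
    moreover have "integral {1..x} b = integral {1..x} (\<lambda>_. 0)"
      by (intro integral_cong) (auto intro!: bumps_eq_0[OF b])
    ultimately show ?thesis using \<open>I \<noteq> 0\<close> by (simp add: P_def I_def)
  qed
  have dP: "(P has_real_derivative b x / I) (at x)" if "x \<in> {-10<..<10}" for x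
  proof -
    have "((\<lambda>x. integral {-10..x} b) has_real_derivative b x) (at x within {-10..10})"
      using that by (intro integral_has_real_derivative bc) auto
    moreover have "at x within {-10..10} = at x"
      using that by (intro at_within_interior) auto
    ultimately show ?thesis unfolding P_def by (intro DERIV_cdivide) simp
  qed
  define D where "D n x = (case n of 0 \<Rightarrow> P (x + 3) - P (x - 2) | Suc m \<Rightarrow> (B m (x + 3) - B m (x - 2)) / I)" for n x
  have "(D n has_real_derivative D (Suc n) x) (at x within {-4..4})" if "x \<in> {-4..4}" for n x
  proof (cases n)
    case 0
    have "((\<lambda>x. P (x + 3)) has_real_derivative b (x + 3) / I * 1) (at x)"
      using that by (intro DERIV_chain2[OF dP]) (auto intro!: derivative_eq_intros)
    moreover have "((\<lambda>x. P (x - 2)) has_real_derivative b (x - 2) / I * 1) (at x)"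
      using that by (intro DERIV_chain2[OF dP]) (auto intro!: derivative_eq_intros)
    ultimately have d: "((\<lambda>x. P (x + 3) - P (x - 2)) has_real_derivative b (x + 3) / I * 1 - b (x - 2) / I * 1) (at x)"
      by (rule DERIV_diff)
    have "D 0 = (\<lambda>x. P (x + 3) - P (x - 2))" by (simp add: D_def fun_eq_iff)
    moreover have "D (Suc 0) x = b (x + 3) / I * 1 - b (x - 2) / I * 1"
      by (simp add: D_def B(3) diff_divide_distrib)
    ultimately show ?thesis
      unfolding 0 using has_field_derivative_at_within[OF d] by metis
  next
    case (Suc m)
    have "((\<lambda>x. B m (x + 3)) has_real_derivative B (Suc m) (x + 3) * 1) (at x)"
      by (intro DERIV_chain2[OF B(2)]) (auto intro!: derivative_eq_intros)
    moreover have "((\<lambda>x. B m (x - 2)) has_real_derivative B (Suc m) (x - 2) * 1) (at x)"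
      by (intro DERIV_chain2[OF B(2)]) (auto intro!: derivative_eq_intros)
    ultimately have d: "((\<lambda>x. (B m (x + 3) - B m (x - 2)) / I) has_real_derivative (B (Suc m) (x + 3) * 1 - B (Suc m) (x - 2) * 1) / I) (at x)"
      by (intro DERIV_cdivide DERIV_diff)
    have "D (Suc m) = (\<lambda>x. (B m (x + 3) - B m (x - 2)) / I)" by (simp add: D_def fun_eq_iff)
    moreover have "D (Suc (Suc m)) x = (B (Suc m) (x + 3) * 1 - B (Suc m) (x - 2) * 1) / I"
      by (simp add: D_def)
    ultimately show ?thesis
      unfolding Suc using has_field_derivative_at_within[OF d] by metis
  qed
  moreover have "D 0 x = 1" if "x \<in> {-2..2}" for x
    using that by (simp add: D_def P0 P1)
  moreover have "D n x = 0" if "x \<in> {-4..4}" "3 \<le> \<bar>x\<bar>" for n x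
  proof -
    have "x \<le> -3 \<or> 3 \<le> x" using that by linarith
    then show ?thesis
    proof (elim disjE)
      assume "x \<le> -3"
      then show ?thesis using that by (cases n) (auto simp: D_def P0 intro!: bumps_eq_0 B(1) simp: bumps_eq_0[OF B(1)])
    next
      assume "3 \<le> x"
      then show ?thesis using that by (cases n) (auto simp: D_def P1 bumps_eq_0[OF B(1)])
    qed
  qed
  ultimately show ?thesis by blast
qed

section \<open>Cesaro means and the Fejer kernel\<close>

lemma cesaro_limit:
  fixes f :: "nat \<Rightarrow> 'a::real_normed_vector"
  assumes "f \<longlonglongrightarrow> L"
  shows "(\<lambda>N. (\<Sum>T<N. f T) /\<^sub>R real N) \<longlonglongrightarrow> L"
proof (rule LIMSEQ_I)
  fix e :: real assume e: "0 < e"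
  obtain N0 where N0: "\<And>T. T \<ge> N0 \<Longrightarrow> norm (f T - L) < e / 2"
    using LIMSEQ_D[OF assms, of "e / 2"] e by auto
  define K where "K = (\<Sum>T<N0. norm (f T - L))"
  obtain N1 where N1: "2 * K / e < real N1" using reals_Archimedean2 by blast
  have "norm ((\<Sum>T<N. f T) /\<^sub>R real N - L) < e" if "N \<ge> max (max N0 N1) 1" for N
  proof -
    have N: "N0 \<le> N" "N1 \<le> N" "0 < N" using that by auto
    have "(\<Sum>T<N. f T) /\<^sub>R real N - L = (\<Sum>T<N. f T - L) /\<^sub>R real N"
      using N by (simp add: sum_subtractf scaleR_diff_right sum_constant_scaleR)
    then have "norm ((\<Sum>T<N. f T) /\<^sub>R real N - L) = norm (\<Sum>T<N. f T - L) / real N"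
      by (simp add: divide_inverse mult.commute)
    also have "\<dots> \<le> (\<Sum>T<N. norm (f T - L)) / real N"
      by (intro divide_right_mono norm_sum) auto
    also have "(\<Sum>T<N. norm (f T - L)) = K + (\<Sum>T\<in>{N0..<N}. norm (f T - L))"
      unfolding K_def using N by (simp add: lessThan_atLeast0 sum.atLeastLessThan_concat)
    also have "(\<Sum>T\<in>{N0..<N}. norm (f T - L)) \<le> (\<Sum>T\<in>{N0..<N}. e / 2)"
      by (intro sum_mono) (use N0 in \<open>auto intro: less_imp_le\<close>)
    also have "\<dots> \<le> real N * (e / 2)" using e N by (simp add: mult_right_mono)
    also have "(K + real N * (e / 2)) / real N = K / real N + e / 2" using N by (simp add: field_simps)
    also have "K / real N < e / 2"
    proof -
      have "2 * K / e < real N" using N1 N by (smt (verit) of_nat_mono)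
      then show ?thesis using e N by (simp add: field_simps)
    qed
    finally show ?thesis using N by (simp add: divide_right_mono)
  qed
  then show "\<exists>no. \<forall>n\<ge>no. norm ((\<Sum>T<n. f T) /\<^sub>R real n - L) < e" by blast
qed

text \<open>The enumeration runs 0, -1, 1, -2, 2 and so on, so its partial sums of odd length are
  the symmetric ones.\<close>

lemma sum_int_decode:
  fixes f :: "int \<Rightarrow> 'a::comm_monoid_add"
  shows "(\<Sum>n<2 * N + 1. f (int_decode n)) = (\<Sum>m\<in>{- int N..int N}. f m)"
proof (induction N)
  case 0
  then show ?case by (simp add: int_decode_def sum_decode_def)
next
  case (Suc N)
  have d: "int_decode (2 * N + 1) = - int (Suc N)" "int_decode (2 * N + 2) = int (Suc N)"
    by (simp_all add: int_decode_def sum_decode_def)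
  have "{- int (Suc N)..int (Suc N)} = insert (int (Suc N)) (insert (- int (Suc N)) {- int N..int N})"
    by auto
  then have "(\<Sum>m\<in>{- int (Suc N)..int (Suc N)}. f m) = f (int (Suc N)) + (f (- int (Suc N)) + (\<Sum>m\<in>{- int N..int N}. f m))"
    by simp
  moreover have "(\<Sum>n<2 * Suc N + 1. f (int_decode n)) = (\<Sum>n<2 * N + 1. f (int_decode n)) + f (int_decode (2 * N + 1)) + f (int_decode (2 * N + 2))"
    by (simp add: numeral_2_eq_2)
  ultimately show ?case using Suc d by (simp add: add_ac)
qed

lemma int_decode_abs_ge: "(1 + real n) / 2 \<le> 1 + \<bar>real_of_int (int_decode n)\<bar>"
  by (cases "even n") (auto simp: int_decode_def sum_decode_def elim!: evenE oddE)

lemma norm_exp_i_minus_1_le: "norm (exp (- (\<i> * of_real t)) - 1) \<le> \<bar>t\<bar>"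
  using dist_exp_i_1[of "- t"] abs_sin_x_le_abs_x[of "t / 2"] by simp

text \<open>pi + 2 bounds |x - \<xi>| for x in [-pi, pi] and |\<xi>| \<le> 2; it is below 2 pi, so u
  = 0 is the only zero in range. Writing 2 |sin (u/2)| as 4 |sin y cos y| with y = u/4 keeps |y|
  below pi/2, where one cosine controls both factors.\<close>

lemma norm_exp_i_minus_1_ge:
  "\<exists>\<kappa>>0. \<forall>u. \<bar>u\<bar> \<le> pi + 2 \<longrightarrow> \<kappa> * \<bar>u\<bar> \<le> norm (exp (- (\<i> * of_real u)) - 1)"
proof -
  define \<beta> where "\<beta> = (pi + 2) / 4"
  have \<beta>: "0 < \<beta>" "\<beta> < pi / 2" using pi_gt3 by (auto simp: \<beta>_def)
  define c0 where "c0 = cos \<beta>"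
  have c0: "0 < c0" unfolding c0_def using \<beta> by (intro cos_gt_zero) auto
  have cosge: "c0 \<le> cos y" if "\<bar>y\<bar> \<le> \<beta>" for y
  proof -
    have "cos \<beta> \<le> cos \<bar>y\<bar>" using that \<beta> by (intro cos_monotone_0_pi_le) auto
    then show ?thesis by (simp add: c0_def)
  qed
  have sinpos: "c0 * y \<le> sin y" if "0 \<le> y" "y \<le> \<beta>" for y
  proof -
    have "sin 0 - c0 * 0 \<le> sin y - c0 * y"
    proof (rule DERIV_nonneg_imp_nondecreasing[OF that(1)])
      fix x assume "0 \<le> x" "x \<le> y"
      then have "((\<lambda>x. sin x - c0 * x) has_real_derivative cos x - c0) (at x)" "0 \<le> cos x - c0"
        using cosge[of x] that by (auto intro!: derivative_eq_intros)
      then show "\<exists>d. ((\<lambda>x. sin x - c0 * x) has_real_derivative d) (at x) \<and> 0 \<le> d" by blast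
    qed
    then show ?thesis by simp
  qed
  have singe: "c0 * \<bar>y\<bar> \<le> \<bar>sin y\<bar>" if "\<bar>y\<bar> \<le> \<beta>" for y
    using sinpos[of "\<bar>y\<bar>"] that by (cases "0 \<le> y") (auto simp: abs_if split: if_splits)
  have "c0\<^sup>2 * \<bar>u\<bar> \<le> norm (exp (- (\<i> * of_real u)) - 1)" if "\<bar>u\<bar> \<le> pi + 2" for u
  proof -
    define y where "y = u / 4"
    have y: "\<bar>y\<bar> \<le> \<beta>" using that by (simp add: y_def \<beta>_def)
    have "norm (exp (- (\<i> * of_real u)) - 1) = 2 * \<bar>sin (u / 2)\<bar>"
      using dist_exp_i_1[of "- u"] by simp
    also have "u / 2 = 2 * y" by (simp add: y_def)
    also have "2 * \<bar>sin (2 * y)\<bar> = 4 * (\<bar>sin y\<bar> * \<bar>cos y\<bar>)" by (simp add: sin_double abs_mult)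
    also have "\<dots> \<ge> 4 * ((c0 * \<bar>y\<bar>) * c0)"
      using c0 y cosge[OF y] singe[OF y] by (intro mult_left_mono mult_mono) auto
    also have "4 * ((c0 * \<bar>y\<bar>) * c0) = c0\<^sup>2 * \<bar>u\<bar>" by (simp add: y_def power2_eq_square)
    finally show ?thesis by simp
  qed
  then show ?thesis using c0 by (intro exI[of _ "c0\<^sup>2"]) auto
qed

lemma integral_exp_i_period:
  "integral {- pi..pi} (\<lambda>x. exp (- (\<i> * of_real (of_int m * (x - a))))) = (if m = 0 then of_real (2 * pi) else (0 :: complex))"
proof (cases "m = 0")
  case False
  define F where "F x = exp (- (\<i> * of_real (of_int m * (x - a)))) / (- (\<i> * of_int m))" for x :: real
  have "((\<lambda>x. exp (- (\<i> * of_real (of_int m * (x - a))))) has_integral (F pi - F (- pi))) {- pi..pi}"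
  proof (rule fundamental_theorem_of_calculus)
    fix x :: real
    show "(F has_vector_derivative exp (- (\<i> * of_real (of_int m * (x - a))))) (at x within {- pi..pi})"
    proof -
      have "((\<lambda>w. exp (- (\<i> * (of_int m * (w - of_real a)))) / (- (\<i> * of_int m))) has_field_derivative
          exp (- (\<i> * (of_int m * (of_real x - of_real a))))) (at (of_real x))"
        using False by (auto intro!: derivative_eq_intros) (simp_all add: mult_ac)
      from has_vector_derivative_real_field[OF this] show ?thesis by (simp add: F_def[abs_def])
    qed
  qed simp
  moreover have "F pi = F (- pi)"
  proof -
    have "exp (- (\<i> * of_real (of_int m * (- pi - a)))) = exp (- (\<i> * of_real (of_int m * (pi - a))) + \<i> * (of_int (2 * m) * of_real pi))"
      by (simp add: algebra_simps)
    also have "\<dots> = exp (- (\<i> * of_real (of_int m * (pi - a))))"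
      unfolding exp_eq by (intro exI[of _ m]) simp
    finally show ?thesis by (simp add: F_def)
  qed
  ultimately show ?thesis using False by (simp add: integral_unique)
qed (simp add: scaleR_conv_of_real)

definition dirichlet :: "nat \<Rightarrow> real \<Rightarrow> complex" where
  "dirichlet N u = (\<Sum>m\<in>{- int N..int N}. exp (- (\<i> * of_real (of_int m * u))))"

definition fejer :: "nat \<Rightarrow> real \<Rightarrow> complex" where
  "fejer N u = (\<Sum>T<N. dirichlet T u) /\<^sub>R real N"

lemma continuous_on_dirichlet [continuous_intros]: "continuous_on A f \<Longrightarrow> continuous_on A (\<lambda>x. dirichlet N (f x))"
  unfolding dirichlet_def by (intro continuous_intros)

lemma continuous_on_fejer [continuous_intros]: "continuous_on A f \<Longrightarrow> continuous_on A (\<lambda>x. fejer N (f x))"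
  unfolding fejer_def by (intro continuous_intros)

lemma dirichlet_telescope:
  fixes u :: real
  defines "z \<equiv> exp (- (\<i> * of_real u))" and "w \<equiv> exp (\<i> * of_real u)"
  shows "(z - 1) * dirichlet N u = z ^ (N + 1) - w ^ N"
proof (induction N)
  case 0
  then show ?case by (simp add: dirichlet_def)
next
  case (Suc N)
  have zw: "z * w = 1" by (simp add: z_def w_def exp_minus)
  have e: "{- int (Suc N)..int (Suc N)} = insert (int (Suc N)) (insert (- int (Suc N)) {- int N..int N})"
    by auto
  have "exp (- (\<i> * of_real (of_int (int (Suc N)) * u))) = z ^ Suc N"
    unfolding z_def exp_of_nat_mult[symmetric] by (simp add: algebra_simps)
  moreover have "exp (- (\<i> * of_real (of_int (- int (Suc N)) * u))) = w ^ Suc N"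
    unfolding w_def exp_of_nat_mult[symmetric] by (simp add: algebra_simps)
  ultimately have "dirichlet (Suc N) u = z ^ Suc N + (w ^ Suc N + dirichlet N u)"
    unfolding dirichlet_def e by simp
  then have "(z - 1) * dirichlet (Suc N) u = z * z ^ Suc N - z ^ Suc N + ((z * w) * w ^ N - w ^ Suc N) + (z - 1) * dirichlet N u"
    by (simp add: algebra_simps)
  then show ?case unfolding zw Suc by simp
qed

text \<open>Telescoping is used once for the first bound and twice for the second. The first yields
  a bounded majorant for products with a function vanishing linearly at u = 0, the second the decay
  in N away from 0; together they do the work of the positivity of the kernel.\<close>

lemma fejer_bounds:
  fixes u :: real
  defines "z \<equiv> exp (- (\<i> * of_real u))"
  assumes N: "0 < N"
  shows "norm (z - 1) * norm (fejer N u) \<le> 2" "(norm (z - 1))\<^sup>2 * norm (fejer N u) \<le> 4 / real N"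
proof -
  define w where "w = exp (\<i> * of_real u)"
  have zw: "z * w = 1" by (simp add: z_def w_def exp_minus)
  have nz: "norm z = 1" "norm w = 1" by (simp_all add: z_def w_def)
  have e: "(z - 1) * fejer N u = (\<Sum>T<N. z ^ (T + 1) - w ^ T) /\<^sub>R real N"
    using dirichlet_telescope[of u] unfolding fejer_def z_def w_def
    by (simp add: sum_distrib_left)
  have "norm (\<Sum>T<N. z ^ (T + 1) - w ^ T) \<le> (\<Sum>T<N. norm (z ^ (T + 1) - w ^ T))" by (rule norm_sum)
  also have "\<dots> \<le> (\<Sum>T<N. 2)"
    by (intro sum_mono order_trans[OF norm_triangle_ineq4]) (simp add: norm_power norm_mult nz)
  finally have "norm ((z - 1) * fejer N u) \<le> 2"
    unfolding e using N by (simp add: field_simps)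
  then show "norm (z - 1) * norm (fejer N u) \<le> 2" by (simp add: norm_mult)
  have "(z - 1) * (\<Sum>T<n. z ^ (T + 1) - w ^ T) = z * (z ^ n - 1) + z * (w ^ n - 1)" for n
  proof (induction n)
    case (Suc n)
    have "z * w ^ Suc n = w ^ n" using zw by (simp add: mult.assoc[symmetric])
    then have "(z - 1) * w ^ n = z * w ^ n - z * w ^ Suc n" by (simp only: left_diff_distrib mult_1)
    then have "(z - 1) * (z ^ (n + 1) - w ^ n) = z * z ^ Suc n - z * z ^ n - (z * w ^ n - z * w ^ Suc n)"
      by (simp add: algebra_simps)
    then show ?case using Suc by (simp add: distrib_left right_diff_distrib)
  qed simp
  from this[of N] have "(z - 1) * ((z - 1) * fejer N u) = (z * (z ^ N - 1) + z * (w ^ N - 1)) /\<^sub>R real N"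
    unfolding e by simp
  then have "norm ((z - 1) * ((z - 1) * fejer N u)) = norm (z * (z ^ N - 1) + z * (w ^ N - 1)) / real N"
    by (simp add: divide_inverse mult.commute)
  also have "norm (z * (z ^ N - 1) + z * (w ^ N - 1)) \<le> 4"
  proof -
    have "norm (z * (z ^ N - 1)) \<le> 2" "norm (z * (w ^ N - 1)) \<le> 2"
      using norm_triangle_ineq4[of "z ^ N" 1] norm_triangle_ineq4[of "w ^ N" 1]
      by (simp_all add: norm_mult norm_power nz)
    then show ?thesis using norm_triangle_ineq[of "z * (z ^ N - 1)" "z * (w ^ N - 1)"] by linarith
  qed
  finally show "(norm (z - 1))\<^sup>2 * norm (fejer N u) \<le> 4 / real N"
    by (simp add: norm_mult power2_eq_square divide_right_mono mult.assoc)
qed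


lemma norm_int_decode_summable: "summable (\<lambda>n. 1 / (1 + \<bar>real_of_int (int_decode n)\<bar>)\<^sup>2)"
proof (rule summable_comparison_test)
  have "summable (\<lambda>n. inverse (real (Suc n) ^ 2))"
    by (subst summable_Suc_iff) (rule inverse_power_summable, simp)
  then show "summable (\<lambda>n. 4 * inverse (real (Suc n) ^ 2))" by (rule summable_mult)
  have "norm (1 / (1 + \<bar>real_of_int (int_decode n)\<bar>)\<^sup>2) \<le> 4 * inverse (real (Suc n) ^ 2)" for n
  proof -
    have "((1 + real n) / 2)\<^sup>2 \<le> (1 + \<bar>real_of_int (int_decode n)\<bar>)\<^sup>2"
      by (intro power_mono int_decode_abs_ge) auto
    then have "1 / (1 + \<bar>real_of_int (int_decode n)\<bar>)\<^sup>2 \<le> 1 / ((1 + real n) / 2)\<^sup>2"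
      by (intro divide_left_mono) (auto intro!: mult_pos_pos zero_less_power add_pos_nonneg)
    then show ?thesis by (simp add: power_divide inverse_eq_divide)
  qed
  then show "\<exists>N. \<forall>n\<ge>N. norm (1 / (1 + \<bar>real_of_int (int_decode n)\<bar>)\<^sup>2) \<le> 4 * inverse (real (Suc n) ^ 2)"
    by blast
qed

text \<open>The coefficients are the Fourier coefficients of \<open>\<chi> \<xi> e\<^sup>-\<^sup>i\<^sup>s\<^sup>\<xi>\<close> on \<open>[- \<pi>, \<pi>]\<close>, where \<open>\<chi>\<close> is a smooth
  plateau function, equal to \<open>1\<close> on \<open>[-2, 2]\<close> and supported in \<open>[-3, 3]\<close>. Smoothness, and not merely
  finite differentiability, matters: the coefficients have to beat the unknown polynomial growth of
  \<open>f\<^sub>k\<close>. Their series converges absolutely, so its sum may be found from the Cesaro means.\<close>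

lemma sampling_coefficients:
  "\<exists>c :: real \<Rightarrow> int \<Rightarrow> complex.
    (\<forall>M. \<exists>C. \<forall>s\<in>{0..1}. \<forall>m. norm (c s m) * (1 + \<bar>real_of_int m\<bar>) ^ M \<le> C) \<and>
    (\<forall>s\<in>{0..1}. \<forall>\<xi>. \<bar>\<xi>\<bar> \<le> 2 \<longrightarrow>
      (\<lambda>n. c s (int_decode n) * exp (\<i> * of_real ((of_int (int_decode n) + s) * \<xi>))) sums 1)"
proof -
  obtain D :: "nat \<Rightarrow> real \<Rightarrow> real" where
    D: "\<And>n x. x \<in> {-4..4} \<Longrightarrow> (D n has_real_derivative D (Suc n) x) (at x within {-4..4})"
    and D1: "\<And>x. x \<in> {-2..2} \<Longrightarrow> D 0 x = 1"
    and D0: "\<And>n x. x \<in> {-4..4} \<Longrightarrow> 3 \<le> \<bar>x\<bar> \<Longrightarrow> D n x = 0"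
    using plateau_exists by blast
  have sub: "{-pi..pi} \<subseteq> {-4..4::real}" using pi_less_4 by auto
  have cont4: "continuous_on {-4..4} (D n)" for n
    by (rule DERIV_continuous_on[OF D])
  have cont [continuous_intros]: "continuous_on {-pi..pi} (D n)" for n
    using continuous_on_subset[OF cont4 sub] .
  define E where "E \<mu> x = exp (- (\<i> * of_real (\<mu> * x)))" for \<mu> x :: real
  have contE [continuous_intros]: "continuous_on A (E \<mu>)" for A \<mu>
    unfolding E_def by (intro continuous_intros)
  have normE: "norm (E \<mu> x) = 1" for \<mu> x by (simp add: E_def)
  define J where "J n \<mu> = integral {-pi..pi} (\<lambda>x. of_real (D n x) * E \<mu> x)" for n \<mu>
  \<comment> \<open>Integration by parts without boundary terms, as every \<open>D n\<close>
    vanishes at the end points because of pi > 3.\<close>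
  have ibp: "J (Suc n) \<mu> = \<i> * of_real \<mu> * J n \<mu>" for n \<mu>
  proof -
    have "((\<lambda>x. of_real (D (Suc n) x) * E \<mu> x - \<i> * of_real \<mu> * (of_real (D n x) * E \<mu> x)) has_integral
       (of_real (D n pi) * E \<mu> pi - of_real (D n (- pi)) * E \<mu> (- pi))) {-pi..pi}"
    proof (rule fundamental_theorem_of_calculus)
      fix x assume x: "x \<in> {-pi..pi}"
      have "((\<lambda>w. exp (- (\<i> * (of_real \<mu> * w)))) has_field_derivative
          - (\<i> * of_real \<mu>) * exp (- (\<i> * (of_real \<mu> * of_real x)))) (at (of_real x))"
        by (auto intro!: derivative_eq_intros)
      from has_vector_derivative_real_field[OF this]
      have e: "(E \<mu> has_vector_derivative - (\<i> * of_real \<mu>) * E \<mu> x) (at x within {-pi..pi})"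
        by (simp add: E_def[abs_def])
      have "(D n has_real_derivative D (Suc n) x) (at x within {-pi..pi})"
        using D[of x n] x sub by (meson DERIV_subset subsetD)
      then have d: "((\<lambda>x. of_real (D n x) :: complex) has_vector_derivative of_real (D (Suc n) x)) (at x within {-pi..pi})"
        by (intro has_vector_derivative_of_real) (simp add: has_real_derivative_iff_has_vector_derivative)
      show "((\<lambda>x. of_real (D n x) * E \<mu> x) has_vector_derivative
          of_real (D (Suc n) x) * E \<mu> x - \<i> * of_real \<mu> * (of_real (D n x) * E \<mu> x)) (at x within {-pi..pi})"
        using has_vector_derivative_mult[OF d e] by (simp add: algebra_simps)
    qed simp
    moreover have "D n pi = 0" "D n (- pi) = 0" using pi_gt3 pi_less_4 by (auto intro!: D0)
    ultimately have "integral {-pi..pi} (\<lambda>x. of_real (D (Suc n) x) * E \<mu> x - \<i> * of_real \<mu> * (of_real (D n x) * E \<mu> x)) = 0"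
      by (simp add: integral_unique)
    moreover have "integral {-pi..pi} (\<lambda>x. of_real (D (Suc n) x) * E \<mu> x - \<i> * of_real \<mu> * (of_real (D n x) * E \<mu> x)) =
       J (Suc n) \<mu> - \<i> * of_real \<mu> * J n \<mu>"
      unfolding J_def
      by (subst Henstock_Kurzweil_Integration.integral_diff)
        (auto intro!: integrable_continuous_interval continuous_intros)
    ultimately show ?thesis by simp
  qed
  have Jpow: "J n \<mu> = (\<i> * of_real \<mu>) ^ n * J 0 \<mu>" for n \<mu>
    by (induction n) (simp_all add: ibp mult.assoc)
  define K where "K n = integral {-pi..pi} (\<lambda>x. \<bar>D n x\<bar>)" for n
  have Jbd: "norm (J n \<mu>) \<le> K n" for n \<mu>
    unfolding J_def K_def
    by (rule integral_norm_bound_integral)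
      (auto intro!: integrable_continuous_interval continuous_intros simp: norm_mult normE)
  define c where "c s m = J 0 (of_int m + s) / of_real (2 * pi)" for s :: real and m :: int
  have decay: "norm (c s m) * (1 + \<bar>real_of_int m\<bar>) ^ M \<le> 3 ^ M * (K 0 + K M)" if s: "s \<in> {0..1}" for s m M
  proof -
    define \<mu> where "\<mu> = of_int m + s"
    have "(1 + \<bar>real_of_int m\<bar>) ^ M \<le> (3 * max 1 \<bar>\<mu>\<bar>) ^ M"
    proof (intro power_mono)
      have "1 + \<bar>real_of_int m\<bar> \<le> 2 + \<bar>\<mu>\<bar>" unfolding \<mu>_def using s by auto
      also have "\<dots> \<le> 3 * max 1 \<bar>\<mu>\<bar>" by (simp add: max_def)
      finally show "1 + \<bar>real_of_int m\<bar> \<le> 3 * max 1 \<bar>\<mu>\<bar>" .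
    qed simp
    also have "\<dots> \<le> 3 ^ M * (1 + \<bar>\<mu>\<bar> ^ M)"
      by (auto simp: power_mult_distrib max_def)
    finally have "norm (J 0 \<mu>) * (1 + \<bar>real_of_int m\<bar>) ^ M \<le> norm (J 0 \<mu>) * (3 ^ M * (1 + \<bar>\<mu>\<bar> ^ M))"
      by (rule mult_left_mono) simp
    also have "\<dots> = 3 ^ M * (norm (J 0 \<mu>) + norm (J M \<mu>))"
      by (simp add: Jpow[of M] norm_mult norm_power algebra_simps)
    also have "\<dots> \<le> 3 ^ M * (K 0 + K M)"
      by (intro mult_left_mono add_mono Jbd) auto
    finally have "norm (J 0 \<mu>) * (1 + \<bar>real_of_int m\<bar>) ^ M \<le> 3 ^ M * (K 0 + K M)" .
    moreover have "norm (c s m) \<le> norm (J 0 \<mu>)"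
      using pi_gt3 by (simp add: c_def \<mu>_def norm_divide divide_le_eq mult_le_cancel_left1)
    ultimately show ?thesis
      by (meson mult_right_mono order_trans zero_le_power add_nonneg_nonneg abs_ge_zero zero_le_one)
  qed
  moreover have "(\<lambda>n. c s (int_decode n) * exp (\<i> * of_real ((of_int (int_decode n) + s) * \<xi>))) sums 1"
    if s: "s \<in> {0..1}" and xi: "\<bar>\<xi>\<bar> \<le> 2" for s \<xi>
  proof -
    define f where "f m = c s m * exp (\<i> * of_real ((of_int m + s) * \<xi>))" for m
    have sm: "summable (\<lambda>n. f (int_decode n))"
    proof (rule summable_comparison_test)
      show "summable (\<lambda>n. (3 ^ 2 * (K 0 + K 2)) * (1 / (1 + \<bar>real_of_int (int_decode n)\<bar>)\<^sup>2))"
        by (intro summable_mult norm_int_decode_summable)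
      have "norm (f m) \<le> (3 ^ 2 * (K 0 + K 2)) * (1 / (1 + \<bar>real_of_int m\<bar>)\<^sup>2)" for m
      proof -
        have "0 < (1 + \<bar>real_of_int m\<bar>)\<^sup>2" by (intro zero_less_power) auto
        moreover have "norm (f m) = norm (c s m)" by (simp add: f_def norm_mult)
        ultimately show ?thesis using decay[OF s, of m 2] by (simp add: le_divide_eq)
      qed
      then show "\<exists>N. \<forall>n\<ge>N. norm (f (int_decode n)) \<le> (3 ^ 2 * (K 0 + K 2)) * (1 / (1 + \<bar>real_of_int (int_decode n)\<bar>)\<^sup>2)"
        by blast
    qed
    define L where "L = (\<Sum>n. f (int_decode n))"
    have "(\<lambda>N. \<Sum>n<N. f (int_decode n)) \<longlonglongrightarrow> L"
      unfolding L_def using sm by (rule summable_LIMSEQ)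
    then have "(\<lambda>N. \<Sum>n<2 * N + 1. f (int_decode n)) \<longlonglongrightarrow> L"
    proof -
      have "strict_mono (\<lambda>N::nat. 2 * N + 1)" by (simp add: strict_mono_def)
      from LIMSEQ_subseq_LIMSEQ[OF \<open>(\<lambda>N. \<Sum>n<N. f (int_decode n)) \<longlonglongrightarrow> L\<close> this]
      show ?thesis unfolding o_def .
    qed
    then have "(\<lambda>N. \<Sum>m\<in>{- int N..int N}. f m) \<longlonglongrightarrow> L" by (simp only: sum_int_decode)
    then have ces: "(\<lambda>N. (\<Sum>T<N. \<Sum>m\<in>{- int T..int T}. f m) /\<^sub>R real N) \<longlonglongrightarrow> L" by (rule cesaro_limit)
    \<comment> \<open>The Cesaro means of the sampling series are Fejer integrals of this function,
      whose value at \<xi> is 1.\<close>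
    define \<eta> where "\<eta> x = of_real (D 0 x) * exp (- (\<i> * of_real (s * (x - \<xi>))))" for x
    have con\<eta> [continuous_intros]: "continuous_on {-pi..pi} \<eta>" unfolding \<eta>_def by (intro continuous_intros)
    have fint: "f m = integral {-pi..pi} (\<lambda>x. \<eta> x * exp (- (\<i> * of_real (of_int m * (x - \<xi>))))) / of_real (2 * pi)" for m
    proof -
      have "\<eta> x * exp (- (\<i> * of_real (of_int m * (x - \<xi>)))) =
         (of_real (D 0 x) * E (of_int m + s) x) * exp (\<i> * of_real ((of_int m + s) * \<xi>))" for x
        by (simp add: \<eta>_def E_def mult.assoc exp_add[symmetric]) (simp add: algebra_simps)
      then have "integral {-pi..pi} (\<lambda>x. \<eta> x * exp (- (\<i> * of_real (of_int m * (x - \<xi>))))) = J 0 (of_int m + s) * exp (\<i> * of_real ((of_int m + s) * \<xi>))"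
        unfolding J_def by simp
      then show ?thesis by (simp add: f_def c_def)
    qed
    have A: "(\<Sum>T<N. \<Sum>m\<in>{- int T..int T}. f m) /\<^sub>R real N = integral {-pi..pi} (\<lambda>x. \<eta> x * fejer N (x - \<xi>)) / of_real (2 * pi)" for N
    proof -
      have d: "integral {-pi..pi} (\<lambda>x. \<eta> x * dirichlet T (x - \<xi>)) =
          (\<Sum>m\<in>{- int T..int T}. integral {-pi..pi} (\<lambda>x. \<eta> x * exp (- (\<i> * of_real (of_int m * (x - \<xi>))))))" for T
        unfolding dirichlet_def sum_distrib_left
        by (rule integral_sum) (auto intro!: integrable_continuous_interval continuous_intros)
      have "integral {-pi..pi} (\<lambda>x. \<eta> x * (\<Sum>T<N. dirichlet T (x - \<xi>))) =
          (\<Sum>T<N. integral {-pi..pi} (\<lambda>x. \<eta> x * dirichlet T (x - \<xi>)))"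
        unfolding sum_distrib_left
        by (rule integral_sum) (auto intro!: integrable_continuous_interval continuous_intros)
      then have "(\<Sum>T<N. \<Sum>m\<in>{- int T..int T}. f m) = integral {-pi..pi} (\<lambda>x. \<eta> x * (\<Sum>T<N. dirichlet T (x - \<xi>))) / of_real (2 * pi)"
        unfolding fint sum_divide_distrib[symmetric] d by simp
      moreover have "integral {-pi..pi} (\<lambda>x. \<eta> x * fejer N (x - \<xi>)) =
          inverse (real N) *\<^sub>R integral {-pi..pi} (\<lambda>x. \<eta> x * (\<Sum>T<N. dirichlet T (x - \<xi>)))"
        unfolding fejer_def mult_scaleR_right by (rule integral_cmul)
      moreover have "(I / z) /\<^sub>R real N = (inverse (real N) *\<^sub>R I) / z" for I z :: complex
        by (simp add: scaleR_conv_of_real divide_inverse)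
      ultimately show ?thesis by (simp only:)
    qed
    have one: "integral {-pi..pi} (\<lambda>x. fejer N (x - \<xi>)) = of_real (2 * pi)" if "0 < N" for N
    proof -
      have d: "integral {-pi..pi} (\<lambda>x. dirichlet T (x - \<xi>)) = of_real (2 * pi)" for T
      proof -
        have "integral {-pi..pi} (\<lambda>x. dirichlet T (x - \<xi>)) =
            (\<Sum>m\<in>{- int T..int T}. integral {-pi..pi} (\<lambda>x. exp (- (\<i> * of_real (of_int m * (x - \<xi>))))))"
          unfolding dirichlet_def
          by (rule integral_sum) (auto intro!: integrable_continuous_interval continuous_intros)
        also have "\<dots> = (\<Sum>m\<in>{- int T..int T}. if m = 0 then of_real (2 * pi) else 0)"
          by (simp only: integral_exp_i_period)
        finally show ?thesis by simp
      qed
      have "integral {-pi..pi} (\<lambda>x. \<Sum>T<N. dirichlet T (x - \<xi>)) =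
          (\<Sum>T<N. integral {-pi..pi} (\<lambda>x. dirichlet T (x - \<xi>)))"
        by (rule integral_sum) (auto intro!: integrable_continuous_interval continuous_intros)
      then show ?thesis unfolding fejer_def d using that by (simp add: scaleR_conv_of_real)
    qed
    have "\<exists>L1. \<forall>x\<in>{-4..4}. norm (D 1 x) \<le> L1"
      using compact_imp_bounded[OF compact_continuous_image[OF cont4[of 1] compact_Icc]]
      unfolding bounded_iff by blast
    then obtain L1 where L1: "\<And>x. x \<in> {-4..4} \<Longrightarrow> norm (D 1 x) \<le> L1" by blast
    have \<eta>1: "norm (\<eta> x - 1) \<le> (L1 + 1) * \<bar>x - \<xi>\<bar>" if x: "x \<in> {-pi..pi}" for x
    proof -
      have "norm (D 0 x - D 0 \<xi>) \<le> L1 * norm (x - \<xi>)"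
        using D[of _ 0] L1 x xi sub
        by (intro field_differentiable_bound[of "{-4..4}" "D 0" "D 1"]) auto
      then have 1: "\<bar>D 0 x - 1\<bar> \<le> L1 * \<bar>x - \<xi>\<bar>"
        using D1[of \<xi>] xi by (simp add: abs_le_iff)
      have "\<eta> x - 1 = of_real (D 0 x - 1) * exp (- (\<i> * of_real (s * (x - \<xi>)))) + (exp (- (\<i> * of_real (s * (x - \<xi>)))) - 1)"
        by (simp add: \<eta>_def algebra_simps)
      then have "norm (\<eta> x - 1) \<le> norm (of_real (D 0 x - 1) * exp (- (\<i> * of_real (s * (x - \<xi>))))) + norm (exp (- (\<i> * of_real (s * (x - \<xi>)))) - 1)"
        by (metis norm_triangle_ineq)
      also have "\<dots> \<le> \<bar>D 0 x - 1\<bar> + \<bar>s * (x - \<xi>)\<bar>"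
        by (intro add_mono norm_exp_i_minus_1_le) (simp add: norm_mult del: of_real_diff)
      also have "\<bar>s * (x - \<xi>)\<bar> \<le> 1 * \<bar>x - \<xi>\<bar>" unfolding abs_mult using s by (intro mult_right_mono) auto
      finally show ?thesis using 1 by (simp add: distrib_right)
    qed
    obtain \<kappa> where \<kappa>: "0 < \<kappa>" "\<And>u. \<bar>u\<bar> \<le> pi + 2 \<Longrightarrow> \<kappa> * \<bar>u\<bar> \<le> norm (exp (- (\<i> * of_real u)) - 1)"
      using norm_exp_i_minus_1_ge by blast
    have L10: "0 \<le> L1" using L1[of 0] norm_ge_zero order_trans by fastforce
    \<comment> \<open>After subtraction of the limit value, the linear vanishing of \<eta> - 1 at
      \<xi> cancels the peak of the kernel, and dominated convergence applies.\<close>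
    have "(\<lambda>N. integral {-pi..pi} (\<lambda>x. (\<eta> x - 1) * fejer (Suc N) (x - \<xi>))) \<longlonglongrightarrow> integral {-pi..pi} (\<lambda>x. 0)"
    proof (rule dominated_convergence(2))
      show "(\<lambda>x. (\<eta> x - 1) * fejer (Suc N) (x - \<xi>)) integrable_on {-pi..pi}" for N
        by (intro integrable_continuous_interval continuous_intros)
      show "(\<lambda>x. (L1 + 1) * (2 / \<kappa>)) integrable_on {-pi..pi}" by (rule integrable_const_ivl)
      fix x assume x: "x \<in> {-pi..pi}"
      define u where "u = x - \<xi>"
      define z where "z = exp (- (\<i> * of_real u))"
      have "\<bar>u\<bar> \<le> pi + 2" using x xi unfolding u_def by auto
      then have \<kappa>u: "\<kappa> * \<bar>u\<bar> \<le> norm (z - 1)" unfolding z_def by (rule \<kappa>(2))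
      show "norm ((\<eta> x - 1) * fejer (Suc N) (x - \<xi>)) \<le> (L1 + 1) * (2 / \<kappa>)" for N
      proof -
        have "\<kappa> * \<bar>u\<bar> * norm (fejer (Suc N) u) \<le> norm (z - 1) * norm (fejer (Suc N) u)"
          using \<kappa>u by (rule mult_right_mono) simp
        also have "\<dots> \<le> 2" unfolding z_def by (rule fejer_bounds) simp
        finally have "\<bar>u\<bar> * norm (fejer (Suc N) u) \<le> 2 / \<kappa>"
          using \<kappa>(1) by (simp add: le_divide_eq mult_ac)
        then have "(L1 + 1) * (\<bar>u\<bar> * norm (fejer (Suc N) u)) \<le> (L1 + 1) * (2 / \<kappa>)"
          using L10 by (intro mult_left_mono) auto
        moreover have "norm (\<eta> x - 1) * norm (fejer (Suc N) u) \<le> ((L1 + 1) * \<bar>u\<bar>) * norm (fejer (Suc N) u)"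
          using \<eta>1[OF x] unfolding u_def by (rule mult_right_mono) simp
        ultimately show ?thesis by (simp add: norm_mult u_def mult.assoc)
      qed
      show "(\<lambda>N. (\<eta> x - 1) * fejer (Suc N) (x - \<xi>)) \<longlonglongrightarrow> 0"
      proof (cases "u = 0")
        case True
        then have "\<eta> x = 1" using \<eta>1[OF x] by (simp add: u_def)
        then show ?thesis by simp
      next
        case False
        have zpos: "0 < norm (z - 1)" using \<kappa>u \<kappa>(1) False by (smt (verit) mult_pos_pos zero_less_abs_iff)
        have "(\<lambda>N. fejer (Suc N) u) \<longlonglongrightarrow> 0"
        proof (rule Lim_null_comparison)
          have "norm (fejer (Suc N) u) \<le> (4 / (norm (z - 1))\<^sup>2) * inverse (real (Suc N))" for N
          proof -
            have "(norm (z - 1))\<^sup>2 * norm (fejer (Suc N) u) \<le> 4 / real (Suc N)"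
              unfolding z_def by (rule fejer_bounds) simp
            moreover have "0 < (norm (z - 1))\<^sup>2" using zpos by (rule zero_less_power)
            ultimately have "norm (fejer (Suc N) u) \<le> 4 / real (Suc N) / (norm (z - 1))\<^sup>2"
              by (simp only: pos_le_divide_eq mult.commute)
            then show ?thesis by (simp only: divide_inverse mult_ac)
          qed
          then show "\<forall>\<^sub>F N in sequentially. norm (fejer (Suc N) u) \<le> (4 / (norm (z - 1))\<^sup>2) * inverse (real (Suc N))"
            by simp
          show "(\<lambda>N. (4 / (norm (z - 1))\<^sup>2) * inverse (real (Suc N))) \<longlonglongrightarrow> 0"
            by (rule tendsto_mult_right_zero[OF LIMSEQ_inverse_real_of_nat])
        qed
        then show ?thesis unfolding u_def by (rule tendsto_mult_right_zero)
      qed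
    qed
    moreover have "integral {-pi..pi} (\<lambda>x. (\<eta> x - 1) * fejer (Suc N) (x - \<xi>)) =
        integral {-pi..pi} (\<lambda>x. \<eta> x * fejer (Suc N) (x - \<xi>)) - of_real (2 * pi)" for N
      unfolding left_diff_distrib mult_1 one[of "Suc N", OF zero_less_Suc, symmetric]
      by (rule Henstock_Kurzweil_Integration.integral_diff)
        (auto intro!: integrable_continuous_interval continuous_intros)
    ultimately have "(\<lambda>N. integral {-pi..pi} (\<lambda>x. \<eta> x * fejer (Suc N) (x - \<xi>)) - of_real (2 * pi)) \<longlonglongrightarrow> 0"
      by simp
    then have "(\<lambda>N. integral {-pi..pi} (\<lambda>x. \<eta> x * fejer (Suc N) (x - \<xi>))) \<longlonglongrightarrow> of_real (2 * pi)"
      by (simp add: LIM_zero_iff)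
    then have "(\<lambda>N. integral {-pi..pi} (\<lambda>x. \<eta> x * fejer (Suc N) (x - \<xi>)) / of_real (2 * pi)) \<longlonglongrightarrow> of_real (2 * pi) / of_real (2 * pi)"
      by (intro tendsto_divide) auto
    then have "(\<lambda>N. (\<Sum>T<Suc N. \<Sum>m\<in>{- int T..int T}. f m) /\<^sub>R real (Suc N)) \<longlonglongrightarrow> 1"
      unfolding A by simp
    moreover have "(\<lambda>N. (\<Sum>T<Suc N. \<Sum>m\<in>{- int T..int T}. f m) /\<^sub>R real (Suc N)) \<longlonglongrightarrow> L"
      using ces by (rule LIMSEQ_Suc)
    ultimately have "L = 1" using LIMSEQ_unique by blast
    then show ?thesis using summable_sums[OF sm] unfolding L_def f_def by simp
  qed
  ultimately show ?thesis by blast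
qed

subsection \<open>Injectivity of the Fourier transform\<close>

text \<open>Lebesgue measure is the image of a product of one-dimensional measures, for which
  integrals of products factorise.\<close>

lemma lborel_prod_complex:
  fixes f :: "'a::euclidean_space \<Rightarrow> real \<Rightarrow> complex"
  assumes f: "\<And>b. b \<in> Basis \<Longrightarrow> integrable lborel (f b)"
  shows "integrable lborel (\<lambda>x::'a. \<Prod>b\<in>Basis. f b (x \<bullet> b))"
    and "(integral\<^sup>L lborel (\<lambda>x::'a. (\<Prod>b\<in>Basis. f b (x \<bullet> b)))) = (\<Prod>b\<in>Basis. \<integral>t. f b t \<partial>lborel)"
proof -
  interpret product_sigma_finite "\<lambda>_::'a. lborel :: real measure" ..
  have [measurable]: "f b \<in> borel_measurable borel" if "b \<in> Basis" for b
    using borel_measurable_integrable[OF f[OF that]] by simp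
  have m: "(\<lambda>x::'a. \<Prod>b\<in>Basis. f b (x \<bullet> b)) \<in> borel_measurable borel"
    by measurable
  have S: "(\<lambda>f. \<Sum>b\<in>Basis. f b *\<^sub>R b) \<in> measurable (\<Pi>\<^sub>M b\<in>(Basis::'a set). (lborel::real measure)) (borel::'a measure)"
    by measurable
  have e: "(\<Prod>b\<in>Basis. f b ((\<Sum>c\<in>Basis. g c *\<^sub>R c) \<bullet> b)) = (\<Prod>b\<in>Basis. f b (g b))" for g :: "'a \<Rightarrow> real"
    by (intro prod.cong refl) simp
  show "integrable lborel (\<lambda>x::'a. \<Prod>b\<in>Basis. f b (x \<bullet> b))"
    unfolding lborel_eq[where 'a = 'a] integrable_distr_eq[OF S m] e
    by (intro product_integrable_prod f) auto
  show "(integral\<^sup>L lborel (\<lambda>x::'a. (\<Prod>b\<in>Basis. f b (x \<bullet> b)))) = (\<Prod>b\<in>Basis. \<integral>t. f b t \<partial>lborel)"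
    unfolding lborel_eq[where 'a = 'a] integral_distr[OF S m] e
    by (intro product_integral_prod f) auto
qed

lemma std_normal_fourier:
  "integrable lborel (\<lambda>\<xi>. complex_of_real (std_normal_density \<xi>) * exp (\<i> * of_real (t * \<xi>)))"
  "(\<integral>\<xi>. complex_of_real (std_normal_density \<xi>) * exp (\<i> * of_real (t * \<xi>)) \<partial>lborel) = of_real (exp (- t\<^sup>2 / 2))"
proof -
  have "integrable lborel (\<lambda>\<xi>. std_normal_density \<xi> *\<^sub>R exp (\<i> * of_real (t * \<xi>)) :: complex)"
    by (rule Bochner_Integration.integrable_bound[of _ std_normal_density])
      (auto intro: integrable_normal_density)
  then show "integrable lborel (\<lambda>\<xi>. complex_of_real (std_normal_density \<xi>) * exp (\<i> * of_real (t * \<xi>)))"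
    by (simp add: scaleR_conv_of_real)
  have "char std_normal_distribution t = (\<integral>\<xi>. std_normal_density \<xi> *\<^sub>R exp (\<i> * of_real (t * \<xi>)) \<partial>lborel)"
    unfolding char_def by (subst integral_density) auto
  then show "(\<integral>\<xi>. complex_of_real (std_normal_density \<xi>) * exp (\<i> * of_real (t * \<xi>)) \<partial>lborel) = of_real (exp (- t\<^sup>2 / 2))"
    unfolding char_std_normal_distribution by (simp add: scaleR_conv_of_real)
qed

text \<open>The standard normal density, kept as a product so that its Fourier transform reduces to
  one dimension.\<close>

definition gauss_weight :: "'a::euclidean_space \<Rightarrow> real" where
  "gauss_weight x = (\<Prod>b\<in>Basis. std_normal_density (x \<bullet> b))"

lemma gauss_weight_measurable [measurable]: "gauss_weight \<in> borel_measurable borel"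
  unfolding gauss_weight_def[abs_def] by measurable

lemma gauss_weight_pos: "0 < gauss_weight x"
  unfolding gauss_weight_def by (intro prod_pos) (auto intro!: normal_density_pos)

lemma gauss_weight_fourier:
  fixes x :: "'a::euclidean_space"
  shows "integrable lborel (\<lambda>\<xi>::'a. complex_of_real (gauss_weight \<xi>) * exp (\<i> * of_real (x \<bullet> \<xi>)))"
    and "(integral\<^sup>L lborel (\<lambda>\<xi>::'a. complex_of_real (gauss_weight \<xi>) * exp (\<i> * of_real (x \<bullet> \<xi>)))) = of_real (exp (- (norm x)\<^sup>2 / 2))"
proof -
  have e: "complex_of_real (gauss_weight \<xi>) * exp (\<i> * of_real (x \<bullet> \<xi>)) =
      (\<Prod>b\<in>Basis. complex_of_real (std_normal_density (\<xi> \<bullet> b)) * exp (\<i> * of_real ((x \<bullet> b) * (\<xi> \<bullet> b))))" for \<xi> :: 'a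
    unfolding gauss_weight_def euclidean_inner[of x \<xi>]
    by (simp add: prod.distrib exp_sum[symmetric] sum_distrib_left)
  show "integrable lborel (\<lambda>\<xi>::'a. complex_of_real (gauss_weight \<xi>) * exp (\<i> * of_real (x \<bullet> \<xi>)))"
    unfolding e by (intro lborel_prod_complex(1) std_normal_fourier)
  have "(\<Sum>b\<in>Basis. - (x \<bullet> b)\<^sup>2 / 2) = - (norm x)\<^sup>2 / 2"
    unfolding power2_norm_eq_inner euclidean_inner[of x x]
    by (simp add: sum_negf sum_divide_distrib power2_eq_square)
  then have "(\<Prod>b\<in>(Basis::'a set). complex_of_real (exp (- (x \<bullet> b)\<^sup>2 / 2))) = of_real (exp (- (norm x)\<^sup>2 / 2))"
    by (simp only: of_real_prod[symmetric] exp_sum[symmetric] finite_Basis)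
  then show "(integral\<^sup>L lborel (\<lambda>\<xi>::'a. complex_of_real (gauss_weight \<xi>) * exp (\<i> * of_real (x \<bullet> \<xi>)))) = of_real (exp (- (norm x)\<^sup>2 / 2))"
    unfolding e lborel_prod_complex(2)[OF std_normal_fourier(1)] std_normal_fourier(2) .
qed

lemma gauss_weight_eq: "gauss_weight (x::'a::euclidean_space) = exp (- (norm x)\<^sup>2 / 2) / sqrt (2 * pi) ^ DIM('a)"
proof -
  have "(\<Sum>b\<in>Basis. - (x \<bullet> b)\<^sup>2 / 2) = - (norm x)\<^sup>2 / 2"
    unfolding power2_norm_eq_inner euclidean_inner[of x x]
    by (simp add: sum_negf sum_divide_distrib power2_eq_square)
  then have "(\<Prod>b\<in>(Basis::'a set). exp (- (x \<bullet> b)\<^sup>2 / 2)) = exp (- (norm x)\<^sup>2 / 2)"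
    by (simp only: exp_sum[symmetric] finite_Basis)
  moreover have "gauss_weight x = (1 / sqrt (2 * pi)) ^ DIM('a) * (\<Prod>b\<in>(Basis::'a set). exp (- (x \<bullet> b)\<^sup>2 / 2))"
    by (simp only: gauss_weight_def std_normal_density_def prod.distrib prod_constant)
  ultimately show ?thesis by (simp only: power_divide power_one times_divide_eq_left mult_1)
qed

lemma integrable_gauss_weight: "integrable lborel (gauss_weight :: 'a::euclidean_space \<Rightarrow> real)"
  using integrable_norm[OF gauss_weight_fourier(1)[of "0::'a"]]
  by (simp add: abs_of_pos gauss_weight_pos)

lemma lborel_integral_affine:
  fixes f :: "'a::euclidean_space \<Rightarrow> 'b::{banach, second_countable_topology}"
  assumes c: "c \<noteq> 0" and [measurable]: "f \<in> borel_measurable borel"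
  shows "(\<integral>x. f x \<partial>lborel) = \<bar>c\<bar> ^ DIM('a) *\<^sub>R (\<integral>x. f (t + c *\<^sub>R x) \<partial>lborel)"
proof -
  have "(\<integral>x. f x \<partial>lborel) = (\<integral>x. f x \<partial>density (distr lborel borel (\<lambda>x. t + c *\<^sub>R x)) (\<lambda>_. ennreal (\<bar>c\<bar> ^ DIM('a))))"
    using lborel_affine[OF c, of t] by simp
  also have "\<dots> = (\<integral>x. \<bar>c\<bar> ^ DIM('a) *\<^sub>R f x \<partial>distr lborel borel (\<lambda>x. t + c *\<^sub>R x))"
    by (rule integral_density) auto
  also have "\<dots> = (\<integral>x. \<bar>c\<bar> ^ DIM('a) *\<^sub>R f (t + c *\<^sub>R x) \<partial>lborel)"
    by (rule integral_distr) auto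
  finally show ?thesis by simp
qed

lemma lborel_integrable_affine:
  fixes f :: "'a::euclidean_space \<Rightarrow> 'b::{banach, second_countable_topology}"
  assumes c: "c \<noteq> 0" and f: "integrable lborel f"
  shows "integrable lborel (\<lambda>x. f (t + c *\<^sub>R x))"
proof -
  have [measurable]: "f \<in> borel_measurable borel" using f by auto
  have "integrable (density (distr lborel borel (\<lambda>x. t + c *\<^sub>R x)) (\<lambda>_. ennreal (\<bar>c\<bar> ^ DIM('a)))) f"
    using f lborel_affine[OF c, of t] by simp
  then have "integrable (distr lborel borel (\<lambda>x. t + c *\<^sub>R x)) (\<lambda>x. \<bar>c\<bar> ^ DIM('a) *\<^sub>R f x)"
    by (subst (asm) integrable_density) auto
  then have "integrable lborel (\<lambda>x. \<bar>c\<bar> ^ DIM('a) *\<^sub>R f (t + c *\<^sub>R x))"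
    by (subst (asm) integrable_distr_eq) auto
  then have "integrable lborel (\<lambda>x. inverse (\<bar>c\<bar> ^ DIM('a)) *\<^sub>R (\<bar>c\<bar> ^ DIM('a) *\<^sub>R f (t + c *\<^sub>R x)))"
    by (rule integrable_scaleR_right)
  then show ?thesis using c by simp
qed

text \<open>Integrating the vanishing transform against a Gaussian shows that all Gaussian means of
  \<open>g\<close> vanish; they converge to \<open>g\<close>.\<close>

lemma fourier_injective:
  fixes g :: "'a::euclidean_space \<Rightarrow> complex"
  assumes cont: "continuous_on UNIV g" and bdd: "\<And>x. norm (g x) \<le> K" and int: "integrable lborel g"
    and zero: "\<And>\<xi>. (\<integral>y. exp (- \<i> * of_real (y \<bullet> \<xi>)) * g y \<partial>lborel) = 0"
  shows "g x0 = 0"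
proof -
  have [measurable]: "g \<in> borel_measurable borel" using cont by (rule borel_measurable_continuous_onI)
  have mean0: "(\<integral>z. complex_of_real (exp (- (norm z)\<^sup>2 / 2)) * g (x0 + e *\<^sub>R z) \<partial>lborel) = 0" if e: "0 < e" for e
  proof -
    define W where "W \<xi> = complex_of_real (gauss_weight \<xi>)" for \<xi> :: 'a
    have [measurable]: "W \<in> borel_measurable borel" unfolding W_def by measurable
    \<comment> \<open>Integrated in y first, this contains the transform of g at \<xi>/e and
      vanishes. Integrated in \<xi> first, it is g times a Gaussian of width e centred at
      x0.\<close>
    define F where "F \<xi> y = W \<xi> * exp (\<i> * of_real (((x0 - y) /\<^sub>R e) \<bullet> \<xi>)) * g y" for \<xi> y
    have normF: "norm (F \<xi> y) = gauss_weight \<xi> * norm (g y)" for \<xi> y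
      using gauss_weight_pos[of \<xi>] by (simp add: F_def W_def norm_mult)
    have Fm [measurable]: "(\<lambda>(\<xi>, y). F \<xi> y) \<in> borel_measurable (lborel \<Otimes>\<^sub>M lborel)"
      unfolding F_def by measurable
    have Fi: "integrable (lborel \<Otimes>\<^sub>M lborel) (\<lambda>(\<xi>, y). F \<xi> y)"
    proof (rule lborel_pair.Fubini_integrable)
      show "integrable lborel (\<lambda>\<xi>. \<integral>y. norm (case (\<xi>, y) of (\<xi>, y) \<Rightarrow> F \<xi> y) \<partial>lborel)"
        by (simp add: normF integrable_gauss_weight)
      have "integrable lborel (F \<xi>)" for \<xi>
      proof (rule Bochner_Integration.integrable_bound)
        show "integrable lborel (\<lambda>y. gauss_weight \<xi> * norm (g y))" using int by simp
        show "F \<xi> \<in> borel_measurable lborel" unfolding F_def by measurable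
      qed (use gauss_weight_pos[of \<xi>] in \<open>auto simp: normF abs_mult\<close>)
      then show "AE \<xi> in lborel. integrable lborel (\<lambda>y. case (\<xi>, y) of (\<xi>, y) \<Rightarrow> F \<xi> y)" by simp
    qed simp
    have y0: "(\<integral>y. F \<xi> y \<partial>lborel) = 0" for \<xi>
    proof -
      have "F \<xi> y = (W \<xi> * exp (\<i> * of_real ((x0 /\<^sub>R e) \<bullet> \<xi>))) * (exp (- \<i> * of_real (y \<bullet> (\<xi> /\<^sub>R e))) * g y)" for y
        by (simp add: F_def inner_diff_left right_diff_distrib exp_diff exp_minus divide_inverse mult_ac)
      then have "(\<integral>y. F \<xi> y \<partial>lborel) = (W \<xi> * exp (\<i> * of_real ((x0 /\<^sub>R e) \<bullet> \<xi>))) * (\<integral>y. exp (- \<i> * of_real (y \<bullet> (\<xi> /\<^sub>R e))) * g y \<partial>lborel)"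
        by simp
      then show ?thesis using zero[of "\<xi> /\<^sub>R e"] by simp
    qed
    have xi: "(\<integral>\<xi>. F \<xi> y \<partial>lborel) = of_real (exp (- (norm ((x0 - y) /\<^sub>R e))\<^sup>2 / 2)) * g y" for y
      unfolding F_def W_def using gauss_weight_fourier(2)[of "(x0 - y) /\<^sub>R e"] by simp
    have "(\<integral>y. (\<integral>\<xi>. F \<xi> y \<partial>lborel) \<partial>lborel) = (\<integral>\<xi>. (\<integral>y. F \<xi> y \<partial>lborel) \<partial>lborel)"
      using lborel_pair.Fubini_integral[OF Fi] by simp
    then have "(\<integral>y. complex_of_real (exp (- (norm ((x0 - y) /\<^sub>R e))\<^sup>2 / 2)) * g y \<partial>lborel) = 0"
      unfolding y0 xi by simp
    moreover have "(\<integral>y. complex_of_real (exp (- (norm ((x0 - y) /\<^sub>R e))\<^sup>2 / 2)) * g y \<partial>lborel) =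
      \<bar>e\<bar> ^ DIM('a) *\<^sub>R (\<integral>z. complex_of_real (exp (- (norm ((x0 - (x0 + e *\<^sub>R z)) /\<^sub>R e))\<^sup>2 / 2)) * g (x0 + e *\<^sub>R z) \<partial>lborel)"
      using e by (intro lborel_integral_affine) auto
    ultimately show ?thesis using e by simp
  qed
  define G where "G z = exp (- (norm z)\<^sup>2 / 2)" for z :: 'a
  have GW: "G z = sqrt (2 * pi) ^ DIM('a) * gauss_weight z" for z :: 'a
    by (simp add: gauss_weight_eq G_def)
  have Gi: "integrable lborel G" unfolding GW by (intro integrable_mult_right integrable_gauss_weight)
  have Gm [measurable]: "G \<in> borel_measurable borel" using Gi by auto
  \<comment> \<open>The Gaussians shrink with widths 1/(n + 1); continuity of g at x0 gives the
    limit and boundedness of g the majorant.\<close>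
  have "(\<lambda>n. \<integral>z. complex_of_real (G z) * g (x0 + inverse (real (Suc n)) *\<^sub>R z) \<partial>lborel) \<longlonglongrightarrow> (\<integral>z. complex_of_real (G z) * g x0 \<partial>lborel)"
  proof (rule integral_dominated_convergence)
    show "integrable lborel (\<lambda>z. G z * K)" using Gi by simp
    show "AE z in lborel. norm (complex_of_real (G z) * g (x0 + inverse (real (Suc n)) *\<^sub>R z)) \<le> G z * K" for n
      using bdd by (auto simp: norm_mult G_def intro!: mult_left_mono)
    show "AE z in lborel. (\<lambda>n. complex_of_real (G z) * g (x0 + inverse (real (Suc n)) *\<^sub>R z)) \<longlonglongrightarrow> complex_of_real (G z) * g x0"
    proof (intro AE_I2 tendsto_mult tendsto_const)
      fix z
      have "(\<lambda>n. x0 + inverse (real (Suc n)) *\<^sub>R z) \<longlonglongrightarrow> x0 + 0 *\<^sub>R z"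
        by (intro tendsto_intros LIMSEQ_inverse_real_of_nat)
      moreover have "isCont g x0" using cont by (simp add: continuous_on_eq_continuous_at)
      ultimately show "(\<lambda>n. g (x0 + inverse (real (Suc n)) *\<^sub>R z)) \<longlonglongrightarrow> g x0"
        by (intro isCont_tendsto_compose[of x0 g]) auto
    qed
  qed measurable
  moreover have "(\<integral>z. complex_of_real (G z) * g (x0 + inverse (real (Suc n)) *\<^sub>R z) \<partial>lborel) = 0" for n
    using mean0[of "inverse (real (Suc n))"] by (simp add: G_def del: of_nat_Suc)
  ultimately have "(\<integral>z. complex_of_real (G z) * g x0 \<partial>lborel) = 0"
    by (simp add: LIMSEQ_const_iff)
  moreover have "(\<integral>z. complex_of_real (G z) * g x0 \<partial>lborel) = complex_of_real (\<integral>z. G z \<partial>lborel) * g x0" by simp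
  moreover have "(integral\<^sup>L lborel (\<lambda>z::'a. G z)) \<noteq> 0"
  proof -
    have "complex_of_real (integral\<^sup>L lborel (\<lambda>z::'a. G z)) = of_real (sqrt (2 * pi) ^ DIM('a)) * (integral\<^sup>L lborel (\<lambda>z::'a. complex_of_real (gauss_weight z)))"
      unfolding GW by simp
    also have "(integral\<^sup>L lborel (\<lambda>z::'a. complex_of_real (gauss_weight z))) = 1"
      using gauss_weight_fourier(2)[of "0::'a"] by simp
    finally show ?thesis by (metis mult_1_right of_real_0 of_real_eq_0_iff pi_neq_zero power_not_zero real_sqrt_eq_zero_cancel_iff mult_eq_0_iff zero_neq_numeral)
  qed
  ultimately show ?thesis by simp
qed

subsection \<open>Schwartz functions and tempered distributions\<close>

lemma partial_deriv_eq:
  assumes "(f has_derivative f') (at x)"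
  shows "partial_deriv j f x = f' (axis j 1)"
proof -
  have "((\<lambda>t. f (x + t *\<^sub>R axis j 1)) has_derivative (\<lambda>h. f' (h *\<^sub>R axis j 1))) (at 0)"
  proof (rule has_derivative_compose[of "\<lambda>t. x + t *\<^sub>R axis j 1" "\<lambda>h. h *\<^sub>R axis j 1", where g = f])
    show "((\<lambda>t. x + t *\<^sub>R axis j 1) has_derivative (\<lambda>h. h *\<^sub>R axis j 1)) (at 0)"
      by (auto intro!: derivative_eq_intros)
    show "(f has_derivative f') (at (x + 0 *\<^sub>R axis j 1))" using assms by simp
  qed
  then have "((\<lambda>t. f (x + t *\<^sub>R axis j 1)) has_vector_derivative f' (axis j 1)) (at 0)"
    using has_derivative_linear[OF assms] by (simp add: has_vector_derivative_def linear_cmul)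
  then show ?thesis unfolding partial_deriv_def by (rule vector_derivative_at)
qed

lemma partial_deriv_has_derivative:
  assumes "f differentiable at (x + t *\<^sub>R axis j 1)"
  shows "((\<lambda>t. f (x + t *\<^sub>R axis j 1)) has_derivative (\<lambda>h. h *\<^sub>R partial_deriv j f (x + t *\<^sub>R axis j 1))) (at t)"
proof -
  obtain f' where f': "(f has_derivative f') (at (x + t *\<^sub>R axis j 1))"
    using assms by (auto simp: differentiable_def)
  have "((\<lambda>t. f (x + t *\<^sub>R axis j 1)) has_derivative (\<lambda>h. f' (h *\<^sub>R axis j 1))) (at t)"
    by (rule has_derivative_compose[of "\<lambda>t. x + t *\<^sub>R axis j 1" "\<lambda>h. h *\<^sub>R axis j 1", where g = f, OF _ f'])
      (auto intro!: derivative_eq_intros)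
  then show ?thesis
    using has_derivative_linear[OF f'] by (simp add: partial_deriv_eq[OF f'] linear_cmul)
qed

lemma iter_deriv_Nil [simp]: "iter_deriv [] f = f"
  by (simp add: iter_deriv_def)

lemma iter_deriv_Cons [simp]: "iter_deriv (i # is) f = partial_deriv i (iter_deriv is f)"
  by (simp add: iter_deriv_def)

lemma smooth_differentiable: "smooth f \<Longrightarrow> iter_deriv is f differentiable at x"
  by (simp add: smooth_def differentiable_on_eq_differentiable_at)

text \<open>Covers both the dilations that define the Littlewood-Paley kernels and the reflections y
  \<mapsto> x - y in \<open>conv_distr\<close>.\<close>

lemma iter_deriv_affine:
  assumes "smooth f"
  shows "iter_deriv is (\<lambda>y. a * f (v + b *\<^sub>R y)) = (\<lambda>y. a * of_real b ^ length is * iter_deriv is f (v + b *\<^sub>R y))"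
proof (induction "is")
  case (Cons i "is")
  show ?case
  proof
    fix y
    obtain D where D: "(iter_deriv is f has_derivative D) (at (v + b *\<^sub>R y))"
      using smooth_differentiable[OF assms] by (auto simp: differentiable_def)
    have "((\<lambda>y. iter_deriv is f (v + b *\<^sub>R y)) has_derivative (\<lambda>h. D (b *\<^sub>R h))) (at y)"
      by (rule has_derivative_compose[of "\<lambda>y. v + b *\<^sub>R y" "\<lambda>h. b *\<^sub>R h", OF _ D])
        (auto intro!: derivative_eq_intros)
    then have "((\<lambda>y. a * of_real b ^ length is * iter_deriv is f (v + b *\<^sub>R y)) has_derivative
        (\<lambda>h. a * of_real b ^ length is * D (b *\<^sub>R h))) (at y)"
      by (rule has_derivative_mult_right)
    then have "iter_deriv (i # is) (\<lambda>y. a * f (v + b *\<^sub>R y)) y = a * of_real b ^ length is * D (b *\<^sub>R axis i 1)"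
      unfolding iter_deriv_Cons Cons by (rule partial_deriv_eq)
    also have "D (b *\<^sub>R axis i 1) = b *\<^sub>R D (axis i 1)"
      by (rule linear_cmul[OF has_derivative_linear[OF D]])
    also have "\<dots> = of_real b * D (axis i 1)"
      by (rule scaleR_conv_of_real)
    also have "D (axis i 1) = iter_deriv (i # is) f (v + b *\<^sub>R y)"
      unfolding iter_deriv_Cons by (rule partial_deriv_eq[OF D, symmetric])
    finally show "iter_deriv (i # is) (\<lambda>y. a * f (v + b *\<^sub>R y)) y = a * of_real b ^ length (i # is) * iter_deriv (i # is) f (v + b *\<^sub>R y)"
      by (simp only: length_Cons power_Suc mult_ac)
  qed
qed simp

lemma iter_deriv_add:
  assumes "smooth f" "smooth g"
  shows "iter_deriv is (\<lambda>y. f y + c * g y) = (\<lambda>y. iter_deriv is f y + c * iter_deriv is g y)"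
proof (induction "is")
  case (Cons i "is")
  show ?case
  proof
    fix y
    obtain D E where D: "(iter_deriv is f has_derivative D) (at y)" and E: "(iter_deriv is g has_derivative E) (at y)"
      using smooth_differentiable assms by (metis differentiable_def)
    have "((\<lambda>y. iter_deriv is f y + c * iter_deriv is g y) has_derivative (\<lambda>h. D h + c * E h)) (at y)"
      by (intro has_derivative_add has_derivative_mult_right D E)
    then show "iter_deriv (i # is) (\<lambda>y. f y + c * g y) y = iter_deriv (i # is) f y + c * iter_deriv (i # is) g y"
      by (simp add: Cons partial_deriv_eq partial_deriv_eq[OF D] partial_deriv_eq[OF E])
  qed
qed simp

lemma schwartz_smooth: "f \<in> schwartz \<Longrightarrow> smooth f"
  by (simp add: schwartz_def)

lemma schwartz_bounded:
  assumes "f \<in> schwartz"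
  shows "\<exists>C\<ge>0. \<forall>x. (1 + norm x) ^ m * norm (iter_deriv is f x) \<le> C"
proof -
  obtain C where "\<And>x. (1 + norm x) ^ m * norm (iter_deriv is f x) \<le> C"
    using assms unfolding schwartz_def bdd_above_def by blast
  then show ?thesis by (intro exI[of _ "max 0 C"]) (auto simp: le_max_iff_disj)
qed

lemma schwartzI:
  assumes "smooth f" "\<And>m is. \<exists>C. \<forall>x. (1 + norm x) ^ m * norm (iter_deriv is f x) \<le> C"
  shows "f \<in> schwartz"
  using assms unfolding schwartz_def bdd_above_def by blast

text \<open>The scalar makes sums, multiples and differences instances of one closure
  property.\<close>

lemma schwartz_add:
  assumes "f \<in> schwartz" "g \<in> schwartz"
  shows "(\<lambda>y. f y + c * g y) \<in> schwartz"
proof (rule schwartzI)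
  note e = iter_deriv_add[OF schwartz_smooth[OF assms(1)] schwartz_smooth[OF assms(2)]]
  show "smooth (\<lambda>y. f y + c * g y)"
    unfolding smooth_def e using assms[THEN schwartz_smooth]
    by (auto simp: smooth_def intro!: differentiable_on_add differentiable_on_mult differentiable_on_const)
  fix m "is"
  obtain A where A: "\<And>x. (1 + norm x) ^ m * norm (iter_deriv is f x) \<le> A" using schwartz_bounded[OF assms(1)] by blast
  obtain B where B: "\<And>x. (1 + norm x) ^ m * norm (iter_deriv is g x) \<le> B" using schwartz_bounded[OF assms(2)] by blast
  have "(1 + norm x) ^ m * norm (iter_deriv is f x + c * iter_deriv is g x) \<le> A + norm c * B" for x
  proof -
    have "(1 + norm x) ^ m * norm (iter_deriv is f x + c * iter_deriv is g x) \<le>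
      (1 + norm x) ^ m * (norm (iter_deriv is f x) + norm c * norm (iter_deriv is g x))"
      by (intro mult_left_mono order_trans[OF norm_triangle_ineq]) (auto simp: norm_mult)
    also have "\<dots> = (1 + norm x) ^ m * norm (iter_deriv is f x) + norm c * ((1 + norm x) ^ m * norm (iter_deriv is g x))"
      by (simp add: algebra_simps)
    also have "\<dots> \<le> A + norm c * B" by (intro add_mono mult_left_mono A B) auto
    finally show ?thesis .
  qed
  then show "\<exists>C. \<forall>x. (1 + norm x) ^ m * norm (iter_deriv is (\<lambda>y. f y + c * g y) x) \<le> C"
    unfolding e by blast
qed

lemma schwartz_0: "(\<lambda>y. 0) \<in> schwartz"
proof -
  have "iter_deriv is (\<lambda>y. 0) = (\<lambda>y. 0)" for "is" :: "'a::finite list"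
    by (induction "is") (auto simp: partial_deriv_def vector_derivative_const_at)
  then show ?thesis by (intro schwartzI) (auto simp: smooth_def intro!: exI[of _ 0])
qed

lemma schwartz_diff:
  "f \<in> schwartz \<Longrightarrow> g \<in> schwartz \<Longrightarrow> (\<lambda>y. f y - g y) \<in> schwartz"
  using schwartz_add[of f g "-1"] by simp

lemma iter_deriv_diff:
  assumes "smooth f" "smooth g"
  shows "iter_deriv is (\<lambda>y. f y - g y) = (\<lambda>y. iter_deriv is f y - iter_deriv is g y)"
  using iter_deriv_add[OF assms, of "is" "-1"] by simp

text \<open>Lets the polynomial weights of the Schwartz seminorms survive an affine change of
  variables.\<close>

lemma one_plus_norm_affine:
  fixes y v :: "'a::real_normed_vector"
  assumes "b \<noteq> 0"
  shows "1 + norm y \<le> (1 + (1 + norm v) / \<bar>b\<bar>) * (1 + norm (v + b *\<^sub>R y))"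
proof -
  have "\<bar>b\<bar> * norm y = norm ((v + b *\<^sub>R y) - v)" by simp
  also have "\<dots> \<le> norm (v + b *\<^sub>R y) + norm v" by (rule norm_triangle_ineq4)
  finally have "norm y \<le> (norm (v + b *\<^sub>R y) + norm v) / \<bar>b\<bar>"
    using assms by (simp add: le_divide_eq mult.commute)
  also have "\<dots> \<le> (1 + norm v) * (1 + norm (v + b *\<^sub>R y)) / \<bar>b\<bar>"
    by (intro divide_right_mono) (auto simp: algebra_simps)
  finally have "1 + norm y \<le> 1 * 1 + (1 + norm v) / \<bar>b\<bar> * (1 + norm (v + b *\<^sub>R y))" by simp
  also have "\<dots> \<le> 1 * (1 + norm (v + b *\<^sub>R y)) + (1 + norm v) / \<bar>b\<bar> * (1 + norm (v + b *\<^sub>R y))"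
    by (intro add_mono mult_left_mono) auto
  finally show ?thesis by (simp add: distrib_right)
qed

lemma schwartz_affine:
  assumes f: "f \<in> schwartz" and b: "b \<noteq> 0"
  shows "(\<lambda>y. a * f (v + b *\<^sub>R y)) \<in> schwartz"
proof (rule schwartzI)
  note e = iter_deriv_affine[OF schwartz_smooth[OF f]]
  show "smooth (\<lambda>y. a * f (v + b *\<^sub>R y))"
    unfolding smooth_def e differentiable_on_eq_differentiable_at[OF open_UNIV]
  proof (intro allI ballI)
    fix "is" y
    have "(iter_deriv is f \<circ> (\<lambda>y. v + b *\<^sub>R y)) differentiable at y"
      by (intro differentiable_chain_at smooth_differentiable schwartz_smooth f) auto
    then show "(\<lambda>y. a * of_real b ^ length is * iter_deriv is f (v + b *\<^sub>R y)) differentiable at y"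
      by (intro differentiable_mult) (auto simp: o_def)
  qed
  fix m "is"
  obtain C where C: "\<And>x. (1 + norm x) ^ m * norm (iter_deriv is f x) \<le> C" "0 \<le> C" using schwartz_bounded[OF f] by blast
  define K where "K = 1 + (1 + norm v) / \<bar>b\<bar>"
  have K: "0 \<le> K" by (simp add: K_def)
  have "(1 + norm y) ^ m * norm (a * of_real b ^ length is * iter_deriv is f (v + b *\<^sub>R y)) \<le>
      norm (a * of_real b ^ length is) * (K ^ m * C)" for y
  proof -
    have "(1 + norm y) ^ m \<le> (K * (1 + norm (v + b *\<^sub>R y))) ^ m"
      unfolding K_def by (intro power_mono one_plus_norm_affine b) auto
    then have "(1 + norm y) ^ m * norm (iter_deriv is f (v + b *\<^sub>R y)) \<le>
        K ^ m * ((1 + norm (v + b *\<^sub>R y)) ^ m * norm (iter_deriv is f (v + b *\<^sub>R y)))"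
      by (subst mult.assoc[symmetric]) (intro mult_right_mono, auto simp: power_mult_distrib)
    also have "\<dots> \<le> K ^ m * C" using K by (intro mult_left_mono C) auto
    finally have "norm (a * of_real b ^ length is) * ((1 + norm y) ^ m * norm (iter_deriv is f (v + b *\<^sub>R y))) \<le>
      norm (a * of_real b ^ length is) * (K ^ m * C)"
      by (intro mult_left_mono) auto
    then show ?thesis by (simp only: norm_mult mult_ac)
  qed
  then show "\<exists>C. \<forall>x. (1 + norm x) ^ m * norm (iter_deriv is (\<lambda>y. a * f (v + b *\<^sub>R y)) x) \<le> C"
    unfolding e by blast
qed

section \<open>Seminorms and sequential use of the Schwartz topology\<close>

lemma schwartz_seminorm_le:
  "(\<And>x. (1 + norm x) ^ m * norm (iter_deriv is f x) \<le> B) \<Longrightarrow> schwartz_seminorm m is f \<le> B"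
  unfolding schwartz_seminorm_def by (intro cSUP_least) auto

lemma schwartz_seminorm_ge:
  "f \<in> schwartz \<Longrightarrow> (1 + norm x) ^ m * norm (iter_deriv is f x) \<le> schwartz_seminorm m is f"
  unfolding schwartz_seminorm_def by (intro cSUP_upper) (auto simp: schwartz_def)

lemma schwartz_seminorm_nonneg: "f \<in> schwartz \<Longrightarrow> 0 \<le> schwartz_seminorm m is f"
  by (rule order_trans[OF _ schwartz_seminorm_ge[where x = 0]]) auto

lemma schwartz_seminorm_triangle:
  assumes "f \<in> schwartz" "g \<in> schwartz" "h \<in> schwartz"
  shows "schwartz_seminorm m is (\<lambda>x. h x - f x) \<le> schwartz_seminorm m is (\<lambda>x. h x - g x) + schwartz_seminorm m is (\<lambda>x. g x - f x)"
proof (rule schwartz_seminorm_le)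
  fix x
  have "norm (iter_deriv is (\<lambda>x. h x - f x) x) \<le>
     norm (iter_deriv is (\<lambda>x. h x - g x) x) + norm (iter_deriv is (\<lambda>x. g x - f x) x)"
    unfolding iter_deriv_diff[OF assms(3,1)[THEN schwartz_smooth]] iter_deriv_diff[OF assms(3,2)[THEN schwartz_smooth]]
      iter_deriv_diff[OF assms(2,1)[THEN schwartz_smooth]]
    using norm_triangle_ineq[of "iter_deriv is h x - iter_deriv is g x" "iter_deriv is g x - iter_deriv is f x"] by simp
  then have "(1 + norm x) ^ m * norm (iter_deriv is (\<lambda>x. h x - f x) x) \<le>
     (1 + norm x) ^ m * (norm (iter_deriv is (\<lambda>x. h x - g x) x) + norm (iter_deriv is (\<lambda>x. g x - f x) x))"
    by (intro mult_left_mono) auto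
  also have "\<dots> \<le> schwartz_seminorm m is (\<lambda>x. h x - g x) + schwartz_seminorm m is (\<lambda>x. g x - f x)"
    unfolding distrib_left by (intro add_mono schwartz_seminorm_ge schwartz_diff assms)
  finally show "(1 + norm x) ^ m * norm (iter_deriv is (\<lambda>x. h x - f x) x) \<le> \<dots>" .
qed

text \<open>The preimage under u of a neighbourhood of \<open>u g\<close> is generated by seminorm
  balls, and induction over this generation shows that it eventually contains \<open>G n\<close>.
  The balls may be centred away from \<open>g\<close>, hence the triangle inequality.\<close>

lemma tempered_tendsto:
  fixes u :: "'n::finite functional"
  assumes u: "u \<in> tempered_distributions" and G: "\<And>n. G n \<in> schwartz" and g: "g \<in> schwartz"
    and lim: "\<And>m is. ((\<lambda>n. schwartz_seminorm m is (\<lambda>x. G n x - g x)) \<longlongrightarrow> 0) F"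
  shows "((\<lambda>n. u (G n)) \<longlongrightarrow> u g) F"
proof (rule topological_tendstoI)
  fix V assume V: "open V" "u g \<in> V"
  define B :: "'n cfun set set" where "B = {{g \<in> schwartz. schwartz_seminorm m is (\<lambda>x. g x - f x) < e} | f m is e. f \<in> schwartz \<and> 0 < e}"
  \<comment> \<open>The space underlying the topology is the union of the generating balls, so
    \<open>g\<close> has to be exhibited in one of them.\<close>
  have gB: "g \<in> \<Union> B"
  proof -
    have "schwartz_seminorm 0 [] (\<lambda>x. g x - g x) \<le> 0" by (rule schwartz_seminorm_le) simp
    then have "g \<in> {h \<in> schwartz. schwartz_seminorm 0 [] (\<lambda>x. h x - g x) < 1}" using g by simp
    moreover have "{h \<in> schwartz. schwartz_seminorm 0 [] (\<lambda>x. h x - g x) < 1} \<in> B"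
      unfolding B_def
      by (intro CollectI exI[of _ g] exI[of _ 0] exI[of _ "[]"] exI[of _ 1] conjI refl g zero_less_one)
    ultimately show ?thesis by blast
  qed
  have "openin schwartz_topology {f \<in> topspace schwartz_topology. u f \<in> V}"
    using u V by (auto simp: tempered_distributions_def continuous_map_def)
  then have gen: "generate_topology_on B {f \<in> \<Union> B. u f \<in> V}"
    unfolding schwartz_topology_def B_def[symmetric] topology_generated_by_topspace openin_topology_generated_by_iff .
  have "\<forall>\<^sub>F n in F. G n \<in> U" if "generate_topology_on B U" "g \<in> U" for U
    using that
  proof (induction rule: generate_topology_on.induct)
    case (Basis s)
    then obtain f m "is" e where s: "s = {g \<in> schwartz. schwartz_seminorm m is (\<lambda>x. g x - f x) < e}" "f \<in> schwartz"
      by (auto simp: B_def)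
    then have "0 < e - schwartz_seminorm m is (\<lambda>x. g x - f x)" using Basis by simp
    then have "\<forall>\<^sub>F n in F. schwartz_seminorm m is (\<lambda>x. G n x - g x) < e - schwartz_seminorm m is (\<lambda>x. g x - f x)"
      using lim[of m "is"] by (rule order_tendstoD(2)[rotated])
    then show ?case
    proof eventually_elim
      case (elim n)
      then show ?case
        using schwartz_seminorm_triangle[OF s(2) g G[of n], of m "is"] G[of n] unfolding s(1) by simp
    qed
  next
    case (UN K)
    then obtain k where k: "k \<in> K" "g \<in> k" by blast
    then have "\<forall>\<^sub>F n in F. G n \<in> k" using UN by blast
    then show ?case by eventually_elim (use k in blast)
  qed (auto intro: eventually_conj)
  from this[OF gen] gB V(2) show "\<forall>\<^sub>F n in F. u (G n) \<in> V"
    by (auto elim: eventually_mono)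
qed

section \<open>Sampling formulas for Schwartz functions\<close>

lemma continuous_on_schwartz:
  assumes "f \<in> schwartz"
  shows "continuous_on UNIV f"
proof -
  have "iter_deriv [] f differentiable_on UNIV" using schwartz_smooth[OF assms] unfolding smooth_def by blast
  then show ?thesis using differentiable_imp_continuous_on by fastforce
qed

text \<open>Decay of order 2d, with d the dimension, is shared among the coordinates to give a
  majorant that is a product of functions 1/(1 + t^2).\<close>

lemma integrable_schwartz:
  fixes f :: "'n::finite cfun"
  assumes f: "f \<in> schwartz"
  shows "integrable lborel f"
proof -
  define d where "d = DIM((real, 'n) vec)"
  obtain C where C: "\<And>x. (1 + norm x) ^ (2 * d) * norm (iter_deriv [] f x) \<le> C" "0 \<le> C"
    using schwartz_bounded[OF f] by blast
  define h where "h x = C * (\<Prod>b\<in>Basis. 1 / (1 + (x \<bullet> b)\<^sup>2))" for x :: "(real, 'n) vec"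
  have [measurable]: "f \<in> borel_measurable borel"
    by (rule borel_measurable_continuous_onI[OF continuous_on_schwartz[OF f]])
  have hi: "integrable lborel h"
  proof -
    have "integrable lborel (\<lambda>x::(real, 'n) vec. \<Prod>b\<in>Basis. complex_of_real (1 / (1 + (x \<bullet> b)\<^sup>2)))"
    proof (rule lborel_prod_complex(1))
      have "integrable lborel (\<lambda>t. 1 / (1 + t\<^sup>2) :: real)"
      proof (rule integrableI_bounded)
        show "(\<lambda>t. 1 / (1 + t\<^sup>2) :: real) \<in> borel_measurable lborel" by measurable
        have "norm (1 / (1 + t\<^sup>2)) = 1 / (1 + t\<^sup>2)" for t :: real
          by (simp add: abs_of_pos add_pos_nonneg)
        then show "(\<integral>\<^sup>+ t. ennreal (norm (1 / (1 + t\<^sup>2) :: real)) \<partial>lborel) < \<infinity>"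
          by (simp only: nn_integral_inverse_1_plus_square) simp
      qed
      then show "integrable lborel (\<lambda>t. complex_of_real (1 / (1 + t\<^sup>2)))" by (rule integrable_of_real)
    qed
    then have "integrable lborel (\<lambda>x::(real, 'n) vec. complex_of_real (\<Prod>b\<in>Basis. 1 / (1 + (x \<bullet> b)\<^sup>2)))"
      by simp
    from integrable_Re[OF this]
    have "integrable lborel (\<lambda>x::(real, 'n) vec. (\<Prod>b\<in>Basis. 1 / (1 + (x \<bullet> b)\<^sup>2)))"
      by (simp only: Re_complex_of_real)
    then show ?thesis unfolding h_def by (rule integrable_mult_right)
  qed
  show ?thesis
  proof (rule Bochner_Integration.integrable_bound[OF hi])
    show "AE x in lborel. norm (f x) \<le> norm (h x)"
    proof (rule AE_I2)
      fix x :: "(real, 'n) vec"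
      define P where "P = (\<Prod>b\<in>Basis. (1 + (x \<bullet> b)\<^sup>2))"
      have P: "0 < P" unfolding P_def by (intro prod_pos) (auto intro: add_pos_nonneg)
      have "P \<le> (\<Prod>b\<in>(Basis::(real, 'n) vec set). (1 + norm x)\<^sup>2)"
        unfolding P_def
      proof (rule prod_mono)
        fix b :: "(real, 'n) vec" assume b: "b \<in> Basis"
        have "(x \<bullet> b)\<^sup>2 \<le> (norm x)\<^sup>2" using Basis_le_norm[OF b, of x] abs_le_square_iff by fastforce
        then show "0 \<le> 1 + (x \<bullet> b)\<^sup>2 \<and> 1 + (x \<bullet> b)\<^sup>2 \<le> (1 + norm x)\<^sup>2"
          by (simp add: power2_sum add_increasing2)
      qed
      also have "\<dots> = (1 + norm x) ^ (2 * d)" by (simp add: d_def power_mult)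
      finally have "P * norm (f x) \<le> (1 + norm x) ^ (2 * d) * norm (f x)" by (rule mult_right_mono) simp
      also have "\<dots> \<le> C" using C(1)[of x] by simp
      finally have "norm (f x) \<le> C / P" using P by (simp add: le_divide_eq mult.commute)
      also have "C / P = h x" by (simp add: h_def P_def prod_dividef)
      finally show "norm (f x) \<le> norm (h x)" by simp
    qed
  qed simp
qed

lemma inner_axis_1: "axis i 1 \<bullet> (x :: (real, 'n::finite) vec) = x $ i"
  by (simp add: inner_axis')

text \<open>A shift by \<open>b n\<close> along axis i multiplies the transform at \<xi> by exp
  (\<i> b_n \<xi>_i). Hence f and its sampled series have the same transform: where |\<xi>| \<le> 2
  the multipliers sum to 1, and elsewhere both transforms vanish. \<open>fourier_injective\<close>
  then identifies the two functions.\<close>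

lemma schwartz_sampling:
  fixes f :: "'n::finite cfun" and b :: "nat \<Rightarrow> real"
  assumes f: "f \<in> schwartz" and supp: "\<And>\<xi>. 2 < norm \<xi> \<Longrightarrow> fourier f \<xi> = 0"
    and c: "summable (\<lambda>n. norm (c n))"
    and one: "\<And>\<xi>. \<bar>\<xi>\<bar> \<le> 2 \<Longrightarrow> (\<lambda>n. c n * exp (\<i> * of_real (b n * \<xi>))) sums 1"
  shows "(\<lambda>n. c n * f (x + b n *\<^sub>R axis i 1)) sums f x"
proof -
  define h where "h n x = c n * f (x + b n *\<^sub>R axis i 1)" for n x
  obtain B where B: "\<And>x. norm (f x) \<le> B"
    using schwartz_bounded[OF f, of 0 "[]"] by auto
  have fc: "continuous_on UNIV f" by (rule continuous_on_schwartz[OF f])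
  have [measurable]: "f \<in> borel_measurable borel" by (rule borel_measurable_continuous_onI[OF fc])
  have fi: "integrable lborel f" by (rule integrable_schwartz[OF f])
  have hn: "norm (h n x) \<le> norm (c n) * B" for n x
    unfolding h_def norm_mult by (intro mult_left_mono B) auto
  have sB: "summable (\<lambda>n. norm (c n) * B)" by (rule summable_mult2[OF c])
  have hs: "summable (\<lambda>n. norm (h n x))" for x
    by (rule summable_comparison_test[OF _ sB]) (auto simp: hn)
  define S where "S x = (\<Sum>n. h n x)" for x
  have Sc: "continuous_on UNIV S"
  proof (rule uniform_limit_theorem)
    show "uniform_limit UNIV (\<lambda>n x. \<Sum>i<n. h i x) S sequentially"
      unfolding S_def by (rule Weierstrass_m_test[OF hn sB])
    show "\<forall>\<^sub>F n in sequentially. continuous_on UNIV (\<lambda>x. \<Sum>i<n. h i x)"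
      unfolding h_def by (intro always_eventually allI continuous_intros continuous_on_compose2[OF fc]) auto
  qed simp
  have hi: "integrable lborel (h n)" for n
    using lborel_integrable_affine[OF _ fi, of 1 "b n *\<^sub>R axis i 1"] unfolding h_def
    by (simp add: add.commute)
  have hnorm: "(\<integral>x. norm (h n x) \<partial>lborel) = norm (c n) * (\<integral>x. norm (f x) \<partial>lborel)" for n
    using lborel_integral_affine[of 1 "\<lambda>x. norm (f x)" "b n *\<^sub>R axis i 1"] unfolding h_def
    by (simp add: norm_mult add.commute)
  have sn: "summable (\<lambda>n. \<integral>x. norm (h n x) \<partial>lborel)"
    unfolding hnorm by (rule summable_mult2[OF c])
  have Si: "integrable lborel S"
    unfolding S_def by (rule integrable_suminf[OF hi _ sn]) (simp add: hs)
  define g where "g x = f x - S x" for x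
  have "g x = 0"
  proof (rule fourier_injective[where g = g])
    show "continuous_on UNIV g" unfolding g_def by (intro continuous_on_diff fc Sc)
    show "integrable lborel g" unfolding g_def by (intro Bochner_Integration.integrable_diff fi Si)
    show "norm (g x) \<le> B + (\<Sum>n. norm (c n) * B)" for x
    proof -
      have "norm (S x) \<le> (\<Sum>n. norm (h n x))" unfolding S_def by (rule summable_norm[OF hs])
      also have "\<dots> \<le> (\<Sum>n. norm (c n) * B)" by (rule suminf_le[OF hn hs sB])
      finally show ?thesis unfolding g_def using norm_triangle_ineq4[of "f x" "S x"] B[of x] by linarith
    qed
    fix \<xi>
    define E where "E y = exp (- \<i> * of_real (y \<bullet> \<xi>))" for y :: "(real, 'n) vec"
    have Em [measurable]: "E \<in> borel_measurable borel" unfolding E_def by measurable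
    have nE: "norm (E y) = 1" for y by (simp add: E_def)
    have Ei: "integrable lborel (\<lambda>y. E y * k y)" if "integrable lborel k" for k
    proof (rule Bochner_Integration.integrable_bound[OF that])
      have [measurable]: "k \<in> borel_measurable borel" using that by auto
      show "(\<lambda>y. E y * k y) \<in> borel_measurable lborel" by measurable
    qed (simp add: norm_mult nE)
    define F where "F = (\<integral>y. E y * f y \<partial>lborel)"
    have Fh: "(\<integral>y. E y * h n y \<partial>lborel) = F * (c n * exp (\<i> * of_real (b n * \<xi> $ i)))" for n
    proof -
      have "(\<integral>y. E (y - b n *\<^sub>R axis i 1) * f y \<partial>lborel) = (\<integral>y. E y * f (b n *\<^sub>R axis i 1 + y) \<partial>lborel)"
        using lborel_integral_affine[of 1 "\<lambda>y. E (y - b n *\<^sub>R axis i 1) * f y" "b n *\<^sub>R axis i 1"] by simp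
      moreover have "E (y - b n *\<^sub>R axis i 1) = exp (\<i> * of_real (b n * \<xi> $ i)) * E y" for y
      proof -
        have "- \<i> * complex_of_real ((y - b n *\<^sub>R axis i 1) \<bullet> \<xi>) =
            \<i> * complex_of_real (b n * \<xi> $ i) + - \<i> * complex_of_real (y \<bullet> \<xi>)"
          by (simp add: inner_diff_left inner_axis_1 right_diff_distrib)
        then show ?thesis unfolding E_def by (simp only: exp_add)
      qed
      ultimately have "exp (\<i> * of_real (b n * \<xi> $ i)) * F = (\<integral>y. E y * f (b n *\<^sub>R axis i 1 + y) \<partial>lborel)"
        unfolding F_def by (simp add: mult.assoc)
      moreover have "E y * h n y = c n * (E y * f (b n *\<^sub>R axis i 1 + y))" for y
        unfolding h_def by (simp only: mult.left_commute add.commute)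
      ultimately have "(\<integral>y. E y * h n y \<partial>lborel) = c n * (exp (\<i> * of_real (b n * \<xi> $ i)) * F)"
        by (simp only: integral_mult_right_zero)
      then show ?thesis by (simp only: mult_ac)
    qed
    have "(\<lambda>n. \<integral>y. E y * h n y \<partial>lborel) sums (\<integral>y. (\<Sum>n. E y * h n y) \<partial>lborel)"
    proof (rule sums_integral)
      show "integrable lborel (\<lambda>y. E y * h n y)" for n by (rule Ei[OF hi])
      show "AE y in lborel. summable (\<lambda>n. norm (E y * h n y))" by (simp add: norm_mult nE hs)
      show "summable (\<lambda>n. \<integral>y. norm (E y * h n y) \<partial>lborel)" using sn by (simp add: norm_mult nE)
    qed
    also have "(\<lambda>y. \<Sum>n. E y * h n y) = (\<lambda>y. E y * S y)"
    proof
      show "(\<Sum>n. E y * h n y) = E y * S y" for y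
        unfolding S_def by (rule suminf_mult[OF summable_norm_cancel[OF hs]])
    qed
    finally have sum1: "(\<lambda>n. F * (c n * exp (\<i> * of_real (b n * \<xi> $ i)))) sums (\<integral>y. E y * S y \<partial>lborel)"
      unfolding Fh .
    have "(\<integral>y. E y * S y \<partial>lborel) = F"
    proof (cases "norm \<xi> \<le> 2")
      case True
      then have "\<bar>\<xi> $ i\<bar> \<le> 2" using component_le_norm_cart[of \<xi> i] by linarith
      from sums_unique2[OF sum1 sums_mult[OF one[OF this], of F]] show ?thesis by simp
    next
      case False
      then have "F = 0" using supp[of \<xi>] by (simp add: fourier_def F_def E_def)
      then have "(\<lambda>n. 0) sums (\<integral>y. E y * S y \<partial>lborel)" using sum1 by simp
      from sums_unique2[OF this sums_zero] \<open>F = 0\<close> show ?thesis by simp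
    qed
    moreover have "(\<integral>y. E y * f y - E y * S y \<partial>lborel) = F - (\<integral>y. E y * S y \<partial>lborel)"
      unfolding F_def by (rule Bochner_Integration.integral_diff[OF Ei[OF fi] Ei[OF Si]])
    ultimately show "(\<integral>y. exp (- \<i> * of_real (y \<bullet> \<xi>)) * g y \<partial>lborel) = 0"
      unfolding E_def[symmetric] g_def right_diff_distrib by simp
  qed
  then show ?thesis
    using summable_sums[OF summable_norm_cancel[OF hs[of x]]] unfolding g_def S_def h_def by simp
qed

text \<open>The series is differentiated term by term along one coordinate line at a time; the
  differentiated series converges uniformly, as the coefficients are summable and the derivatives of
  f bounded.\<close>

lemma iter_deriv_sampling:
  fixes f :: "'n::finite cfun"
  assumes f: "f \<in> schwartz" and c: "summable (\<lambda>n. norm (c n))"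
    and s: "\<And>x. (\<lambda>n. c n * f (x + b n)) sums f x"
  shows "(\<lambda>n. c n * iter_deriv is f (x + b n)) sums iter_deriv is f x"
proof (induction "is" arbitrary: x)
  case Nil
  then show ?case using s by simp
next
  case (Cons j "is")
  define g where "g = iter_deriv is f"
  define d where "d = partial_deriv j g"
  obtain B where B: "\<And>x. norm (d x) \<le> B"
    using schwartz_bounded[OF f, of 0 "j # is"] by (auto simp: d_def g_def)
  have gd: "g differentiable at y" for y
    unfolding g_def by (intro smooth_differentiable schwartz_smooth f)
  have sB: "summable (\<lambda>n. norm (c n) * B)" by (rule summable_mult2[OF c])
  have sd: "summable (\<lambda>n. norm (c n * d (y n)))" for y
    by (rule summable_comparison_test[OF _ sB]) (auto simp: norm_mult B intro!: mult_left_mono)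
  define D where "D t = (\<Sum>n. c n * d (x + b n + t *\<^sub>R axis j 1))" for t
  have "\<exists>G. \<forall>t\<in>UNIV. (\<lambda>n. c n * g (x + b n + t *\<^sub>R axis j 1)) sums G t \<and> (G has_derivative (\<lambda>h. h *\<^sub>R D t)) (at t within UNIV)"
  proof (rule has_derivative_series[where f' = "\<lambda>n t h. h *\<^sub>R (c n * d (x + b n + t *\<^sub>R axis j 1))" and x = 0])
    fix n t
    have "((\<lambda>t. c n * g (x + b n + t *\<^sub>R axis j 1)) has_derivative (\<lambda>h. c n * (h *\<^sub>R d (x + b n + t *\<^sub>R axis j 1)))) (at t)"
      unfolding d_def by (intro has_derivative_mult_right partial_deriv_has_derivative gd)
    then show "((\<lambda>t. c n * g (x + b n + t *\<^sub>R axis j 1)) has_derivative (\<lambda>h. h *\<^sub>R (c n * d (x + b n + t *\<^sub>R axis j 1)))) (at t within UNIV)"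
      by simp
  next
    fix e :: real assume e: "0 < e"
    have "uniform_limit UNIV (\<lambda>n t. \<Sum>k<n. c k * d (x + b k + t *\<^sub>R axis j 1)) D sequentially"
      unfolding D_def by (rule Weierstrass_m_test[OF _ sB]) (auto simp: norm_mult intro!: mult_left_mono B)
    from uniform_limitD[OF this e]
    show "\<forall>\<^sub>F n in sequentially. \<forall>t\<in>UNIV. \<forall>h. norm ((\<Sum>i<n. h *\<^sub>R (c i * d (x + b i + t *\<^sub>R axis j 1))) - h *\<^sub>R D t) \<le> e * norm h"
    proof eventually_elim
      case (elim n)
      show ?case
      proof (intro ballI allI)
        fix t h
        have "norm ((\<Sum>i<n. c i * d (x + b i + t *\<^sub>R axis j 1)) - D t) \<le> e"
          using elim by (auto simp: dist_norm less_imp_le)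
        then have "\<bar>h\<bar> * norm ((\<Sum>i<n. c i * d (x + b i + t *\<^sub>R axis j 1)) - D t) \<le> \<bar>h\<bar> * e"
          by (rule mult_left_mono) simp
        then show "norm ((\<Sum>i<n. h *\<^sub>R (c i * d (x + b i + t *\<^sub>R axis j 1))) - h *\<^sub>R D t) \<le> e * norm h"
          unfolding scaleR_sum_right[symmetric] scaleR_diff_right[symmetric] norm_scaleR by (simp add: mult.commute)
      qed
    qed
  next
    show "(\<lambda>n. c n * g (x + b n + 0 *\<^sub>R axis j 1)) sums g x"
      using Cons[of x] by (simp add: g_def)
  qed auto
  then obtain G where G: "\<And>t. (\<lambda>n. c n * g (x + b n + t *\<^sub>R axis j 1)) sums G t" "(G has_derivative (\<lambda>h. h *\<^sub>R D 0)) (at 0)"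
    by auto
  have "G t = g (x + t *\<^sub>R axis j 1)" for t
  proof -
    have "(\<lambda>n. c n * g (x + b n + t *\<^sub>R axis j 1)) sums g (x + t *\<^sub>R axis j 1)"
      using Cons[of "x + t *\<^sub>R axis j 1"] by (simp add: g_def add_ac)
    with G(1) show ?thesis by (rule sums_unique2)
  qed
  then have "G = (\<lambda>t. g (x + t *\<^sub>R axis j 1))" by auto
  then have "((\<lambda>t. g (x + t *\<^sub>R axis j 1)) has_vector_derivative D 0) (at 0)"
    using G(2) by (simp add: has_vector_derivative_def)
  then have "d x = D 0" unfolding d_def partial_deriv_def by (rule vector_derivative_at)
  moreover have "(\<lambda>n. c n * d (x + b n)) sums D 0"
    unfolding D_def using summable_sums[OF summable_norm_cancel[OF sd]] by simp
  ultimately show ?case by (simp add: d_def g_def)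
qed

section \<open>Convolution of a tempered distribution with a Schwartz function\<close>

text \<open>The mean value inequality on the segment from z to z + h. The total derivative is
  bounded through partial derivatives because only these enter the Schwartz seminorms.\<close>

lemma norm_diff_le_partial_derivs:
  fixes g :: "'n::finite cfun"
  assumes d: "\<And>y. g differentiable at y"
    and B: "\<And>\<theta> j. 0 \<le> \<theta> \<Longrightarrow> \<theta> \<le> 1 \<Longrightarrow> norm (partial_deriv j g (z + \<theta> *\<^sub>R h)) \<le> B"
  shows "norm (g (z + h) - g z) \<le> norm h * (real CARD('n) * B)"
proof -
  obtain D where D: "\<And>y. (g has_derivative D y) (at y)"
    using d unfolding differentiable_def by metis
  have Dh: "norm (D y v) \<le> norm v * (\<Sum>j\<in>UNIV. norm (partial_deriv j g y))" for y v
  proof -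
    have "D y v = D y (\<Sum>j\<in>UNIV. (v $ j) *\<^sub>R axis j 1)"
      by (subst basis_expansion[of v, symmetric]) (simp add: scalar_mult_eq_scaleR)
    also have "\<dots> = (\<Sum>j\<in>UNIV. (v $ j) *\<^sub>R partial_deriv j g y)"
      using has_derivative_linear[OF D[of y]] by (simp add: linear_sum linear_cmul partial_deriv_eq[OF D])
    finally have "norm (D y v) \<le> (\<Sum>j\<in>UNIV. \<bar>v $ j\<bar> * norm (partial_deriv j g y))"
      using norm_sum[of "\<lambda>j. (v $ j) *\<^sub>R partial_deriv j g y" UNIV] by simp
    also have "\<dots> \<le> (\<Sum>j\<in>UNIV. norm v * norm (partial_deriv j g y))"
      by (intro sum_mono mult_right_mono component_le_norm_cart) auto
    finally show ?thesis by (simp add: sum_distrib_left)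
  qed
  have "norm (g (z + 1 *\<^sub>R h) - g (z + 0 *\<^sub>R h)) \<le> (norm h * (real CARD('n) * B)) * norm (1 - 0 :: real)"
  proof (rule differentiable_bound[where S = "{0..1}" and f = "\<lambda>\<theta>. g (z + \<theta> *\<^sub>R h)" and f' = "\<lambda>\<theta> s. D (z + \<theta> *\<^sub>R h) (s *\<^sub>R h)"])
    fix \<theta> :: real assume \<theta>: "\<theta> \<in> {0..1}"
    have "((\<lambda>\<theta>. g (z + \<theta> *\<^sub>R h)) has_derivative (\<lambda>s. D (z + \<theta> *\<^sub>R h) (s *\<^sub>R h))) (at \<theta>)"
      by (rule has_derivative_compose[of "\<lambda>\<theta>. z + \<theta> *\<^sub>R h" "\<lambda>s. s *\<^sub>R h", OF _ D]) (auto intro!: derivative_eq_intros)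
    then show "((\<lambda>\<theta>. g (z + \<theta> *\<^sub>R h)) has_derivative (\<lambda>s. D (z + \<theta> *\<^sub>R h) (s *\<^sub>R h))) (at \<theta> within {0..1})"
      by (rule has_derivative_at_withinI)
    show "onorm (\<lambda>s. D (z + \<theta> *\<^sub>R h) (s *\<^sub>R h)) \<le> norm h * (real CARD('n) * B)"
    proof (rule onorm_le)
      fix s :: real
      have "norm (D (z + \<theta> *\<^sub>R h) (s *\<^sub>R h)) \<le> norm (s *\<^sub>R h) * (\<Sum>j\<in>(UNIV :: 'n set). B)"
        using \<theta> by (intro order_trans[OF Dh] mult_left_mono sum_mono B) auto
      then show "norm (D (z + \<theta> *\<^sub>R h) (s *\<^sub>R h)) \<le> norm h * (real CARD('n) * B) * norm s"
        by (simp add: mult_ac)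
    qed
  qed auto
  then show ?thesis by simp
qed

lemma reflect_schwartz: "f \<in> schwartz \<Longrightarrow> (\<lambda>y. f (x - y)) \<in> schwartz"
  using schwartz_affine[of f "-1" 1 x] by simp

lemma iter_deriv_reflect:
  "f \<in> schwartz \<Longrightarrow> iter_deriv is (\<lambda>y. f (x - y)) = (\<lambda>y. (- 1) ^ length is * iter_deriv is f (x - y))"
  using iter_deriv_affine[OF schwartz_smooth, of f "is" 1 x "-1"] by simp

text \<open>The reflected translates of f depend continuously on x in the Schwartz topology: each
  seminorm of their difference is at most a constant times |x - x0| near x0. The result provides the
  measurability of the blocks.\<close>

lemma continuous_conv_distr:
  fixes f :: "'n::finite cfun"
  assumes f: "f \<in> schwartz" and u: "u \<in> tempered_distributions"
  shows "continuous_on UNIV (conv_distr f u)"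
  unfolding continuous_on_def conv_distr_def
proof (intro ballI, rule tempered_tendsto[OF u])
  fix x0 :: "(real, 'n) vec"
  show "(\<lambda>y. f (x - y)) \<in> schwartz" for x by (rule reflect_schwartz[OF f])
  show "(\<lambda>y. f (x0 - y)) \<in> schwartz" by (rule reflect_schwartz[OF f])
  fix m "is"
  define g where "g = iter_deriv is f"
  have "\<forall>j. \<exists>C. \<forall>x. (1 + norm x) ^ m * norm (partial_deriv j g x) \<le> C"
    using schwartz_bounded[OF f, of m "_ # is"] unfolding g_def by (auto intro: ex_forward)
  then obtain C where C: "\<And>j x. (1 + norm x) ^ m * norm (partial_deriv j g x) \<le> C j" by metis
  define K where "K = Max (range C)"
  have K: "C j \<le> K" for j unfolding K_def by (rule Max_ge) auto
  define M where "M = (2 + norm x0) ^ m * (real CARD('n) * K)"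
  have bound: "schwartz_seminorm m is (\<lambda>y. f (x - y) - f (x0 - y)) \<le> norm (x - x0) * M" if "norm (x - x0) \<le> 1" for x
  proof (rule schwartz_seminorm_le)
    fix y
    define z where "z = x0 - y"
    define h where "h = x - x0"
    have nz: "norm (partial_deriv j g (z + \<theta> *\<^sub>R h)) \<le> (2 + norm x0) ^ m * K / (1 + norm y) ^ m"
      if \<theta>: "0 \<le> \<theta>" "\<theta> \<le> 1" for \<theta> j
    proof -
      define v where "v = z + \<theta> *\<^sub>R h"
      have "norm (\<theta> *\<^sub>R h) \<le> 1" using \<theta> \<open>norm (x - x0) \<le> 1\<close> by (simp add: h_def mult_le_one)
      moreover have "y = x0 + \<theta> *\<^sub>R h - v" by (simp add: v_def z_def)
      ultimately have "norm y \<le> norm x0 + 1 + norm v"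
        by (smt (verit) norm_triangle_ineq norm_triangle_ineq4)
      then have "1 + norm y \<le> (2 + norm x0) * (1 + norm v)"
      proof -
        assume "norm y \<le> norm x0 + 1 + norm v"
        moreover have "(2 + norm x0) * (1 + norm v) = 2 + norm x0 + 2 * norm v + norm x0 * norm v"
          by (simp add: algebra_simps)
        moreover have "0 \<le> norm x0 * norm v" by simp
        ultimately show ?thesis using norm_ge_zero[of v] by linarith
      qed
      then have "(1 + norm y) ^ m \<le> ((2 + norm x0) * (1 + norm v)) ^ m" by (intro power_mono) auto
      then have "(1 + norm y) ^ m * norm (partial_deriv j g v) \<le> ((2 + norm x0) * (1 + norm v)) ^ m * norm (partial_deriv j g v)"
        by (rule mult_right_mono) simp
      also have "\<dots> = (2 + norm x0) ^ m * ((1 + norm v) ^ m * norm (partial_deriv j g v))"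
        by (simp add: power_mult_distrib)
      also have "\<dots> \<le> (2 + norm x0) ^ m * K"
        using order_trans[OF C K] by (intro mult_left_mono) auto
      finally show ?thesis
        by (simp add: v_def le_divide_eq zero_less_power add_pos_nonneg mult.commute)
    qed
    have "norm (g (z + h) - g z) \<le> norm h * (real CARD('n) * ((2 + norm x0) ^ m * K / (1 + norm y) ^ m))"
      by (rule norm_diff_le_partial_derivs[OF _ nz]) (simp add: g_def smooth_differentiable schwartz_smooth f)
    also have "\<dots> = norm h * M / (1 + norm y) ^ m" by (simp add: M_def)
    finally have "(1 + norm y) ^ m * norm (g (z + h) - g z) \<le> norm h * M"
      by (simp add: le_divide_eq zero_less_power add_pos_nonneg mult.commute)
    moreover have "iter_deriv is (\<lambda>y. f (x - y) - f (x0 - y)) y = (- 1) ^ length is * (g (z + h) - g z)"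
      unfolding iter_deriv_diff[OF reflect_schwartz[OF f, THEN schwartz_smooth] reflect_schwartz[OF f, THEN schwartz_smooth]]
        iter_deriv_reflect[OF f] by (simp add: g_def z_def h_def right_diff_distrib)
    ultimately show "(1 + norm y) ^ m * norm (iter_deriv is (\<lambda>y. f (x - y) - f (x0 - y)) y) \<le> norm (x - x0) * M"
      by (simp add: norm_mult norm_power h_def)
  qed
  show "((\<lambda>x. schwartz_seminorm m is (\<lambda>y. f (x - y) - f (x0 - y))) \<longlongrightarrow> 0) (at x0)"
  proof (rule Lim_null_comparison)
    have "\<forall>\<^sub>F x in at x0. norm (x - x0) \<le> 1"
      unfolding eventually_at by (intro exI[of _ 1]) (auto simp: dist_norm)
    then show "\<forall>\<^sub>F x in at x0. norm (schwartz_seminorm m is (\<lambda>y. f (x - y) - f (x0 - y))) \<le> norm (x - x0) * M"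
      by eventually_elim
        (use bound schwartz_seminorm_nonneg[OF schwartz_diff[OF reflect_schwartz[OF f] reflect_schwartz[OF f]]] in simp)
    have "((\<lambda>x. norm (x - x0) * M) \<longlongrightarrow> norm (x0 - x0) * M) (at x0)" by (intro tendsto_intros)
    then show "((\<lambda>x. norm (x - x0) * M) \<longlongrightarrow> 0) (at x0)" by simp
  qed
qed

lemma tempered_add:
  "u \<in> tempered_distributions \<Longrightarrow> f \<in> schwartz \<Longrightarrow> g \<in> schwartz \<Longrightarrow> u (\<lambda>x. f x + g x) = u f + u g"
  by (simp add: tempered_distributions_def)

lemma tempered_cmult:
  "u \<in> tempered_distributions \<Longrightarrow> f \<in> schwartz \<Longrightarrow> u (\<lambda>x. c * f x) = c * u f"
  by (simp add: tempered_distributions_def)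

lemma tempered_sum:
  assumes u: "u \<in> tempered_distributions" and G: "\<And>n::nat. G n \<in> schwartz"
  shows "(\<lambda>y. \<Sum>n<N. c n * G n y) \<in> schwartz \<and> u (\<lambda>y. \<Sum>n<N. c n * G n y) = (\<Sum>n<N. c n * u (G n))"
proof (induction N)
  case 0
  show ?case using tempered_cmult[OF u schwartz_0, of 0] by (simp add: schwartz_0)
next
  case (Suc N)
  have cG: "(\<lambda>y. c N * G N y) \<in> schwartz"
    using schwartz_add[OF schwartz_0 G[of N], of "c N"] by simp
  note IH = Suc[THEN conjunct1] Suc[THEN conjunct2]
  have "(\<lambda>y. \<Sum>n<Suc N. c n * G n y) \<in> schwartz"
    using schwartz_add[OF IH(1) G[of N], of "c N"] by simp
  moreover have "u (\<lambda>y. (\<Sum>n<N. c n * G n y) + c N * G N y) = u (\<lambda>y. \<Sum>n<N. c n * G n y) + u (\<lambda>y. c N * G N y)"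
    by (rule tempered_add[OF u IH(1) cG])
  moreover have "u (\<lambda>y. c N * G N y) = c N * u (G N)"
    by (rule tempered_cmult[OF u G])
  ultimately show ?case using IH(2) by simp
qed

text \<open>The series converges in every Schwartz seminorm, so u may be applied term by term. A
  shift by \<open>b n\<close> costs (1 + |b_n|)^m in a seminorm of weight m, and the order of u is
  unknown; hence summability is demanded for every m.\<close>

lemma conv_distr_sampling:
  fixes f :: "'n::finite cfun" and b :: "nat \<Rightarrow> (real, 'n) vec"
  assumes f: "f \<in> schwartz" and u: "u \<in> tempered_distributions"
    and c: "\<And>m. summable (\<lambda>n. norm (c n) * (1 + norm (b n)) ^ m)"
    and s: "\<And>x. (\<lambda>n. c n * f (x + b n)) sums f x"
  shows "(\<lambda>n. c n * conv_distr f u (x + b n)) sums conv_distr f u x"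
proof -
  define G where "G n y = f (x + b n - y)" for n y
  have G: "G n \<in> schwartz" for n unfolding G_def by (rule reflect_schwartz[OF f])
  define S where "S N y = (\<Sum>n<N. c n * G n y)" for N y
  have S: "S N \<in> schwartz" for N unfolding S_def by (rule tempered_sum[OF u G, THEN conjunct1])
  have f': "(\<lambda>y. f (x - y)) \<in> schwartz" by (rule reflect_schwartz[OF f])
  have c0: "summable (\<lambda>n. norm (c n))" using c[of 0] by simp
  have "(\<lambda>N. u (S N)) \<longlonglongrightarrow> u (\<lambda>y. f (x - y))"
  proof (rule tempered_tendsto[OF u S f'])
    fix m "is"
    define g where "g = iter_deriv is f"
    obtain B where B: "\<And>x. (1 + norm x) ^ m * norm (g x) \<le> B" "0 \<le> B"
      using schwartz_bounded[OF f] unfolding g_def by blast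
    have gs: "(\<lambda>n. c n * g (z + b n)) sums g z" for z
      unfolding g_def by (rule iter_deriv_sampling[OF f c0 s])
    have dS: "iter_deriv is (S N) = (\<lambda>y. \<Sum>n<N. c n * ((- 1) ^ length is * g (x + b n - y)))" for N
    proof (induction N)
      case 0
      have "iter_deriv is (\<lambda>y. 0 + 0 * (\<lambda>y. 0) y) = (\<lambda>y. 0)" for "is" :: "'n list"
      proof (induction "is")
        case (Cons a "is")
        then show ?case by (auto simp: partial_deriv_def vector_derivative_const_at)
      qed simp
      then show ?case unfolding S_def by simp
    next
      case (Suc N)
      have "S (Suc N) = (\<lambda>y. S N y + c N * G N y)" by (simp add: S_def fun_eq_iff)
      then have "iter_deriv is (S (Suc N)) = (\<lambda>y. iter_deriv is (S N) y + c N * iter_deriv is (G N) y)"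
        using iter_deriv_add[OF schwartz_smooth[OF S] schwartz_smooth[OF G]] by simp
      moreover have "iter_deriv is (G N) = (\<lambda>y. (- 1) ^ length is * g (x + b N - y))"
        unfolding G_def g_def by (rule iter_deriv_reflect[OF f])
      ultimately show ?case using Suc by simp
    qed
    define t where "t N = (\<Sum>n. norm (c (n + N)) * (1 + norm (b (n + N))) ^ m)" for N
    have bound: "schwartz_seminorm m is (\<lambda>y. S N y - f (x - y)) \<le> (1 + norm x) ^ m * B * t N" for N
    proof (rule schwartz_seminorm_le)
      fix y
      define z where "z = x - y"
      have each: "(1 + norm y) ^ m * norm (c n * g (z + b n)) \<le> (1 + norm x) ^ m * B * (norm (c n) * (1 + norm (b n)) ^ m)" for n
      proof -
        have "y = x - (z + b n) + b n" by (simp add: z_def)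
        then have "norm y \<le> norm x + norm (z + b n) + norm (b n)"
          by (smt (verit) norm_triangle_ineq norm_triangle_ineq4)
        also have "1 + (norm x + norm (z + b n) + norm (b n)) \<le> (1 + norm x) * (1 + norm (b n)) * (1 + norm (z + b n))"
          by (simp add: algebra_simps)
        finally have "1 + norm y \<le> (1 + norm x) * (1 + norm (b n)) * (1 + norm (z + b n))" by simp
        then have "(1 + norm y) ^ m \<le> ((1 + norm x) * (1 + norm (b n)) * (1 + norm (z + b n))) ^ m"
          by (intro power_mono) auto
        then have "(1 + norm y) ^ m * norm (c n * g (z + b n)) \<le>
          ((1 + norm x) * (1 + norm (b n)) * (1 + norm (z + b n))) ^ m * norm (c n * g (z + b n))"
          by (rule mult_right_mono) simp
        also have "\<dots> = (1 + norm x) ^ m * (norm (c n) * (1 + norm (b n)) ^ m) * ((1 + norm (z + b n)) ^ m * norm (g (z + b n)))"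
          by (simp add: power_mult_distrib norm_mult)
        also have "\<dots> \<le> (1 + norm x) ^ m * (norm (c n) * (1 + norm (b n)) ^ m) * B"
          by (intro mult_left_mono B) auto
        finally show ?thesis by (simp only: mult_ac)
      qed
      have sumn: "summable (\<lambda>n. norm (c (n + N)) * (1 + norm (b (n + N))) ^ m)"
        using c[of m] by (rule summable_ignore_initial_segment)
      have sg: "summable (\<lambda>n. norm (c (n + N) * g (z + b (n + N))))"
      proof (rule summable_comparison_test)
        show "summable (\<lambda>n. (1 + norm x) ^ m * B * (norm (c (n + N)) * (1 + norm (b (n + N))) ^ m))"
          by (rule summable_mult[OF sumn])
        have "1 \<le> (1 + norm y) ^ m" by (intro one_le_power) auto
        then have "norm (c n * g (z + b n)) \<le> (1 + norm y) ^ m * norm (c n * g (z + b n))" for n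
          using mult_right_mono[of 1 "(1 + norm y) ^ m" "norm (c n * g (z + b n))"] by simp
        then show "\<exists>N'. \<forall>n\<ge>N'. norm (norm (c (n + N) * g (z + b (n + N)))) \<le> (1 + norm x) ^ m * B * (norm (c (n + N)) * (1 + norm (b (n + N))) ^ m)"
          using order_trans[OF _ each] by fastforce
      qed
      have "iter_deriv is (\<lambda>y. S N y - f (x - y)) y = (- 1) ^ length is * ((\<Sum>n<N. c n * g (z + b n)) - g z)"
        unfolding iter_deriv_diff[OF schwartz_smooth[OF S] schwartz_smooth[OF f']] dS iter_deriv_reflect[OF f] g_def[symmetric]
        by (simp add: z_def right_diff_distrib sum_distrib_left algebra_simps)
      also have "g z = (\<Sum>n. c (n + N) * g (z + b (n + N))) + (\<Sum>n<N. c n * g (z + b n))"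
        using suminf_split_initial_segment[OF sums_summable[OF gs[of z]], of N] sums_unique[OF gs[of z]] by simp
      finally have "norm (iter_deriv is (\<lambda>y. S N y - f (x - y)) y) = norm (\<Sum>n. c (n + N) * g (z + b (n + N)))"
        by (simp add: norm_mult norm_power)
      also have "\<dots> \<le> (\<Sum>n. norm (c (n + N) * g (z + b (n + N))))" by (rule summable_norm[OF sg])
      finally have "(1 + norm y) ^ m * norm (iter_deriv is (\<lambda>y. S N y - f (x - y)) y) \<le>
          (1 + norm y) ^ m * (\<Sum>n. norm (c (n + N) * g (z + b (n + N))))"
        by (rule mult_left_mono) simp
      also have "\<dots> = (\<Sum>n. (1 + norm y) ^ m * norm (c (n + N) * g (z + b (n + N))))"
        by (rule suminf_mult[OF sg, symmetric])
      also have "\<dots> \<le> (\<Sum>n. (1 + norm x) ^ m * B * (norm (c (n + N)) * (1 + norm (b (n + N))) ^ m))"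
        by (rule suminf_le[OF each summable_mult[OF sg] summable_mult[OF sumn]])
      also have "\<dots> = (1 + norm x) ^ m * B * t N" unfolding t_def by (rule suminf_mult[OF sumn])
      finally show "(1 + norm y) ^ m * norm (iter_deriv is (\<lambda>y. S N y - f (x - y)) y) \<le> (1 + norm x) ^ m * B * t N" .
    qed
    show "(\<lambda>N. schwartz_seminorm m is (\<lambda>y. S N y - f (x - y))) \<longlonglongrightarrow> 0"
    proof (rule Lim_null_comparison)
      show "\<forall>\<^sub>F N in sequentially. norm (schwartz_seminorm m is (\<lambda>y. S N y - f (x - y))) \<le> (1 + norm x) ^ m * B * t N"
        using bound schwartz_seminorm_nonneg[OF schwartz_diff[OF S f']] by simp
      have "t \<longlonglongrightarrow> 0" unfolding t_def by (rule suminf_exist_split2[OF c])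
      then show "(\<lambda>N. (1 + norm x) ^ m * B * t N) \<longlonglongrightarrow> 0" by (rule tendsto_mult_right_zero)
    qed
  qed
  moreover have "u (S N) = (\<Sum>n<N. c n * conv_distr f u (x + b n))" for N
  proof -
    have "G n = (\<lambda>y. f (x + b n - y))" for n by (simp add: G_def fun_eq_iff)
    then show ?thesis unfolding S_def tempered_sum[OF u G, THEN conjunct2] conv_distr_def by simp
  qed
  ultimately show ?thesis by (simp add: sums_def conv_distr_def)
qed

subsection \<open>Littlewood-Paley blocks\<close>

lemma norm_sums_le_tsum:
  fixes f :: "nat \<Rightarrow> 'a::real_normed_vector"
  assumes "f sums s"
  shows "ennreal (norm s) \<le> tsum (\<lambda>n. ennreal (norm (f n)))"
proof (rule LIMSEQ_le_const2)
  show "(\<lambda>n. ennreal (norm (\<Sum>i<n. f i))) \<longlonglongrightarrow> ennreal (norm s)"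
    using assms unfolding sums_def by (intro tendsto_ennrealI tendsto_norm)
  have "ennreal (norm (\<Sum>i<n. f i)) \<le> tsum (\<lambda>n. ennreal (norm (f n)))" for n
  proof -
    have "ennreal (norm (\<Sum>i<n. f i)) \<le> ennreal (\<Sum>i<n. norm (f i))" by (intro ennreal_leI norm_sum)
    also have "\<dots> = (\<Sum>i<n. ennreal (norm (f i)))" by (rule sum_ennreal[symmetric]) simp
    also have "\<dots> \<le> (\<Sum>i. ennreal (norm (f i)))" by (rule sum_le_suminf) auto
    finally show ?thesis by (simp add: nn_integral_count_space_nat)
  qed
  then show "\<exists>N. \<forall>n\<ge>N. ennreal (norm (\<Sum>i<n. f i)) \<le> tsum (\<lambda>n. ennreal (norm (f n)))" by blast
qed

lemma tsum_powr_subadd: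
  assumes "0 < r" "r < 1"
  shows "enn_powr (tsum a) r \<le> tsum (\<lambda>k. enn_powr (a k) r)"
  using tsum_powr_le[of r 1 a] assms by (simp add: enn_powr_le_iff)

text \<open>Both kinds of kernel appear as one affine rescaling in the shape of
  \<open>schwartz_affine\<close>; for k = 0 the scale is 1.\<close>

lemma lp_kernel_eq:
  "lp_kernel \<Phi> \<phi> k = (\<lambda>x. 2 ^ (k * CARD('n)) * (if k = 0 then \<Phi> else \<phi>) (0 + 2 ^ k *\<^sub>R x))"
  for \<Phi> :: "'n::finite cfun"
  by (simp add: lp_kernel_def fun_eq_iff)

lemma admissible_pair_cases:
  fixes k :: nat
  assumes "admissible_pair \<Phi> \<phi>"
  shows "(if k = 0 then \<Phi> else \<phi>) \<in> schwartz" "2 < norm \<xi> \<Longrightarrow> fourier (if k = 0 then \<Phi> else \<phi>) \<xi> = 0"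
proof -
  define \<psi> where "\<psi> = (if k = 0 then \<Phi> else \<phi>)"
  show "(if k = 0 then \<Phi> else \<phi>) \<in> schwartz" using assms by (simp add: admissible_pair_def)
  assume "2 < norm \<xi>"
  moreover have "\<xi> \<in> closure {\<xi>. fourier \<psi> \<xi> \<noteq> 0} \<Longrightarrow> norm \<xi> \<le> 2"
    using assms by (auto simp: admissible_pair_def \<psi>_def split: if_splits)
  ultimately show "fourier (if k = 0 then \<Phi> else \<phi>) \<xi> = 0"
    unfolding \<psi>_def[symmetric] using closure_subset[of "{\<xi>. fourier \<psi> \<xi> \<noteq> 0}"] by force
qed

lemma lp_kernel_schwartz:
  "admissible_pair \<Phi> \<phi> \<Longrightarrow> lp_kernel \<Phi> \<phi> k \<in> schwartz"
  unfolding lp_kernel_eq by (intro schwartz_affine admissible_pair_cases) auto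

lemma lp_block_measurable:
  assumes "admissible_pair \<Phi> \<phi>" "f \<in> tempered_distributions"
  shows "lp_block \<Phi> \<phi> f k \<in> borel_measurable borel"
proof -
  have [measurable]: "conv_distr (lp_kernel \<Phi> \<phi> k) f \<in> borel_measurable borel"
    by (intro borel_measurable_continuous_onI continuous_conv_distr lp_kernel_schwartz assms)
  show ?thesis unfolding lp_block_def[abs_def] by measurable
qed

text \<open>By dilation, the kernel at level k satisfies on the grid of step 2^-k the formula that
  \<Phi> or \<phi> satisfies on the unit grid; \<open>conv_distr_sampling\<close> transfers it to
  the block.\<close>

lemma lp_block_sampling:
  fixes \<Phi> \<phi> :: "'n::finite cfun" and c :: "int \<Rightarrow> complex"
  assumes adm: "admissible_pair \<Phi> \<phi>" and f: "f \<in> tempered_distributions" and s: "s \<in> {0..1}"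
    and c: "\<And>M. \<exists>C. \<forall>m. norm (c m) * (1 + \<bar>real_of_int m\<bar>) ^ M \<le> C"
    and one: "\<And>\<xi>. \<bar>\<xi>\<bar> \<le> 2 \<Longrightarrow> (\<lambda>n. c (int_decode n) * exp (\<i> * of_real ((of_int (int_decode n) + s) * \<xi>))) sums 1"
  shows "lp_block \<Phi> \<phi> f k x \<le> tsum (\<lambda>m. ennreal (norm (c m)) *
    lp_block \<Phi> \<phi> f k (x + (2 powr (- real k) * (s + of_int m)) *\<^sub>R axis i 1))"
proof -
  define d where "d n = c (int_decode n)" for n
  define b where "b n = of_int (int_decode n) + s" for n
  define \<delta> where "\<delta> = 2 powr (- real k)"
  have \<delta>: "0 < \<delta>" "\<delta> \<le> 1" "2 ^ k * \<delta> = 1"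
  proof -
    have "2 powr (- real k) \<le> (2::real) powr 0" by (rule powr_mono) auto
    then show "\<delta> \<le> 1" by (simp add: \<delta>_def)
    show "0 < \<delta>" by (simp add: \<delta>_def)
    show "2 ^ k * \<delta> = 1" by (simp add: \<delta>_def powr_minus powr_realpow)
  qed
  define \<psi> where "\<psi> = (if k = 0 then \<Phi> else \<phi>)"
  define K where "K = lp_kernel \<Phi> \<phi> k"
  have K: "K \<in> schwartz" unfolding K_def by (rule lp_kernel_schwartz[OF adm])
  have sm: "summable (\<lambda>n. norm (d n) * (1 + norm ((\<delta> * b n) *\<^sub>R (axis i 1 :: (real, 'n) vec))) ^ m)" for m
  proof -
    \<comment> \<open>Of the m + 2 powers of decay, m absorb the polynomial weight and two make the
      series converge.\<close>
    obtain C where C: "\<And>j. norm (c j) * (1 + \<bar>real_of_int j\<bar>) ^ (m + 2) \<le> C" using c by blast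
    show ?thesis
    proof (rule summable_comparison_test)
      show "summable (\<lambda>n. (2 ^ m * C) * (1 / (1 + \<bar>real_of_int (int_decode n)\<bar>)\<^sup>2))"
        by (intro summable_mult norm_int_decode_summable)
      have "norm (d n) * (1 + norm ((\<delta> * b n) *\<^sub>R (axis i 1 :: (real, 'n) vec))) ^ m \<le> (2 ^ m * C) * (1 / (1 + \<bar>real_of_int (int_decode n)\<bar>)\<^sup>2)" for n
      proof -
        define a where "a = 1 + \<bar>real_of_int (int_decode n)\<bar>"
        have a: "1 \<le> a" by (simp add: a_def)
        have "\<bar>\<delta> * b n\<bar> \<le> 1 * \<bar>b n\<bar>" unfolding abs_mult using \<delta> by (intro mult_right_mono) auto
        also have "\<bar>b n\<bar> \<le> a" using s by (auto simp: b_def a_def)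
        finally have "1 + norm ((\<delta> * b n) *\<^sub>R (axis i 1 :: (real, 'n) vec)) \<le> 2 * a" using a by simp
        then have "norm (d n) * (1 + norm ((\<delta> * b n) *\<^sub>R (axis i 1 :: (real, 'n) vec))) ^ m \<le> norm (d n) * (2 * a) ^ m"
          by (intro mult_left_mono power_mono) auto
        also have "\<dots> = 2 ^ m * (norm (c (int_decode n)) * a ^ (m + 2)) * (1 / a\<^sup>2)"
          using a by (simp add: d_def power_mult_distrib power_add power2_eq_square)
        also have "\<dots> \<le> 2 ^ m * C * (1 / a\<^sup>2)"
          unfolding a_def by (intro mult_right_mono mult_left_mono C) auto
        finally show ?thesis unfolding a_def .
      qed
      then show "\<exists>N. \<forall>n\<ge>N. norm (norm (d n) * (1 + norm ((\<delta> * b n) *\<^sub>R (axis i 1 :: (real, 'n) vec))) ^ m) \<le> (2 ^ m * C) * (1 / (1 + \<bar>real_of_int (int_decode n)\<bar>)\<^sup>2)"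
        by simp
    qed
  qed
  have dn: "summable (\<lambda>n. norm (d n))" using sm[of 0] by simp
  have sK: "(\<lambda>n. d n * K (y + (\<delta> * b n) *\<^sub>R axis i 1)) sums K y" for y
  proof -
    have "(\<lambda>n. d n * \<psi> (2 ^ k *\<^sub>R y + b n *\<^sub>R axis i 1)) sums \<psi> (2 ^ k *\<^sub>R y)"
      unfolding \<psi>_def
    proof (rule schwartz_sampling[OF admissible_pair_cases[OF adm] dn])
      show "(\<lambda>n. d n * exp (\<i> * of_real (b n * \<xi>))) sums 1" if "\<bar>\<xi>\<bar> \<le> 2" for \<xi>
        unfolding d_def b_def by (rule one[OF that])
    qed
    then have "(\<lambda>n. 2 ^ (k * CARD('n)) * (d n * \<psi> (2 ^ k *\<^sub>R y + b n *\<^sub>R axis i 1))) sums (2 ^ (k * CARD('n)) * \<psi> (2 ^ k *\<^sub>R y))"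
      by (rule sums_mult)
    moreover have "2 ^ k *\<^sub>R (y + (\<delta> * b n) *\<^sub>R axis i 1) = 2 ^ k *\<^sub>R y + b n *\<^sub>R axis i 1" for n
      using \<delta>(3) by (simp add: scaleR_add_right mult.assoc[symmetric])
    ultimately show ?thesis
      unfolding K_def lp_kernel_eq \<psi>_def[symmetric] by (simp add: mult.left_commute)
  qed
  have "ennreal (norm (conv_distr K f x)) \<le> tsum (\<lambda>n. ennreal (norm (d n * conv_distr K f (x + (\<delta> * b n) *\<^sub>R axis i 1))))"
    by (rule norm_sums_le_tsum[OF conv_distr_sampling[OF K f sm sK]])
  also have "\<dots> = tsum (\<lambda>n. (\<lambda>m. ennreal (norm (c m)) * lp_block \<Phi> \<phi> f k (x + (\<delta> * (s + of_int m)) *\<^sub>R axis i 1)) (int_decode n))"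
    by (simp add: norm_mult ennreal_mult lp_block_def K_def d_def b_def add.commute)
  also have "\<dots> = tsum (\<lambda>m. ennreal (norm (c m)) * lp_block \<Phi> \<phi> f k (x + (\<delta> * (s + of_int m)) *\<^sub>R axis i 1))"
    by (rule nn_integral_bij_count_space[OF bij_int_decode])
  finally show ?thesis by (simp add: lp_block_def K_def \<delta>_def)
qed

text \<open>Since r < 1, the r-th power goes inside the sampling sum, and the coefficients are
  bounded uniformly in s. The weights are chosen before f, k and i, so the final constant does not
  depend on f.\<close>

lemma lp_block_sub_mean:
  fixes \<Phi> \<phi> :: "'n::finite cfun"
  assumes adm: "admissible_pair \<Phi> \<phi>" and r: "0 < r" "r < 1"
  shows "\<exists>w c. 0 \<le> c \<and> (\<forall>m. w m \<le> ennreal (c / (1 + \<bar>real_of_int m\<bar>) ^ 2)) \<and>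
    (\<forall>f\<in>tempered_distributions. \<forall>k i. slice_sub_mean r w (2 powr (- real k)) i (lp_block \<Phi> \<phi> f k))"
proof -
  obtain c :: "real \<Rightarrow> int \<Rightarrow> complex" where
    c: "\<And>M. \<exists>C. \<forall>s\<in>{0..1}. \<forall>m. norm (c s m) * (1 + \<bar>real_of_int m\<bar>) ^ M \<le> C"
    and one: "\<And>s \<xi>. s \<in> {0..1} \<Longrightarrow> \<bar>\<xi>\<bar> \<le> 2 \<Longrightarrow>
      (\<lambda>n. c s (int_decode n) * exp (\<i> * of_real ((of_int (int_decode n) + s) * \<xi>))) sums 1"
    using sampling_coefficients by blast
  \<comment> \<open>Decay of order M in the coefficients becomes decay of order M r \<ge> 2 in their
    r-th powers.\<close>
  define M where "M = nat \<lceil>2 / r\<rceil>"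
  have M: "2 \<le> real M * r" using r unfolding M_def by (simp add: pos_divide_le_eq[symmetric])
  obtain C where C: "\<And>s m. s \<in> {0..1} \<Longrightarrow> norm (c s m) * (1 + \<bar>real_of_int m\<bar>) ^ M \<le> C" using c by blast
  have C0: "0 \<le> C" using C[of 0 0] by (auto intro: order_trans[rotated])
  define w where "w m = ennreal (C powr r / (1 + \<bar>real_of_int m\<bar>) ^ 2)" for m
  have cw: "enn_powr (ennreal (norm (c s m))) r \<le> w m" if s: "s \<in> {0..1}" for s m
  proof -
    define a where "a = 1 + \<bar>real_of_int m\<bar>"
    have a: "1 \<le> a" by (simp add: a_def)
    have "norm (c s m) \<le> C / a ^ M"
      using C[OF s, of m] a unfolding a_def[symmetric] by (simp add: le_divide_eq)
    then have "norm (c s m) powr r \<le> (C / a ^ M) powr r" using r by (intro powr_mono2) auto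
    also have "\<dots> = C powr r / a powr (real M * r)"
      using a C0 by (simp add: powr_divide powr_powr powr_realpow[symmetric])
    also have "\<dots> \<le> C powr r / a powr 2"
      using a M by (intro divide_left_mono powr_mono) auto
    also have "a powr 2 = a ^ 2" using a by (simp add: powr_numeral)
    finally show ?thesis by (simp add: enn_powr_ennreal w_def a_def ennreal_leI)
  qed
  have "slice_sub_mean r w (2 powr (- real k)) i (lp_block \<Phi> \<phi> f k)" if f: "f \<in> tempered_distributions" for f k i
    unfolding slice_sub_mean_def sub_mean_def upd_add
  proof (intro allI ballI)
    fix x and t s :: real assume "s \<in> {0..<1}"
    then have s: "s \<in> {0..1}" by auto
    define y where "y = upd x i t"
    have "lp_block \<Phi> \<phi> f k y \<le> tsum (\<lambda>m. ennreal (norm (c s m)) * lp_block \<Phi> \<phi> f k (y + (2 powr (- real k) * (s + of_int m)) *\<^sub>R axis i 1))"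
      using c s by (intro lp_block_sampling[OF adm f s _ one[OF s]]) blast
    then have "enn_powr (lp_block \<Phi> \<phi> f k y) r \<le> enn_powr (tsum (\<lambda>m. ennreal (norm (c s m)) * lp_block \<Phi> \<phi> f k (y + (2 powr (- real k) * (s + of_int m)) *\<^sub>R axis i 1))) r"
      using r by (intro enn_powr_mono) auto
    also have "\<dots> \<le> tsum (\<lambda>m. enn_powr (ennreal (norm (c s m)) * lp_block \<Phi> \<phi> f k (y + (2 powr (- real k) * (s + of_int m)) *\<^sub>R axis i 1)) r)"
      by (rule tsum_powr_subadd[OF r])
    also have "\<dots> \<le> tsum (\<lambda>m. w m * enn_powr (lp_block \<Phi> \<phi> f k (y + (2 powr (- real k) * (s + of_int m)) *\<^sub>R axis i 1)) r)"
      unfolding enn_powr_mult by (intro nn_integral_mono mult_right_mono cw s) auto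
    finally show "enn_powr (lp_block \<Phi> \<phi> f k (upd x i t)) r \<le> tsum (\<lambda>m. w m * enn_powr (lp_block \<Phi> \<phi> f k (upd x i t + (2 powr (- real k) * (s + of_int m)) *\<^sub>R axis i 1)) r)"
      unfolding y_def .
  qed
  then show ?thesis
    by (intro exI[of _ w] exI[of _ "C powr r"]) (auto simp: w_def)
qed

section \<open>The two embeddings\<close>

lemma cont_embeddedI:
  assumes "\<And>f. f \<in> tempered_distributions \<Longrightarrow> N' f \<le> ennreal C * N f"
  shows "cont_embedded N N'"
proof -
  \<comment> \<open>\<open>cont_embedded\<close> asks for a positive constant, hence the maximum
    with 1.\<close>
  have le: "N' f \<le> ennreal (max 1 C) * N f" if "f \<in> tempered_distributions" for f
    by (rule order_trans[OF assms[OF that]]) (intro mult_right_mono ennreal_leI, auto)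
  moreover have "N' f < \<infinity>" if "f \<in> tempered_distributions" "N f < \<infinity>" for f
    using le[OF that(1)] that(2) by (auto simp: ennreal_mult_less_top intro: le_less_trans)
  ultimately show ?thesis
    unfolding cont_embedded_def distr_space_def by (auto intro!: exI[of _ "max 1 C"])
qed

lemma lq_norm_antimono:
  assumes r: "0 < r" "ennreal r < \<theta>"
  shows "lq_norm \<theta> a \<le> lq_norm (ennreal r) a"
proof (cases "\<theta> = \<infinity>")
  case True
  have "a k \<le> lq_norm (ennreal r) a" for k
    using r tsum_ge[of "\<lambda>k. enn_powr (a k) r" k] by (simp add: lq_norm_ennreal enn_powr_le_iff[symmetric])
  then show ?thesis using True by (auto simp: lq_norm_def intro: SUP_least)
next
  case False
  then obtain t where t: "\<theta> = ennreal t" "0 \<le> t" by (cases \<theta>) auto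
  then have rt: "r < t" using r by (simp add: ennreal_less_iff)
  have "enn_powr (tsum (\<lambda>k. enn_powr (a k) t)) (1 / t) \<le> enn_powr (enn_powr (tsum (\<lambda>k. enn_powr (a k) r)) (t / r)) (1 / t)"
    using r rt by (intro enn_powr_mono tsum_powr_le) auto
  then show ?thesis using r rt by (simp add: t lq_norm_ennreal enn_powr_powr)
qed

lemma mixed_herz_norm_le_mixed_Lp_norm:
  fixes p q :: "'n::{finite,linorder} \<Rightarrow> real"
  assumes "\<And>i. 0 < q i" "\<And>i. q i < p i" "H \<in> borel_measurable borel"
  shows "mixed_herz_norm (\<lambda>i. ennreal (q i)) (\<lambda>i. 0) (\<lambda>i. ennreal (p i)) H \<le> mixed_Lp_norm (\<lambda>i. ennreal (q i)) H"
proof -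
  have p: "0 < p i" for i using assms(1,2)[of i] by simp
  have "fold (coord_norm (\<lambda>i. herz_norm (ennreal (q i)) 0 (ennreal (p i)))) l H y \<le>
    fold (coord_norm (\<lambda>i. Lp_norm (ennreal (q i)))) l H y" for l y
    using assms(3)
  proof (induction l arbitrary: H)
    case (Cons i l)
    note [measurable] = Cons.prems
    have "fold (coord_norm (\<lambda>i. herz_norm (ennreal (q i)) 0 (ennreal (p i)))) (i # l) H y \<le>
      fold (coord_norm (\<lambda>i. herz_norm (ennreal (q i)) 0 (ennreal (p i)))) l (coord_norm (\<lambda>i. Lp_norm (ennreal (q i))) i H) y"
      unfolding fold_Cons o_apply
    proof (rule fold_coord_norm_mono)
      show "herz_norm (ennreal (q i)) 0 (ennreal (p i)) g \<le> herz_norm (ennreal (q i)) 0 (ennreal (p i)) h"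
        if "\<And>t. g t \<le> h t" for i g h
        using that assms(1) p by (intro herz_norm_mono) auto
      show "coord_norm (\<lambda>i. herz_norm (ennreal (q i)) 0 (ennreal (p i))) i H x \<le> coord_norm (\<lambda>i. Lp_norm (ennreal (q i))) i H x" for x
        unfolding coord_norm_upd by (intro herz_norm_le_Lp_norm assms) simp
    qed
    also have "\<dots> \<le> fold (coord_norm (\<lambda>i. Lp_norm (ennreal (q i)))) (i # l) H y"
      unfolding fold_Cons o_apply by (rule Cons.IH[OF measurable_coord_Lp_norm[OF assms(1) Cons.prems]])
    finally show ?case .
  qed simp
  then show ?thesis unfolding mixed_herz_norm_def mixed_Lp_norm_def mixed_norm_def .
qed

theorem corollary6p25:
  fixes s1 s2 :: real and \<theta> :: ennreal
    and p q :: "'n::{finite,linorder} \<Rightarrow> real"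
    and \<Phi> \<phi> :: "'n cfun"
  assumes "admissible_pair \<Phi> \<phi>"
    and "0 < \<theta>"
    and "\<And>i. 0 < q i" and "\<And>i. q i < p i"
    and "s1 - (\<Sum>i\<in>UNIV. 1 / p i) = s2 - (\<Sum>i\<in>UNIV. 1 / q i)"
  shows "cont_embedded
      (besov_norm \<Phi> \<phi> (\<lambda>i. ennreal (q i)) s2 (ennreal (p (Max UNIV))))
      (herz_besov_norm \<Phi> \<phi> (\<lambda>i. ennreal (q i)) (\<lambda>i. 0) (\<lambda>i. ennreal (p i)) s2
        (ennreal (p (Max UNIV)))) \<and>
    cont_embedded
      (herz_besov_norm \<Phi> \<phi> (\<lambda>i. ennreal (q i)) (\<lambda>i. 0) (\<lambda>i. ennreal (p i)) s2
        (ennreal (p (Max UNIV))))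
      (triebel_lizorkin_norm \<Phi> \<phi> (\<lambda>i. ennreal (p i)) s1 \<theta>)"
proof
  have p: "0 < p i" for i using assms(3,4)[of i] by simp
  show "cont_embedded
      (besov_norm \<Phi> \<phi> (\<lambda>i. ennreal (q i)) s2 (ennreal (p (Max UNIV))))
      (herz_besov_norm \<Phi> \<phi> (\<lambda>i. ennreal (q i)) (\<lambda>i. 0) (\<lambda>i. ennreal (p i)) s2
        (ennreal (p (Max UNIV))))"
  proof (rule cont_embeddedI[where C = 1])
    fix f assume f: "f \<in> (tempered_distributions :: 'n functional set)"
    show "herz_besov_norm \<Phi> \<phi> (\<lambda>i. ennreal (q i)) (\<lambda>i. 0) (\<lambda>i. ennreal (p i)) s2 (ennreal (p (Max UNIV))) f \<le>
      ennreal 1 * besov_norm \<Phi> \<phi> (\<lambda>i. ennreal (q i)) s2 (ennreal (p (Max UNIV))) f"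
      unfolding herz_besov_norm_def besov_norm_def ennreal_1 mult_1
      by (intro lq_norm_mono p mult_left_mono mixed_herz_norm_le_mixed_Lp_norm assms(3,4) lp_block_measurable assms(1) f) simp
  qed
  obtain r0 where r0: "0 < r0" "ennreal r0 < \<theta>"
  proof (cases \<theta>)
    case (real t)
    then have "ennreal (t / 2) < \<theta>" "0 < t / 2" using assms(2) by (auto simp: ennreal_less_iff)
    then show ?thesis using that by blast
  next
    case top
    then show ?thesis using that[of 1] by simp
  qed
  \<comment> \<open>r has to lie strictly below 1, \<theta> and all q_i; halving gives the strict
    inequalities for 1 and q_i, while r0 is already strictly below \<theta>.\<close>
  define r where "r = min (1 / 2) (min r0 (Min (range q) / 2))"
  have Mq: "0 < Min (range q)" "\<And>i. Min (range q) \<le> q i" using assms(3) by auto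
  have r: "0 < r" "r < 1" "\<And>i. r < q i"
  proof -
    show "0 < r" "r < 1" using r0 Mq(1) by (auto simp: r_def)
    have "r \<le> Min (range q) / 2" unfolding r_def by (intro min.coboundedI2 order_refl)
    then show "r < q i" for i using Mq(1) Mq(2)[of i] by linarith
  qed
  have "ennreal r \<le> ennreal r0" by (intro ennreal_leI) (simp add: r_def)
  then have r\<theta>: "ennreal r < \<theta>" using r0(2) by (rule le_less_trans)
  obtain w c where c: "0 \<le> c" and w: "\<And>m. w m \<le> ennreal (c / (1 + \<bar>real_of_int m\<bar>) ^ 2)"
    and sm: "\<And>f k i. f \<in> tempered_distributions \<Longrightarrow> slice_sub_mean r w (2 powr (- real k)) i (lp_block \<Phi> \<phi> f k)"
    using lp_block_sub_mean[OF assms(1) r(1,2)] by blast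
  show "cont_embedded
      (herz_besov_norm \<Phi> \<phi> (\<lambda>i. ennreal (q i)) (\<lambda>i. 0) (\<lambda>i. ennreal (p i)) s2
        (ennreal (p (Max UNIV))))
      (triebel_lizorkin_norm \<Phi> \<phi> (\<lambda>i. ennreal (p i)) s1 \<theta>)"
  proof (rule cont_embeddedI)
    fix f assume f: "f \<in> (tempered_distributions :: 'n functional set)"
    \<comment> \<open>Lowering the sequence exponent from \<theta> to r only enlarges the norm, so
      one small r serves all \<theta>-norms at once.\<close>
    have "triebel_lizorkin_norm \<Phi> \<phi> (\<lambda>i. ennreal (p i)) s1 \<theta> f \<le>
      mixed_Lp_norm (\<lambda>i. ennreal (p i)) (\<lambda>x. lq_norm (ennreal r) (\<lambda>k. ennreal (2 powr (real k * s1)) * lp_block \<Phi> \<phi> f k x))"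
      unfolding triebel_lizorkin_norm_def mixed_Lp_norm_def mixed_norm_def
      by (intro fold_coord_norm_mono Lp_norm_mono p lq_norm_antimono r(1) r\<theta>)
    also have "\<dots> \<le> ennreal (\<Prod>i\<leftarrow>sorted_list_of_set UNIV. franke_const c r (q i) (p i)) *
      lq_norm (ennreal (p (Max UNIV))) (\<lambda>k. ennreal (2 powr (real k * s2)) *
       mixed_herz_norm (\<lambda>i. ennreal (q i)) (\<lambda>i. 0) (\<lambda>i. ennreal (p i)) (lp_block \<Phi> \<phi> f k))"
      by (rule mixed_Lp_norm_le_mixed_herz_norm[OF r(1,3) assms(4) c w lp_block_measurable[OF assms(1) f] sm[OF f] assms(5)])
    finally show "triebel_lizorkin_norm \<Phi> \<phi> (\<lambda>i. ennreal (p i)) s1 \<theta> f \<le>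
      ennreal (\<Prod>i\<leftarrow>sorted_list_of_set UNIV. franke_const c r (q i) (p i)) *
      herz_besov_norm \<Phi> \<phi> (\<lambda>i. ennreal (q i)) (\<lambda>i. 0) (\<lambda>i. ennreal (p i)) s2 (ennreal (p (Max UNIV))) f"
      unfolding herz_besov_norm_def .
  qed
qed

end
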